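(* Let $\Omega\subset\mathbb{R}^N$ ($N\ge1$) be a bounded domain with smooth boundary. Assume that $a,f,g:[0,+\infty)\to\mathbb{R}$ are continuous functions, that $f,g\in L^\infty([0,+\infty))$, and that for some constant $a_0>0$ $$\inf_{t\in[0,+\infty)}a(t)\ge a_0,\qquad \inf_{t\in[0,+\infty)}f(t)\ge a_0,\qquad \inf_{t\in[0,+\infty)}g(t)\ge a_0 .$$ Let $p,q,r,\beta\in[1,+\infty)$ and $\alpha\in[0,1)$. Then the nonlocal problem $$\begin{cases}-a\bigl(\int_\Omega|u|^q\,dx\bigr)\Delta u=f\bigl(\int_\Omega|u|^p\,dx\bigr)u^\alpha-g\bigl(\int_\Omega|u|^r\,dx\bigr)u^\beta & \text{in }\Omega,\\ u(x)>0 & \text{in }\Omega,\\ u=0 & \text{on }\partial\Omega,\end{cases}$$ has a (weak) solution.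
   Context: A (weak) solution of the problem is a function $u\in H_0^1(\Omega)\cap L^\infty(\Omega)$ with $u>0$ a.e. in $\Omega$ such that $$a\Bigl(\int_\Omega|u|^q\,dx\Bigr)\int_\Omega\nabla u\cdot\nabla\phi\,dx=f\Bigl(\int_\Omega|u|^p\,dx\Bigr)\int_\Omega u^\alpha\phi\,dx-g\Bigl(\int_\Omega|u|^r\,dx\Bigr)\int_\Omega u^\beta\phi\,dx$$ for all $\phi\in H_0^1(\Omega)$. *)

theory Defs
  imports "HOL-Analysis.Analysis"
begin

primrec Ck :: "nat \<Rightarrow> ('a::euclidean_space \<Rightarrow> real) \<Rightarrow> bool" where
  "Ck 0 \<phi> \<longleftrightarrow> continuous_on UNIV \<phi>"
| "Ck (Suc k) \<phi> \<longleftrightarrow>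
     (\<forall>x. \<phi> differentiable at x) \<and>
     (\<forall>b\<in>Basis. Ck k (\<lambda>x. frechet_derivative \<phi> (at x) b))"

definition smooth :: "('a::euclidean_space \<Rightarrow> real) \<Rightarrow> bool" where
  "smooth \<phi> \<longleftrightarrow> (\<forall>k. Ck k \<phi>)"

definition test_functions :: "'a::euclidean_space set \<Rightarrow> ('a \<Rightarrow> real) set" where
  "test_functions \<Omega> =
     {\<phi>. smooth \<phi> \<and> compact (closure {x. \<phi> x \<noteq> 0}) \<and> closure {x. \<phi> x \<noteq> 0} \<subseteq> \<Omega>}"

text \<open>Near each boundary point, the set is the part of a ball lying strictly above the graph of
  a smooth function over the hyperplane orthogonal to a unit vector \<open>e\<close>. The function
  \<open>\<gamma>\<close> is defined on the whole space, but only its values on that hyperplane are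
  used. In dimension one the hyperplane is a point and \<open>\<gamma>\<close> amounts to a constant.\<close>

definition smooth_boundary :: "'a::euclidean_space set \<Rightarrow> bool" where
  "smooth_boundary \<Omega> \<longleftrightarrow>
     (\<forall>x0\<in>frontier \<Omega>. \<exists>\<rho>>0. \<exists>e \<gamma>. norm e = 1 \<and> smooth \<gamma> \<and>
        \<Omega> \<inter> ball x0 \<rho> = {x \<in> ball x0 \<rho>. \<gamma> (x - (x \<bullet> e) *\<^sub>R e) < x \<bullet> e})"

text \<open>Elements of the function spaces below are representatives: functions on the whole space
  whose values outside \<open>\<Omega>\<close> (and on null sets) are irrelevant.\<close>

definition L2 :: "'b measure \<Rightarrow> ('b \<Rightarrow> 'c::euclidean_space) set" where
  "L2 M = {u \<in> borel_measurable M. integrable M (\<lambda>x. (norm (u x))\<^sup>2)}"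

definition Linfty :: "'b measure \<Rightarrow> ('b \<Rightarrow> real) set" where
  "Linfty M = {u \<in> borel_measurable M. \<exists>C. AE x in M. \<bar>u x\<bar> \<le> C}"

definition L1_loc :: "'a::euclidean_space set \<Rightarrow> ('a \<Rightarrow> 'c::euclidean_space) set" where
  "L1_loc \<Omega> = {u. \<forall>K. compact K \<and> K \<subseteq> \<Omega> \<longrightarrow> u absolutely_integrable_on K}"

definition has_weak_gradient ::
  "'a::euclidean_space set \<Rightarrow> ('a \<Rightarrow> real) \<Rightarrow> ('a \<Rightarrow> 'a) \<Rightarrow> bool" where
  "has_weak_gradient \<Omega> u G \<longleftrightarrow> u \<in> L1_loc \<Omega> \<and> G \<in> L1_loc \<Omega> \<and>
     (\<forall>\<phi>\<in>test_functions \<Omega>. \<forall>b\<in>Basis.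
        (LINT x|lebesgue_on \<Omega>. u x * frechet_derivative \<phi> (at x) b) =
        - (LINT x|lebesgue_on \<Omega>. (G x \<bullet> b) * \<phi> x))"

text \<open>On an open set the weak gradient is unique up to null sets, so integrals involving
  \<open>weak_gradient\<close> do not depend on the choice made here.\<close>

definition weak_gradient :: "'a::euclidean_space set \<Rightarrow> ('a \<Rightarrow> real) \<Rightarrow> 'a \<Rightarrow> 'a" where
  "weak_gradient \<Omega> u = (SOME G. has_weak_gradient \<Omega> u G)"

definition H1 :: "'a::euclidean_space set \<Rightarrow> ('a \<Rightarrow> real) set" where
  "H1 \<Omega> = {u \<in> L2 (lebesgue_on \<Omega>). \<exists>G \<in> L2 (lebesgue_on \<Omega>). has_weak_gradient \<Omega> u G}"

definition H1_norm :: "'a::euclidean_space set \<Rightarrow> ('a \<Rightarrow> real) \<Rightarrow> real" where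
  "H1_norm \<Omega> u =
     sqrt ((LINT x|lebesgue_on \<Omega>. (u x)\<^sup>2) +
           (LINT x|lebesgue_on \<Omega>. (norm (weak_gradient \<Omega> u x))\<^sup>2))"

definition H10 :: "'a::euclidean_space set \<Rightarrow> ('a \<Rightarrow> real) set" where
  "H10 \<Omega> = {u \<in> H1 \<Omega>. \<forall>\<epsilon>>0. \<exists>\<phi>\<in>test_functions \<Omega>. H1_norm \<Omega> (\<lambda>x. u x - \<phi> x) < \<epsilon>}"

text \<open>The junk values of \<open>powr\<close> at nonpositive bases play no role, since
  \<open>u > 0\<close> almost everywhere.\<close>

definition weak_solution ::
  "'a::euclidean_space set \<Rightarrow> (real \<Rightarrow> real) \<Rightarrow> (real \<Rightarrow> real) \<Rightarrow> (real \<Rightarrow> real) \<Rightarrow>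
   real \<Rightarrow> real \<Rightarrow> real \<Rightarrow> real \<Rightarrow> real \<Rightarrow> ('a \<Rightarrow> real) \<Rightarrow> bool" where
  "weak_solution \<Omega> a f g p q r \<alpha> \<beta> u \<longleftrightarrow>
     u \<in> H10 \<Omega> \<and> u \<in> Linfty (lebesgue_on \<Omega>) \<and> (AE x in lebesgue_on \<Omega>. u x > 0) \<and>
     (\<forall>\<phi>\<in>H10 \<Omega>.
        a (LINT x|lebesgue_on \<Omega>. \<bar>u x\<bar> powr q) *
          (LINT x|lebesgue_on \<Omega>. weak_gradient \<Omega> u x \<bullet> weak_gradient \<Omega> \<phi> x) =
        f (LINT x|lebesgue_on \<Omega>. \<bar>u x\<bar> powr p) * (LINT x|lebesgue_on \<Omega>. u x powr \<alpha> * \<phi> x) -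
        g (LINT x|lebesgue_on \<Omega>. \<bar>u x\<bar> powr r) * (LINT x|lebesgue_on \<Omega>. u x powr \<beta> * \<phi> x))"

end

theory Submission imports Defs begin

text \<open>
  For constants \<open>l, \<mu> > 0\<close> consider the local problem \<open>- \<Delta>u = l u\<^sup>\<alpha> - \<mu> u\<^sup>\<beta>\<close> with zero boundary values.
  If \<open>m\<close> satisfies \<open>l m\<^sup>\<alpha> \<le> \<mu> m\<^sup>\<beta>\<close>, then there is a largest solution with values in \<open>[0, m]\<close>, it is positive,
  and it depends continuously on \<open>(l, \<mu>)\<close>. The nonlocal problem thereby becomes a fixed point problem
  in \<open>\<real>\<^sup>3\<close>: send \<open>(t\<^sub>1, t\<^sub>2, t\<^sub>3)\<close> to the integrals of \<open>u\<^sup>q, u\<^sup>p, u\<^sup>r\<close>, where \<open>u\<close> is the largest solution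
  for \<open>l = f(t\<^sub>2) / a(t\<^sub>1)\<close> and \<open>\<mu> = g(t\<^sub>3) / a(t\<^sub>1)\<close>. As \<open>f\<close> is bounded above and \<open>g\<close> is bounded below by \<open>a0 > 0\<close>,
  one constant \<open>m\<close> serves for all \<open>t\<close>. So the three integrals stay in a fixed box, and Brouwer's
  theorem applies.

  The largest solution is the limit of an iteration from above (\<open>maximal_solution\<close>). For large \<open>k\<close> the
  function \<open>s \<mapsto> l s\<^sup>\<alpha> - \<mu> s\<^sup>\<beta> + k s\<close> is increasing on \<open>[0, m]\<close>. The operator \<open>- \<Delta> + k\<close> is inverted by an
  orthogonal projection (\<open>L2_projection\<close>, \<open>resolvent_exists\<close>), and its inverse preserves order by the weak
  maximum principle, whose proof tests with a truncation (\<open>H10_graph_truncate\<close>). Hence the iterates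
  decrease, and every subsolution with values in \<open>[0, m]\<close> stays below them. The monotone pointwise limit is also
  a limit in \<open>L\<^sup>2\<close>, which suffices to pass to the limit in the equation because the
  inverse is continuous on \<open>L\<^sup>2\<close>.

  Maximality over subsolutions carries the rest. Small multiples of the bump
  \<open>exp (- 1 / (R\<^sup>2 - \<bar>x - c\<bar>\<^sup>2))\<close> on a ball in \<open>\<Omega>\<close> are subsolutions because \<open>\<alpha> < 1\<close>, so the largest solution is positive
  (\<open>ball_subsolution\<close>). If \<open>u\<close> solves the problem for \<open>(l, \<mu>)\<close> and \<open>0 < t < 1\<close>, then \<open>t u\<close> is a subsolution for all
  parameters near \<open>(l, \<mu>)\<close>, again because \<open>\<alpha> < 1 \<le> \<beta>\<close>. So the largest solutions \<open>u\<close> and \<open>u'\<close> for nearby parameters satisfy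
  \<open>t u \<le> u'\<close> and \<open>t u' \<le> u\<close>, which is the continuity (\<open>scaled_maximal_le\<close>, \<open>maximal_tendsto_AE\<close>).

  A function in \<open>H\<^sub>0\<^sup>1\<close> is handled together with its weak gradient, as one square integrable map
  into \<open>\<real> \<times> \<real>\<^sup>N\<close>. In this form \<open>H\<^sub>0\<^sup>1\<close> is the closure of the graphs of test functions in \<open>L\<^sup>2\<close>
  (\<open>H10_imp_graph\<close>, \<open>H10_graph_imp\<close>); this rests on the uniqueness of weak gradients
  (\<open>weak_gradient_unique_AE\<close>).
\<close>

section \<open>Smooth functions and test functions\<close>

lemma frechet_derivative_eqI:
  "(f has_derivative f') (at x) \<Longrightarrow> frechet_derivative f (at x) = f'"
  by (metis frechet_derivative_at)

lemma Ck_Suc_D: "Ck (Suc k) \<phi> \<Longrightarrow> Ck k \<phi>"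
proof (induction k arbitrary: \<phi>)
  case 0
  then have "\<forall>x. \<phi> differentiable at x" by (metis Ck.simps(2))
  then show ?case
    by (simp add: continuous_on_eq_continuous_at differentiable_imp_continuous_within)
next
  case (Suc k)
  then show ?case by (metis Ck.simps(2))
qed

lemma Ck_SucI:
  assumes "\<And>x. (\<phi> has_derivative \<phi>' x) (at x)" and "\<And>b. b \<in> Basis \<Longrightarrow> Ck k (\<lambda>x. \<phi>' x b)"
  shows "Ck (Suc k) \<phi>"
proof -
  have "frechet_derivative \<phi> (at x) = \<phi>' x" for x
    using assms(1) by (rule frechet_derivative_eqI)
  with assms show ?thesis
    by (auto simp: differentiable_def)
qed

lemma Ck_SucE:
  assumes "Ck (Suc k) \<phi>"
  shows "(\<phi> has_derivative frechet_derivative \<phi> (at x)) (at x)"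
    and "b \<in> Basis \<Longrightarrow> Ck k (\<lambda>x. frechet_derivative \<phi> (at x) b)"
  using assms by (auto simp: frechet_derivative_works)

lemma Ck_const: "Ck k (\<lambda>x. c)"
proof (induction k arbitrary: c)
  case (Suc k)
  show ?case by (rule Ck_SucI[where \<phi>'="\<lambda>x h. 0"]) (auto intro: Suc)
qed simp

lemma Ck_inner: "Ck k (\<lambda>x. x \<bullet> a)"
proof (cases k)
  case (Suc k')
  show ?thesis unfolding Suc
    by (rule Ck_SucI[where \<phi>'="\<lambda>x h. h \<bullet> a"]) (auto intro!: derivative_eq_intros Ck_const)
qed (auto intro!: continuous_intros)

lemma Ck_add: "Ck k \<phi> \<Longrightarrow> Ck k \<psi> \<Longrightarrow> Ck k (\<lambda>x. \<phi> x + \<psi> x)"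
proof (induction k arbitrary: \<phi> \<psi>)
  case (Suc k)
  note \<phi> = Ck_SucE[OF Suc.prems(1)] and \<psi> = Ck_SucE[OF Suc.prems(2)]
  show ?case
    by (rule Ck_SucI[OF has_derivative_add[OF \<phi>(1) \<psi>(1)]]) (auto intro: Suc.IH \<phi>(2) \<psi>(2))
qed (auto intro: continuous_intros)

lemma Ck_mult: "Ck k \<phi> \<Longrightarrow> Ck k \<psi> \<Longrightarrow> Ck k (\<lambda>x. \<phi> x * \<psi> x)"
proof (induction k arbitrary: \<phi> \<psi>)
  case (Suc k)
  note \<phi> = Ck_SucE[OF Suc.prems(1)] and \<psi> = Ck_SucE[OF Suc.prems(2)]
  note low = Suc.prems[THEN Ck_Suc_D]
  show ?case
    by (rule Ck_SucI[OF has_derivative_mult[OF \<phi>(1) \<psi>(1)]])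
       (auto intro!: Suc.IH Ck_add \<phi>(2) \<psi>(2) low)
qed (auto intro: continuous_intros)

lemma smooth_const: "smooth (\<lambda>x. c)"
  and smooth_inner: "smooth (\<lambda>x. x \<bullet> a)"
  and smooth_add: "smooth \<phi> \<Longrightarrow> smooth \<psi> \<Longrightarrow> smooth (\<lambda>x. \<phi> x + \<psi> x)"
  and smooth_mult: "smooth \<phi> \<Longrightarrow> smooth \<psi> \<Longrightarrow> smooth (\<lambda>x. \<phi> x * \<psi> x)"
  by (simp_all add: smooth_def Ck_const Ck_inner Ck_add Ck_mult)

lemma smooth_diff: "smooth \<phi> \<Longrightarrow> smooth \<psi> \<Longrightarrow> smooth (\<lambda>x. \<phi> x - \<psi> x)"
  using smooth_add[of \<phi> "\<lambda>x. (-1) * \<psi> x"] smooth_mult[OF smooth_const[of "-1"], of \<psi>] by simp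

lemma smooth_sum: "(\<And>i. i \<in> I \<Longrightarrow> smooth (\<phi> i)) \<Longrightarrow> smooth (\<lambda>x. \<Sum>i\<in>I. \<phi> i x)"
  by (induction I rule: infinite_finite_induct) (auto intro: smooth_const smooth_add)

lemma smooth_prod: "(\<And>i. i \<in> I \<Longrightarrow> smooth (\<phi> i)) \<Longrightarrow> smooth (\<lambda>x. \<Prod>i\<in>I. \<phi> i x)"
  by (induction I rule: infinite_finite_induct) (auto intro: smooth_const smooth_mult)

lemma smooth_continuous: "smooth \<phi> \<Longrightarrow> continuous_on S \<phi>"
  unfolding smooth_def by (meson Ck.simps(1) continuous_on_subset subset_UNIV)

lemma smooth_has_derivative:
  "smooth \<phi> \<Longrightarrow> (\<phi> has_derivative frechet_derivative \<phi> (at x)) (at x)"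
  unfolding smooth_def using Ck_SucE(1) by blast

lemma smooth_partial:
  "smooth \<phi> \<Longrightarrow> b \<in> Basis \<Longrightarrow> smooth (\<lambda>x. frechet_derivative \<phi> (at x) b)"
  unfolding smooth_def using Ck_SucE(2) by blast

lemma smooth_norm_squared: "smooth (\<lambda>x. (norm (x - c))\<^sup>2)"
proof -
  have "(\<lambda>x. (norm (x - c))\<^sup>2) = (\<lambda>x. \<Sum>b\<in>Basis. (x \<bullet> b - c \<bullet> b) * (x \<bullet> b - c \<bullet> b))"
    unfolding power2_norm_eq_inner by (subst euclidean_inner) (simp add: inner_diff_left)
  then show ?thesis
    by (auto intro!: smooth_sum smooth_mult smooth_diff smooth_inner smooth_const)
qed

text \<open>The functions \<open>exp (- 1 / t) / t\<^sup>m\<close>, continued by zero to \<open>t \<le> 0\<close>. The family is closed under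
  differentiation up to linear combinations, which makes smoothness of all its members one induction.\<close>

definition flat :: "nat \<Rightarrow> real \<Rightarrow> real" where
  "flat m t = (if t > 0 then exp (- inverse t) * inverse t ^ m else 0)"

lemma flat_nonneg: "0 \<le> flat m t"
  by (simp add: flat_def)

lemma flat_pos_iff: "0 < flat m t \<longleftrightarrow> 0 < t"
  by (simp add: flat_def)

lemma flat_eq_0: "t \<le> 0 \<Longrightarrow> flat m t = 0"
  by (simp add: flat_def)

lemma flat_zero_le_1: "flat 0 t \<le> 1"
  by (simp add: flat_def)

lemma flat_tendsto_0: "((\<lambda>t. flat m t) \<longlongrightarrow> 0) (at 0)"
proof -
  have "((\<lambda>t::real. inverse t ^ m / exp (inverse t)) \<longlongrightarrow> 0) (at_right 0)"
    by (rule filterlim_compose[OF tendsto_power_div_exp_0 filterlim_inverse_at_top_right])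
  then have "((\<lambda>t. flat m t) \<longlongrightarrow> 0) (at_right 0)"
    by (rule Lim_transform_eventually)
       (auto simp: flat_def eventually_at_right_field exp_minus field_simps intro: exI[of _ 1])
  moreover have "((\<lambda>t. flat m t) \<longlongrightarrow> 0) (at_left 0)"
    by (rule Lim_transform_eventually[OF tendsto_const])
       (auto simp: flat_def eventually_at_left_field intro: exI[of _ "-1"])
  ultimately show ?thesis
    by (simp add: filterlim_split_at)
qed

text \<open>At \<open>t = 0\<close> the difference quotient of the function with index \<open>m\<close> is the function with index
  \<open>m + 1\<close>, which tends to \<open>0\<close>.\<close>

lemma flat_has_derivative:
  "(flat m has_real_derivative flat (m + 2) t - real m * flat (m + 1) t) (at t)"
proof -
  consider "t > 0" | "t = 0" | "t < 0" by linarith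
  then show ?thesis
  proof cases
    case 1
    have "((\<lambda>t. exp (- inverse t) * inverse t ^ m) has_real_derivative
        flat (m + 2) t - real m * flat (m + 1) t) (at t)"
      using 1 
      apply (auto intro!: derivative_eq_intros simp: flat_def power2_eq_square)
      apply (cases m) apply (auto simp: algebra_simps)
      done
    then show ?thesis
      by (rule has_field_derivative_transform_within_open[where S="{0<..}"])
         (use 1 in \<open>auto simp: flat_def\<close>)
  next
    case 2
    have "((\<lambda>h. (flat m (0 + h) - flat m 0) / h) \<longlongrightarrow> 0) (at 0)"
      by (rule Lim_transform_eventually[OF flat_tendsto_0[of "m + 1"]])
         (auto simp: flat_def eventually_at_filter field_simps)
    then show ?thesis using 2 by (simp add: DERIV_def flat_def)
  next
    case 3
    have "((\<lambda>t. 0) has_real_derivative flat (m + 2) t - real m * flat (m + 1) t) (at t)"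
      using 3 by (auto simp: flat_def)
    then show ?thesis
      by (rule has_field_derivative_transform_within_open[where S="{..<0}"])
         (use 3 in \<open>auto simp: flat_def\<close>)
  qed
qed

lemma flat_continuous: "continuous_on S (flat m)"
  using flat_has_derivative[of m] by (meson DERIV_isCont continuous_at_imp_continuous_on)

lemma flat_comp_has_derivative:
  assumes "(\<phi> has_derivative \<phi>') (at x)"
  shows "((\<lambda>x. flat m (\<phi> x)) has_derivative
      (\<lambda>h. (flat (m + 2) (\<phi> x) - real m * flat (m + 1) (\<phi> x)) * \<phi>' h)) (at x)"
  using has_derivative_compose[OF assms, of "flat m"] flat_has_derivative[of m "\<phi> x"]
  by (simp add: has_field_derivative_def)

text \<open>The induction has to run over all \<open>m\<close> at once, since a derivative raises the index.\<close>

lemma Ck_flat: "Ck k \<phi> \<Longrightarrow> Ck k (\<lambda>x. flat m (\<phi> x))"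
proof (induction k arbitrary: \<phi> m)
  case 0
  then show ?case by (auto intro: continuous_on_compose2[OF flat_continuous])
next
  case (Suc k)
  note \<phi> = Ck_SucE[OF Suc.prems] and low = Ck_Suc_D[OF Suc.prems]
  have "Ck k (\<lambda>x. (flat (m + 2) (\<phi> x) + (- real m) * flat (m + 1) (\<phi> x)) * frechet_derivative \<phi> (at x) b)"
    if "b \<in> Basis" for b
    by (intro Ck_mult Ck_add Ck_const Suc.IH low \<phi>(2) that)
  then show ?case
    by (intro Ck_SucI[OF flat_comp_has_derivative[OF \<phi>(1)]]) simp
qed

lemma smooth_flat: "smooth \<phi> \<Longrightarrow> smooth (\<lambda>x. flat m (\<phi> x))"
  by (simp add: smooth_def Ck_flat)

definition grad :: "('a::euclidean_space \<Rightarrow> real) \<Rightarrow> 'a \<Rightarrow> 'a" where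
  "grad \<phi> x = (\<Sum>b\<in>Basis. frechet_derivative \<phi> (at x) b *\<^sub>R b)"

lemma grad_inner_Basis: "b \<in> Basis \<Longrightarrow> grad \<phi> x \<bullet> b = frechet_derivative \<phi> (at x) b"
  unfolding grad_def by simp

lemma grad_inner:
  assumes "\<phi> differentiable at x"
  shows "grad \<phi> x \<bullet> h = frechet_derivative \<phi> (at x) h"
proof -
  interpret linear "frechet_derivative \<phi> (at x)"
    using assms by (rule linear_frechet_derivative)
  have "frechet_derivative \<phi> (at x) h = frechet_derivative \<phi> (at x) (\<Sum>b\<in>Basis. (h \<bullet> b) *\<^sub>R b)"
    by (simp add: euclidean_representation)
  also have "\<dots> = (\<Sum>b\<in>Basis. (h \<bullet> b) * frechet_derivative \<phi> (at x) b)"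
    by (simp add: sum scale)
  finally show ?thesis
    unfolding grad_def by (simp add: inner_sum_left inner_commute[of h] mult.commute)
qed

lemma grad_eqI:
  assumes "(\<phi> has_derivative (\<lambda>h. G \<bullet> h)) (at x)"
  shows "grad \<phi> x = G"
  unfolding grad_def frechet_derivative_eqI[OF assms] by (rule euclidean_representation)

lemma smooth_has_derivative_grad:
  assumes "smooth \<phi>"
  shows "(\<phi> has_derivative (\<lambda>h. grad \<phi> x \<bullet> h)) (at x)"
proof -
  note d = smooth_has_derivative[OF assms, of x]
  have "frechet_derivative \<phi> (at x) = (\<lambda>h. grad \<phi> x \<bullet> h)"
    by (rule ext) (simp add: grad_inner[OF differentiableI[OF d]])
  with d show ?thesis by simp
qed

lemma continuous_on_grad: "smooth \<phi> \<Longrightarrow> continuous_on S (grad \<phi>)"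
  unfolding grad_def by (intro continuous_intros smooth_continuous smooth_partial) auto

lemma test_functions_smooth: "\<phi> \<in> test_functions \<Omega> \<Longrightarrow> smooth \<phi>"
  by (simp add: test_functions_def)

lemma test_functionsI:
  assumes "smooth \<phi>" "compact K" "K \<subseteq> \<Omega>" "\<And>x. x \<notin> K \<Longrightarrow> \<phi> x = 0"
  shows "\<phi> \<in> test_functions \<Omega>"
proof -
  have "closure {x. \<phi> x \<noteq> 0} \<subseteq> K"
    using assms by (intro closure_minimal) (auto intro: compact_imp_closed)
  with assms show ?thesis
    unfolding test_functions_def
    by (auto simp: compact_eq_bounded_closed intro: bounded_subset)
qed

lemma test_functionsE:
  assumes "\<phi> \<in> test_functions \<Omega>"
  obtains K where "compact K" "K \<subseteq> \<Omega>" "\<And>x. x \<notin> K \<Longrightarrow> \<phi> x = 0" "\<And>x. x \<notin> K \<Longrightarrow> grad \<phi> x = 0"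
    "\<And>x b. x \<notin> K \<Longrightarrow> frechet_derivative \<phi> (at x) b = 0"
proof -
  define K where "K = closure {x. \<phi> x \<noteq> 0}"
  have K: "compact K" "K \<subseteq> \<Omega>" using assms by (simp_all add: test_functions_def K_def)
  have z: "\<phi> x = 0" if "x \<notin> K" for x
    using that closure_subset[of "{x. \<phi> x \<noteq> 0}"] unfolding K_def by blast
  have d: "frechet_derivative \<phi> (at x) = (\<lambda>h. 0)" if "x \<notin> K" for x
  proof -
    have "(\<phi> has_derivative (\<lambda>h. 0)) (at x)"
    proof (rule has_derivative_transform_within_open[where s="- K"])
      show "((\<lambda>_. 0::real) has_derivative (\<lambda>h. 0)) (at x)" by simp
    qed (use that z K(1) in \<open>auto dest: compact_imp_closed\<close>)
    then show ?thesis by (rule frechet_derivative_eqI)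
  qed
  show ?thesis
    by (rule that[OF K]) (simp_all add: z d grad_def)
qed

section \<open>Weak gradients\<close>

lemma lebesgue_on_integral_eq_lborel:
  fixes h :: "'a::euclidean_space \<Rightarrow> real"
  assumes "\<Omega> \<in> sets lebesgue" "h \<in> borel_measurable borel" "\<And>x. x \<notin> \<Omega> \<Longrightarrow> h x = 0"
  shows "(LINT x|lebesgue_on \<Omega>. h x) = (LINT x|lborel. h x)"
proof -
  have "(LINT x|lebesgue_on \<Omega>. h x) = (LINT x|lebesgue. (if x \<in> \<Omega> then h x else 0))"
    using assms by (simp add: Lebesgue_Measure.integral_restrict_UNIV)
  also have "\<dots> = (LINT x|lebesgue. h x)"
    by (rule Bochner_Integration.integral_cong) (auto simp: assms)
  also have "\<dots> = (LINT x|lborel. h x)"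
    using assms by (intro integral_completion) simp
  finally show ?thesis .
qed

lemma continuous_compact_support_bound:
  fixes h :: "'a::euclidean_space \<Rightarrow> real"
  assumes "continuous_on UNIV h" "compact K" "\<And>x. x \<notin> K \<Longrightarrow> h x = 0"
  obtains C where "C \<ge> 0" "\<And>x. \<bar>h x\<bar> \<le> C"
proof -
  have "bounded (h ` K)"
    using assms by (intro compact_imp_bounded compact_continuous_image continuous_on_subset[OF assms(1)]) auto
  then obtain C where C: "\<And>x. x \<in> K \<Longrightarrow> \<bar>h x\<bar> \<le> C" by (auto simp: bounded_iff)
  show ?thesis
  proof (rule that[of "max C 0"])
    show "\<bar>h x\<bar> \<le> max C 0" for x
      using C[of x] assms(3)[of x] by (cases "x \<in> K") auto
  qed simp
qed

lemma continuous_compact_support_integrable: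
  fixes h :: "'a::euclidean_space \<Rightarrow> real"
  assumes "continuous_on UNIV h" "compact K" "\<And>x. x \<notin> K \<Longrightarrow> h x = 0"
  shows "integrable lborel h"
proof -
  have "(\<lambda>x. indicator K x *\<^sub>R h x) = h"
    using assms(3) by (auto simp: indicator_def fun_eq_iff)
  with borel_integrable_compact[OF assms(2) continuous_on_subset[OF assms(1)]] show ?thesis by auto
qed

text \<open>Lebesgue measure is translation invariant, so every difference quotient of \<open>F\<close> in direction \<open>b\<close> has
  integral \<open>0\<close>. The quotients are bounded by the maximum of the derivative and vanish outside a fixed
  ball, so dominated convergence transfers this to the derivative.\<close>

lemma integral_partial_eq_0:
  fixes F :: "'a::euclidean_space \<Rightarrow> real"
  assumes F: "smooth F" and K: "compact K" "\<And>x. x \<notin> K \<Longrightarrow> F x = 0"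
    and K': "\<And>x. x \<notin> K \<Longrightarrow> frechet_derivative F (at x) b = 0" and b: "b \<in> Basis"
  shows "(LINT x|lborel. frechet_derivative F (at x) b) = 0"
proof -
  define D where "D = (\<lambda>x. frechet_derivative F (at x) b)"
  have contF: "continuous_on UNIV F" and contD: "continuous_on UNIV D"
    unfolding D_def using F b by (auto intro: smooth_continuous smooth_partial)
  obtain C where C: "C \<ge> 0" "\<And>x. \<bar>D x\<bar> \<le> C"
    using continuous_compact_support_bound[OF contD K(1)] K' unfolding D_def by blast
  have intF: "integrable lborel F"
    using contF K by (rule continuous_compact_support_integrable)
  have [measurable]: "F \<in> borel_measurable borel" "D \<in> borel_measurable borel"
    using contF contD by (auto intro: borel_measurable_continuous_onI)
  obtain R where R: "\<And>x. x \<in> K \<Longrightarrow> norm x \<le> R"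
    using compact_imp_bounded[OF K(1)] by (auto simp: bounded_iff)
  \<comment> \<open>the derivative of \<open>F\<close> along the line through \<open>x\<close> in direction \<open>b\<close>\<close>
  have line: "((\<lambda>s. F (x + s *\<^sub>R b)) has_real_derivative D (x + s *\<^sub>R b)) (at s)" for x s
  proof -
    have "((\<lambda>s. F (x + s *\<^sub>R b)) has_derivative
        (\<lambda>s'. frechet_derivative F (at (x + s *\<^sub>R b)) (s' *\<^sub>R b))) (at s)"
      by (rule has_derivative_compose[OF _ smooth_has_derivative[OF F]])
         (auto intro!: derivative_eq_intros)
    moreover have "frechet_derivative F (at (x + s *\<^sub>R b)) (s' *\<^sub>R b) = s' * D (x + s *\<^sub>R b)" for s'
      using linear_scale[OF linear_frechet_derivative[OF differentiableI[OF smooth_has_derivative[OF F]]]]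
      by (simp add: D_def)
    ultimately have "((\<lambda>s. F (x + s *\<^sub>R b)) has_derivative (\<lambda>s'. D (x + s *\<^sub>R b) * s')) (at s)"
      by (simp add: mult.commute)
    then show ?thesis by (simp add: has_field_derivative_def)
  qed
  define t where "t n = inverse (real (Suc n))" for n
  have t: "0 < t n" "t n \<le> 1" for n by (auto simp: t_def field_simps)
  define q where "q n x = (F (t n *\<^sub>R b + x) - F x) / t n" for n x
  have [measurable]: "q n \<in> borel_measurable borel" for n
    unfolding q_def by measurable
  have lim: "(\<lambda>n. q n x) \<longlonglongrightarrow> D x" for x
  proof -
    have "((\<lambda>h. (F (x + h *\<^sub>R b) - F x) / h) \<longlongrightarrow> D x) (at 0)"
      using line[of x 0] by (simp add: DERIV_def)
    moreover have "filterlim t (at 0) sequentially"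
      unfolding filterlim_at using t LIMSEQ_inverse_real_of_nat[folded t_def]
      by (auto intro: always_eventually simp: less_imp_neq[symmetric])
    ultimately have "((\<lambda>n. (F (x + t n *\<^sub>R b) - F x) / t n) \<longlongrightarrow> D x) sequentially"
      by (rule filterlim_compose)
    then show ?thesis by (simp add: q_def add.commute)
  qed
  have dom: "\<bar>q n x\<bar> \<le> C * indicator (cball 0 (R + 1)) x" for n x
  proof (cases "x \<in> cball 0 (R + 1)")
    case True
    obtain z where "F (x + t n *\<^sub>R b) - F (x + 0 *\<^sub>R b) = (t n - 0) * D (x + z *\<^sub>R b)"
      using MVT2[OF t(1)[of n], of "\<lambda>s. F (x + s *\<^sub>R b)" "\<lambda>s. D (x + s *\<^sub>R b)"] line by blast
    then have "q n x = D (x + z *\<^sub>R b)" using t(1)[of n] by (simp add: q_def add.commute)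
    with C True show ?thesis by simp
  next
    case False
    then have x: "norm x > R + 1" by auto
    have "norm (t n *\<^sub>R b) \<le> 1" using t[of n] b by simp
    then have "norm (t n *\<^sub>R b + x) > R"
      using x norm_triangle_ineq2[of x "- (t n *\<^sub>R b)"] by (simp add: add.commute)
    then have "t n *\<^sub>R b + x \<notin> K" "x \<notin> K" using R x by force+
    with False K show ?thesis by (simp add: q_def)
  qed
  have "(\<lambda>n. LINT x|lborel. q n x) \<longlonglongrightarrow> (LINT x|lborel. D x)"
  proof (rule integral_dominated_convergence)
    show "integrable lborel (\<lambda>x. C * indicator (cball 0 (R + 1)) x)"
      by (auto intro!: integrable_mult_right integrable_real_indicator emeasure_bounded_finite)
    show "AE x in lborel. norm (q n x) \<le> C * indicator (cball 0 (R + 1)) x" for n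
      using dom by simp
  qed (use lim in auto)
  moreover have "(LINT x|lborel. q n x) = 0" for n
  proof -
    have "integrable (distr lborel borel ((+) (t n *\<^sub>R b))) F"
      using intF by (simp add: lborel_distr_plus)
    then have i: "integrable lborel (\<lambda>x. F (t n *\<^sub>R b + x))"
      by (subst (asm) integrable_distr_eq) auto
    have "(LINT x|lborel. F (t n *\<^sub>R b + x)) = (LINT x|distr lborel borel ((+) (t n *\<^sub>R b)). F x)"
      by (subst integral_distr) auto
    then show ?thesis
      using i intF by (simp add: q_def lborel_distr_plus)
  qed
  ultimately show ?thesis by (simp add: D_def LIMSEQ_const_iff)
qed

lemma L1_locI_continuous:
  fixes u :: "'a::euclidean_space \<Rightarrow> 'c::euclidean_space"
  assumes "continuous_on UNIV u"
  shows "u \<in> L1_loc \<Omega>"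
proof -
  have "u absolutely_integrable_on K" if "compact K" for K
  proof -
    have "integrable lborel (\<lambda>x. indicator K x *\<^sub>R u x)"
      by (rule borel_integrable_compact[OF that continuous_on_subset[OF assms]]) simp
    then show ?thesis
      unfolding set_integrable_def
      using integrable_completion[OF borel_measurable_integrable] by (metis (no_types, lifting))
  qed
  then show ?thesis by (auto simp: L1_loc_def)
qed

text \<open>Integration by parts: the product with a test function has compact support, so its partial
  derivatives integrate to \<open>0\<close>.\<close>

lemma has_weak_gradient_smooth:
  fixes \<phi> :: "'a::euclidean_space \<Rightarrow> real"
  assumes \<phi>: "smooth \<phi>" and \<Omega>: "\<Omega> \<in> sets lebesgue"
  shows "has_weak_gradient \<Omega> \<phi> (grad \<phi>)"
  unfolding has_weak_gradient_def
proof (intro conjI ballI)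
  show "\<phi> \<in> L1_loc \<Omega>" "grad \<phi> \<in> L1_loc \<Omega>"
    using \<phi> by (auto intro: L1_locI_continuous smooth_continuous continuous_on_grad)
next
  fix \<psi> and b :: 'a assume \<psi>: "\<psi> \<in> test_functions \<Omega>" and b: "b \<in> Basis"
  from \<psi> obtain K where K: "compact K" "K \<subseteq> \<Omega>" "\<And>x. x \<notin> K \<Longrightarrow> \<psi> x = 0"
    "\<And>x b. x \<notin> K \<Longrightarrow> frechet_derivative \<psi> (at x) b = 0" by (rule test_functionsE) blast
  note s = \<phi> test_functions_smooth[OF \<psi>]
  have prod: "frechet_derivative (\<lambda>x. \<phi> x * \<psi> x) (at x) =
      (\<lambda>h. \<phi> x * frechet_derivative \<psi> (at x) h + frechet_derivative \<phi> (at x) h * \<psi> x)" for x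
    by (rule frechet_derivative_eqI has_derivative_mult s[THEN smooth_has_derivative])+
  let ?f = "\<lambda>x. \<phi> x * frechet_derivative \<psi> (at x) b" and ?g = "\<lambda>x. (grad \<phi> x \<bullet> b) * \<psi> x"
  have c: "continuous_on UNIV ?f" "continuous_on UNIV ?g"
    using s b by (intro continuous_intros continuous_on_grad smooth_continuous[OF smooth_partial] smooth_continuous; simp)+
  have int: "integrable lborel ?f" "integrable lborel ?g"
    by (rule continuous_compact_support_integrable[OF _ K(1)]; use c K in simp)+
  have "(LINT x|lborel. frechet_derivative (\<lambda>x. \<phi> x * \<psi> x) (at x) b) = 0"
    by (rule integral_partial_eq_0[OF smooth_mult[OF s] K(1) _ _ b]) (simp_all add: K prod)
  then have "(LINT x|lborel. ?f x + ?g x) = 0"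
    using b by (simp add: prod grad_inner_Basis)
  then have "(LINT x|lborel. ?f x) = - (LINT x|lborel. ?g x)"
    using int by simp
  moreover have "x \<notin> \<Omega> \<Longrightarrow> x \<notin> K" for x using K(2) by auto
  ultimately show "(LINT x|lebesgue_on \<Omega>. ?f x) = - (LINT x|lebesgue_on \<Omega>. ?g x)"
    using c K
    by (subst (1 2) lebesgue_on_integral_eq_lborel[OF \<Omega>]) (auto intro: borel_measurable_continuous_onI)
qed

lemma L1_loc_times_test_integrable:
  fixes g :: "'a::euclidean_space \<Rightarrow> real"
  assumes g: "g \<in> L1_loc \<Omega>" and \<phi>: "continuous_on UNIV \<phi>" and K: "compact K" "K \<subseteq> \<Omega>" "\<And>x. x \<notin> K \<Longrightarrow> \<phi> x = 0"
    and \<Omega>: "\<Omega> \<in> sets lebesgue"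
  shows "integrable (lebesgue_on \<Omega>) (\<lambda>x. g x * \<phi> x)"
proof -
  obtain C where C: "\<And>x. \<bar>\<phi> x\<bar> \<le> C"
    using continuous_compact_support_bound[OF \<phi> K(1,3)] by blast
  have gK: "integrable lebesgue (\<lambda>x. indicator K x *\<^sub>R g x)"
    using g K by (auto simp: L1_loc_def set_integrable_def)
  have m: "\<phi> \<in> borel_measurable lebesgue"
    using \<phi> by (auto intro!: measurable_completion borel_measurable_continuous_onI)
  have "integrable lebesgue (\<lambda>x. \<phi> x *\<^sub>R (indicator K x *\<^sub>R g x))"
  proof (rule Bochner_Integration.integrable_bound[OF integrable_mult_right[OF gK, of C]])
    show "(\<lambda>x. \<phi> x *\<^sub>R (indicator K x *\<^sub>R g x)) \<in> borel_measurable lebesgue"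
      using m borel_measurable_integrable[OF gK] by measurable
    have "0 \<le> C" using C[of 0] by linarith
    with C show "AE x in lebesgue. norm (\<phi> x *\<^sub>R indicat_real K x *\<^sub>R g x) \<le> norm (C * indicat_real K x *\<^sub>R g x)"
      by (auto simp: abs_mult intro!: mult_right_mono AE_I2)
  qed
  also have "(\<lambda>x. \<phi> x *\<^sub>R (indicator K x *\<^sub>R g x)) = (\<lambda>x. if x \<in> \<Omega> then g x * \<phi> x else 0)"
    using K by (auto simp: fun_eq_iff indicator_def)
  finally show ?thesis
    by (simp add: Lebesgue_Measure.integrable_restrict_UNIV[OF \<Omega>])
qed

lemma flat_mult_nat_tendsto: "(\<lambda>n. flat 0 (real n * t)) \<longlonglongrightarrow> (if 0 < t then 1 else 0)"
proof (cases "0 < t")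
  case True
  have "(\<lambda>n. exp (- inverse (real n * t))) \<longlonglongrightarrow> exp (- 0)"
  proof (intro tendsto_exp tendsto_minus)
    show "(\<lambda>n. inverse (real n * t)) \<longlonglongrightarrow> 0"
      using tendsto_mult_left[OF lim_inverse_n, of "inverse t"] by (simp add: mult.commute)
  qed
  moreover have "\<forall>\<^sub>F n in sequentially. exp (- inverse (real n * t)) = flat 0 (real n * t)"
    using eventually_gt_at_top[of 0] by eventually_elim (use True in \<open>simp add: flat_def\<close>)
  ultimately have "(\<lambda>n. flat 0 (real n * t)) \<longlonglongrightarrow> exp (- 0)"
    by (rule Lim_transform_eventually)
  then show ?thesis using True by simp
next
  case False
  then show ?thesis by (simp add: flat_eq_0 mult_nonneg_nonpos)
qed

text \<open>A box is cut out by the inequalities \<open>c \<bullet> i < x \<bullet> i\<close> and \<open>x \<bullet> i < d \<bullet> i\<close>, and \<open>exp (- 1 / (n t))\<close> tends to the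
  indicator of \<open>t > 0\<close>. The approximating functions are the products of these smoothed indicators.\<close>

lemma test_functions_approx_box:
  fixes c d :: "'a::euclidean_space"
  assumes "cbox c d \<subseteq> \<Omega>"
  obtains \<phi> :: "nat \<Rightarrow> 'a \<Rightarrow> real" where "\<And>n. \<phi> n \<in> test_functions \<Omega>"
    "\<And>n x. 0 \<le> \<phi> n x \<and> \<phi> n x \<le> 1" "\<And>n x. x \<notin> cbox c d \<Longrightarrow> \<phi> n x = 0"
    "\<And>x. (\<lambda>n. \<phi> n x) \<longlonglongrightarrow> indicator (box c d) x"
proof -
  define \<phi> where "\<phi> n x = (\<Prod>i\<in>Basis. flat 0 (real n * (x \<bullet> i - c \<bullet> i)) * flat 0 (real n * (d \<bullet> i - x \<bullet> i)))"
    for n x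
  have zero: "\<phi> n x = 0" if "x \<notin> cbox c d" for n x
  proof -
    from that obtain i where "i \<in> Basis" "x \<bullet> i - c \<bullet> i < 0 \<or> d \<bullet> i - x \<bullet> i < 0"
      by (auto simp: mem_box)
    then show ?thesis
      unfolding \<phi>_def by (intro prod_zero) (auto simp: flat_eq_0 mult_nonneg_nonpos intro!: bexI[of _ i])
  qed
  show ?thesis
  proof (rule that[of \<phi>])
    fix n x
    have "smooth (\<phi> n)"
      unfolding \<phi>_def
      by (intro smooth_prod smooth_mult smooth_flat smooth_diff smooth_const smooth_inner)
    then show "\<phi> n \<in> test_functions \<Omega>"
      by (rule test_functionsI[OF _ compact_cbox assms zero])
    show "0 \<le> \<phi> n x \<and> \<phi> n x \<le> 1"
      unfolding \<phi>_def
      by (auto intro!: prod_nonneg prod_le_1 mult_nonneg_nonneg mult_le_one simp: flat_nonneg flat_zero_le_1)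
    show "(\<lambda>n. \<phi> n x) \<longlonglongrightarrow> indicator (box c d) x" for x
    proof -
      have "(\<lambda>n. \<phi> n x) \<longlonglongrightarrow> (\<Prod>i\<in>Basis. (if 0 < x \<bullet> i - c \<bullet> i then 1 else 0) * (if 0 < d \<bullet> i - x \<bullet> i then 1 else 0))"
        unfolding \<phi>_def by (intro tendsto_prod tendsto_mult flat_mult_nat_tendsto)
      also have "(\<Prod>i\<in>Basis. (if 0 < x \<bullet> i - c \<bullet> i then 1 else 0) * (if 0 < d \<bullet> i - x \<bullet> i then 1 else 0))
          = (indicator (box c d) x :: real)"
      proof (cases "x \<in> box c d")
        case True then show ?thesis by (auto simp: mem_box)
      next
        case False
        then obtain i where "i \<in> Basis" "\<not> (c \<bullet> i < x \<bullet> i \<and> x \<bullet> i < d \<bullet> i)" by (auto simp: mem_box)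
        then show ?thesis
          using False by (subst prod_zero) (auto intro!: bexI[of _ i])
      qed
      finally show ?thesis .
    qed
  qed (use zero in auto)
qed

text \<open>Approximating indicators of boxes by test functions shows that \<open>g\<close> has integral \<open>0\<close> over every box
  in \<open>\<Omega>\<close>. By Lebesgue differentiation along shrinking cubes, \<open>g\<close> vanishes almost everywhere.\<close>

lemma fundamental_lemma:
  fixes g :: "'a::euclidean_space \<Rightarrow> real"
  assumes \<Omega>: "open \<Omega>" and g: "g \<in> L1_loc \<Omega>"
    and orth: "\<And>\<phi>. \<phi> \<in> test_functions \<Omega> \<Longrightarrow> (LINT x|lebesgue_on \<Omega>. g x * \<phi> x) = 0"
  shows "AE x in lebesgue_on \<Omega>. g x = 0"
proof -
  have \<Omega>m: "\<Omega> \<in> sets lebesgue" using \<Omega> by simp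
  have "AE x in lebesgue. x \<in> cbox a b \<longrightarrow> g x = 0" if ab: "cbox a b \<subseteq> \<Omega>" for a b
  proof -
    define f where "f x = indicator (cbox a b) x *\<^sub>R g x" for x
    have f: "integrable lebesgue f"
      using g ab unfolding L1_loc_def set_integrable_def f_def by (blast intro: compact_cbox)
    then have [measurable]: "f \<in> borel_measurable lebesgue" by auto
    have zero: "integral (cbox c d) f = 0" if cd: "cbox c d \<subseteq> cbox a b" for c d
    proof -
      obtain \<phi> :: "nat \<Rightarrow> 'a \<Rightarrow> real" where \<phi>: "\<And>n. \<phi> n \<in> test_functions \<Omega>"
        "\<And>n x. 0 \<le> \<phi> n x \<and> \<phi> n x \<le> 1" "\<And>n x. x \<notin> cbox c d \<Longrightarrow> \<phi> n x = 0"
        "\<And>x. (\<lambda>n. \<phi> n x) \<longlonglongrightarrow> indicator (box c d) x"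
        using test_functions_approx_box[OF order_trans[OF cd ab]] by blast
      have \<phi>m: "\<phi> n \<in> borel_measurable lebesgue" for n
        using smooth_continuous[OF test_functions_smooth[OF \<phi>(1)]]
        by (auto intro!: measurable_completion borel_measurable_continuous_onI)
      have "(\<lambda>n. LINT x|lebesgue. f x * \<phi> n x) \<longlonglongrightarrow> (LINT x|lebesgue. f x * indicator (box c d) x)"
      proof (rule integral_dominated_convergence)
        show "integrable lebesgue (\<lambda>x. \<bar>f x\<bar>)" using f by simp
        show "AE x in lebesgue. (\<lambda>n. f x * \<phi> n x) \<longlonglongrightarrow> f x * indicator (box c d) x"
          by (intro AE_I2 tendsto_mult tendsto_const \<phi>(4))
        show "AE x in lebesgue. norm (f x * \<phi> n x) \<le> \<bar>f x\<bar>" for n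
          using \<phi>(2) by (auto simp: abs_mult intro!: mult_left_le AE_I2)
        show "(\<lambda>x. f x * indicator (box c d) x) \<in> borel_measurable lebesgue"
          by (intro borel_measurable_times borel_measurable_indicator) auto
        show "(\<lambda>x. f x * \<phi> n x) \<in> borel_measurable lebesgue" for n
          by (intro borel_measurable_times \<phi>m) auto
      qed
      moreover have "(LINT x|lebesgue. f x * \<phi> n x) = 0" for n
      proof -
        have "f x * \<phi> n x = (if x \<in> \<Omega> then g x * \<phi> n x else 0)" for x
          using cd ab \<phi>(3)[of x n] by (cases "x \<in> cbox c d") (auto simp: f_def)
        then have "(LINT x|lebesgue. f x * \<phi> n x) = (LINT x|lebesgue_on \<Omega>. g x * \<phi> n x)"
          by (simp add: Lebesgue_Measure.integral_restrict_UNIV[OF \<Omega>m])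
        with orth[OF \<phi>(1)] show ?thesis by simp
      qed
      ultimately have "(LINT x|lebesgue. f x * indicator (box c d) x) = 0"
        by (simp add: LIMSEQ_const_iff)
      moreover have "integrable lebesgue (\<lambda>x. f x * indicator (box c d) x)"
        using f by (intro integrable_real_mult_indicator) auto
      ultimately have "((\<lambda>x. f x * indicator (box c d) x) has_integral 0) UNIV"
        using has_integral_integral_lebesgue by (metis (no_types, lifting))
      then have "((\<lambda>x. if x \<in> box c d then f x else 0) has_integral 0) UNIV"
        by (rule has_integral_eq[rotated]) auto
      then have "(f has_integral 0) (box c d)" by (simp add: has_integral_restrict_UNIV)
      then show ?thesis
        using has_integral_interior[of "cbox c d" f 0] by (simp add: integral_unique frontier_def negligible_frontier_interval)
    qed
    \<comment> \<open>the differentiation theorem is stated for functions that are integrable on every box\<close>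
    have "f integrable_on UNIV"
      using f has_integral_integral_lebesgue integrable_on_def by blast
    then have fi: "f integrable_on cbox c d" for c d
      using integrable_on_subcbox by blast
    obtain N where N: "negligible N" "\<And>x e. \<lbrakk>x \<notin> N; 0 < e\<rbrakk> \<Longrightarrow>
       \<exists>\<delta>>0. \<forall>h. 0 < h \<and> h < \<delta> \<longrightarrow> norm (integral (cbox x (x + h *\<^sub>R One)) f /\<^sub>R h ^ DIM('a) - f x) < e"
      using integrable_ccontinuous_explicit[of f, OF fi] by metis
    have "g x = 0" if x: "x \<in> box a b" "x \<notin> N" for x
    proof -
      obtain \<eta> where \<eta>: "\<eta> > 0" "ball x \<eta> \<subseteq> box a b"
        using openE[OF open_box x(1)] by blast
      have sub: "cbox x (x + h *\<^sub>R One) \<subseteq> cbox a b" if "0 < h" "h < \<eta> / DIM('a)" for h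
      proof
        fix y assume y: "y \<in> cbox x (x + h *\<^sub>R One)"
        have "dist y x \<le> (\<Sum>i\<in>Basis. dist (y \<bullet> i) (x \<bullet> i))"
          unfolding euclidean_dist_l2[of y x] by (rule L2_set_le_sum) auto
        also have "\<dots> \<le> (\<Sum>i\<in>(Basis::'a set). h)"
          using y by (intro sum_mono) (auto simp: mem_box dist_real_def algebra_simps)
        also have "\<dots> < \<eta>" using that by (simp add: field_simps)
        finally have "y \<in> ball x \<eta>" by (simp add: dist_commute)
        then show "y \<in> cbox a b" using \<eta> box_subset_cbox by blast
      qed
      have "norm (f x) < e" if e: "e > 0" for e
      proof -
        obtain \<delta> where \<delta>: "\<delta> > 0"
          "\<And>h. 0 < h \<Longrightarrow> h < \<delta> \<Longrightarrow> norm (integral (cbox x (x + h *\<^sub>R One)) f /\<^sub>R h ^ DIM('a) - f x) < e"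
          using N(2)[OF x(2) e] by blast
        obtain h where "0 < h" "h < \<delta>" "h < \<eta> / DIM('a)"
          using field_lbound_gt_zero[of \<delta> "\<eta> / DIM('a)"] \<delta> \<eta> by auto
        with \<delta>(2)[of h] zero[OF sub] show ?thesis by simp
      qed
      then have "f x = 0" by (metis less_irrefl zero_less_norm_iff)
      then show "g x = 0"
        using x box_subset_cbox[of a b] by (auto simp: f_def indicator_def split: if_splits)
    qed
    moreover have "negligible (N \<union> (cbox a b - box a b))"
      using N(1) negligible_frontier_interval by (rule negligible_Un)
    then have "AE x in lebesgue. x \<notin> N \<union> (cbox a b - box a b)"
      by (intro AE_not_in) (simp only: negligible_iff_null_sets)
    ultimately show ?thesis by (auto elim: eventually_mono)
  qed
  note boxes = this
  obtain \<D> where \<D>: "countable \<D>" "\<And>X. X \<in> \<D> \<Longrightarrow> X \<subseteq> \<Omega> \<and> (\<exists>a b. X = cbox a b)" "\<Union>\<D> = \<Omega>"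
    using open_countable_Union_open_cbox[OF \<Omega>] by (metis PowD subsetD)
  have "AE x in lebesgue. \<forall>X\<in>\<D>. x \<in> X \<longrightarrow> g x = 0"
    unfolding AE_ball_countable[OF \<D>(1)] using boxes \<D>(2) by metis
  then show ?thesis
    using \<D>(3) by (auto simp: AE_restrict_space_iff \<Omega>m elim!: eventually_mono)
qed

lemma L1_loc_inner: "G \<in> L1_loc \<Omega> \<Longrightarrow> (\<lambda>x. G x \<bullet> b) \<in> L1_loc \<Omega>"
  by (simp add: L1_loc_def absolutely_integrable_component)

lemma weak_gradient_unique_AE:
  fixes \<Omega> :: "'a::euclidean_space set"
  assumes \<Omega>: "open \<Omega>" and G: "has_weak_gradient \<Omega> u G" and G': "has_weak_gradient \<Omega> u G'"
  shows "AE x in lebesgue_on \<Omega>. G x = G' x"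
proof -
  have "AE x in lebesgue_on \<Omega>. G x \<bullet> b - G' x \<bullet> b = 0" if b: "b \<in> Basis" for b
  proof (rule fundamental_lemma[OF \<Omega>])
    have L: "(\<lambda>x. G x \<bullet> b) \<in> L1_loc \<Omega>" "(\<lambda>x. G' x \<bullet> b) \<in> L1_loc \<Omega>"
      using G G' by (simp_all add: has_weak_gradient_def L1_loc_inner)
    then show "(\<lambda>x. G x \<bullet> b - G' x \<bullet> b) \<in> L1_loc \<Omega>"
      by (simp add: L1_loc_def)
    fix \<phi> assume \<phi>: "\<phi> \<in> test_functions \<Omega>"
    then obtain K where K: "compact K" "K \<subseteq> \<Omega>" "\<And>x. x \<notin> K \<Longrightarrow> \<phi> x = 0" by (rule test_functionsE) blast
    note int = L1_loc_times_test_integrable[OF _ smooth_continuous[OF test_functions_smooth[OF \<phi>]] K]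
    let ?D = "LINT x|lebesgue_on \<Omega>. u x * frechet_derivative \<phi> (at x) b"
    have "?D = - (LINT x|lebesgue_on \<Omega>. (G x \<bullet> b) * \<phi> x)" "?D = - (LINT x|lebesgue_on \<Omega>. (G' x \<bullet> b) * \<phi> x)"
      using G G' \<phi> b unfolding has_weak_gradient_def by blast+
    then show "(LINT x|lebesgue_on \<Omega>. (G x \<bullet> b - G' x \<bullet> b) * \<phi> x) = 0"
      using int[OF L(1)] int[OF L(2)] \<Omega> by (simp add: left_diff_distrib)
  qed
  then have "AE x in lebesgue_on \<Omega>. \<forall>b\<in>Basis. G x \<bullet> b - G' x \<bullet> b = 0"
    by (intro AE_finite_allI finite_Basis)
  then show ?thesis by eventually_elim (simp add: euclidean_eq_iff[where 'a='a])
qed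

section \<open>Completeness and projection in \<open>L\<^sup>2\<close>\<close>

text \<open>Squared distances are additive under the integral and avoid square roots throughout; the triangle
  inequality then costs a factor \<open>2\<close>.\<close>

definition sqdist :: "'b measure \<Rightarrow> ('b \<Rightarrow> 'c::euclidean_space) \<Rightarrow> ('b \<Rightarrow> 'c) \<Rightarrow> real" where
  "sqdist M u v = (LINT x|M. (norm (u x - v x))\<^sup>2)"

lemma sqdist_nonneg: "0 \<le> sqdist M u v"
  by (simp add: sqdist_def)

lemma sqdist_commute: "sqdist M u v = sqdist M v u"
  by (simp add: sqdist_def norm_minus_commute)

lemma power2_norm_add_le: "(norm (a + b))\<^sup>2 \<le> 2 * (norm a)\<^sup>2 + 2 * (norm b)\<^sup>2"
  for a b :: "'a::real_inner"
  using zero_le_power2[of "norm (a - b)"]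
  by (simp add: power2_norm_eq_inner algebra_simps inner_commute)

lemma inner_le_half_squares: "\<bar>a \<bullet> b\<bar> \<le> ((norm a)\<^sup>2 + (norm b)\<^sup>2) / 2"
  for a b :: "'a::real_inner"
  using zero_le_power2[of "norm (a - b)"] zero_le_power2[of "norm (a + b)"]
  by (simp add: power2_norm_eq_inner algebra_simps inner_commute abs_le_iff)

lemma L2_measurable: "u \<in> L2 M \<Longrightarrow> u \<in> borel_measurable M"
  and L2_integrable: "u \<in> L2 M \<Longrightarrow> integrable M (\<lambda>x. (norm (u x))\<^sup>2)"
  by (simp_all add: L2_def)

lemma L2_bound:
  assumes "u \<in> borel_measurable M" "integrable M g" "AE x in M. (norm (u x))\<^sup>2 \<le> g x"
  shows "u \<in> L2 M"
proof -
  have "integrable M (\<lambda>x. (norm (u x))\<^sup>2)"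
    by (rule Bochner_Integration.integrable_bound[OF assms(2)])
       (use assms in \<open>auto elim: eventually_mono\<close>)
  with assms(1) show ?thesis by (simp add: L2_def)
qed

lemma L2_add: "u \<in> L2 M \<Longrightarrow> v \<in> L2 M \<Longrightarrow> (\<lambda>x. u x + v x) \<in> L2 M"
  by (rule L2_bound[where g="\<lambda>x. 2 * (norm (u x))\<^sup>2 + 2 * (norm (v x))\<^sup>2"])
     (auto simp: L2_def power2_norm_add_le)

lemma L2_scale: "u \<in> L2 M \<Longrightarrow> (\<lambda>x. c *\<^sub>R u x) \<in> L2 M"
  by (auto simp: L2_def power_mult_distrib)

lemma L2_diff: "u \<in> L2 M \<Longrightarrow> v \<in> L2 M \<Longrightarrow> (\<lambda>x. u x - v x) \<in> L2 M"
  using L2_add[of u M "\<lambda>x. (-1) *\<^sub>R v x"] L2_scale[of v M "-1"] by simp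

lemma L2_lincomb: "u \<in> L2 M \<Longrightarrow> v \<in> L2 M \<Longrightarrow> (\<lambda>x. a *\<^sub>R u x + b *\<^sub>R v x) \<in> L2 M"
  by (intro L2_add L2_scale)

lemma L2_inner_integrable:
  assumes "u \<in> L2 M" "v \<in> L2 M"
  shows "integrable M (\<lambda>x. u x \<bullet> v x)"
proof (rule Bochner_Integration.integrable_bound)
  show "integrable M (\<lambda>x. ((norm (u x))\<^sup>2 + (norm (v x))\<^sup>2) / 2)"
    using assms by (auto simp: L2_def)
  show "AE x in M. norm (u x \<bullet> v x) \<le> norm (((norm (u x))\<^sup>2 + (norm (v x))\<^sup>2) / 2)"
  proof (rule AE_I2)
    show "norm (u x \<bullet> v x) \<le> norm (((norm (u x))\<^sup>2 + (norm (v x))\<^sup>2) / 2)" for x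
      using inner_le_half_squares[of "u x" "v x"] unfolding real_norm_def by linarith
  qed
qed (use assms in \<open>auto simp: L2_def\<close>)

lemma L2_AE_cong:
  assumes "u \<in> L2 M" "v \<in> borel_measurable M" "AE x in M. u x = v x"
  shows "v \<in> L2 M"
  by (rule L2_bound[OF assms(2) L2_integrable[OF assms(1)]]) (use assms(3) in eventually_elim, simp)

text \<open>The discriminant argument for the nonnegative quadratic polynomial \<open>s \<mapsto> \<integral> \<bar>s u - v\<bar>\<^sup>2\<close>.\<close>

lemma L2_Cauchy_Schwarz:
  assumes u: "u \<in> L2 M" and v: "v \<in> L2 M"
  shows "(LINT x|M. u x \<bullet> v x)\<^sup>2 \<le> (LINT x|M. (norm (u x))\<^sup>2) * (LINT x|M. (norm (v x))\<^sup>2)"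
proof -
  define A B C where "A = (LINT x|M. (norm (u x))\<^sup>2)" and "B = (LINT x|M. u x \<bullet> v x)"
    and "C = (LINT x|M. (norm (v x))\<^sup>2)"
  have quad: "0 \<le> s\<^sup>2 * A - 2 * s * B + C" for s
  proof -
    have "0 \<le> (LINT x|M. (norm (s *\<^sub>R u x - v x))\<^sup>2)" by simp
    also have "\<dots> = (LINT x|M. s\<^sup>2 * (norm (u x))\<^sup>2 - 2 * s * (u x \<bullet> v x) + (norm (v x))\<^sup>2)"
      unfolding power2_norm_eq_inner
      by (intro Bochner_Integration.integral_cong refl) (simp add: algebra_simps inner_commute power2_eq_square)
    also have "\<dots> = s\<^sup>2 * A - 2 * s * B + C"
      using L2_integrable[OF u] L2_integrable[OF v] L2_inner_integrable[OF u v]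
      by (simp add: A_def B_def C_def)
    finally show ?thesis .
  qed
  have "B\<^sup>2 \<le> A * C"
  proof (cases "A = 0")
    case True
    have "B = 0"
    proof (rule ccontr)
      assume "B \<noteq> 0"
      with quad[of "(C + 1) / (2 * B)"] True show False by simp
    qed
    with True show ?thesis by simp
  next
    case False
    moreover have "A \<ge> 0" by (simp add: A_def)
    ultimately have "A > 0" by simp
    from mult_left_mono[OF quad[of "B / A"] less_imp_le[OF this]] this show ?thesis
      by (simp add: power2_eq_square field_simps)
  qed
  then show ?thesis by (simp add: A_def B_def C_def)
qed

lemma sqdist_triangle:
  assumes "u \<in> L2 M" "v \<in> L2 M" "w \<in> L2 M"
  shows "sqdist M u w \<le> 2 * sqdist M u v + 2 * sqdist M v w"
proof -
  have "sqdist M u w \<le> (LINT x|M. 2 * (norm (u x - v x))\<^sup>2 + 2 * (norm (v x - w x))\<^sup>2)"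
    unfolding sqdist_def
  proof (rule integral_mono)
    show "(norm (u x - w x))\<^sup>2 \<le> 2 * (norm (u x - v x))\<^sup>2 + 2 * (norm (v x - w x))\<^sup>2" for x
      using power2_norm_add_le[of "u x - v x" "v x - w x"] by simp
  qed (use assms in \<open>auto intro!: L2_integrable L2_diff\<close>)
  also have "\<dots> = 2 * sqdist M u v + 2 * sqdist M v w"
    unfolding sqdist_def using assms
    by (subst Bochner_Integration.integral_add) (auto intro!: L2_integrable L2_diff)
  finally show ?thesis .
qed

text \<open>On a finite measure space the \<open>L\<^sup>1\<close> norms of the increments are bounded by a multiple of \<open>2\<^sup>-\<^sup>n\<close>. So the
  increments are absolutely summable almost everywhere, and Fatou's lemma bounds the
  distance to the pointwise limit.\<close>

lemma L2_complete:
  fixes u :: "nat \<Rightarrow> 'b \<Rightarrow> 'c::euclidean_space"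
  assumes "finite_measure M" and u: "\<And>n. u n \<in> L2 M"
    and cauchy: "\<And>n m. n \<le> m \<Longrightarrow> sqdist M (u n) (u m) \<le> (1/4) ^ n"
  obtains w where "w \<in> L2 M" "\<And>n. sqdist M (u n) w \<le> (1/4) ^ n"
proof -
  interpret finite_measure M by fact
  have [measurable]: "u n \<in> borel_measurable M" for n using u by (rule L2_measurable)
  have int2: "integrable M (\<lambda>x. (norm (u n x - u m x))\<^sup>2)" for n m
    using u by (intro L2_integrable L2_diff)
  have step: "(\<integral>\<^sup>+x. ennreal (norm (u (Suc n) x - u n x)) \<partial>M) \<le> ennreal ((1 + measure M (space M)) * (1/2) ^ n)" for n
  proof -
    have "norm (u (Suc n) x - u n x) \<le> 2 ^ n * (norm (u n x - u (Suc n) x))\<^sup>2 + (1/2) ^ n" for x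
    proof -
      define t c d where "t = norm (u n x - u (Suc n) x)" and "c = (2::real) ^ n" and "d = (1/2::real) ^ n"
      have cd: "c * d = 1" by (simp add: c_def d_def power_one_over)
      have "0 \<le> c * (t - d)\<^sup>2" by (simp add: c_def)
      also have "\<dots> = c * t\<^sup>2 - 2 * t * (c * d) + d * (c * d)"
        by (simp add: power2_eq_square algebra_simps)
      finally have "2 * t \<le> c * t\<^sup>2 + d" by (simp add: cd)
      moreover have "0 \<le> t" by (simp add: t_def)
      ultimately have "t \<le> c * t\<^sup>2 + d" by linarith
      then show ?thesis by (simp add: t_def c_def d_def norm_minus_commute)
    qed
    then have "(\<integral>\<^sup>+x. ennreal (norm (u (Suc n) x - u n x)) \<partial>M) \<le>
        (\<integral>\<^sup>+x. ennreal (2 ^ n * (norm (u n x - u (Suc n) x))\<^sup>2 + (1/2) ^ n) \<partial>M)"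
      by (intro nn_integral_mono ennreal_leI)
    also have "\<dots> = ennreal (LINT x|M. 2 ^ n * (norm (u n x - u (Suc n) x))\<^sup>2 + (1/2) ^ n)"
      using int2 by (intro nn_integral_eq_integral) auto
    also have "(LINT x|M. 2 ^ n * (norm (u n x - u (Suc n) x))\<^sup>2 + (1/2) ^ n) =
        2 ^ n * sqdist M (u n) (u (Suc n)) + measure M (space M) * (1/2) ^ n"
      unfolding sqdist_def using int2 by (subst Bochner_Integration.integral_add) auto
    also have "ennreal \<dots> \<le> ennreal ((1 + measure M (space M)) * (1/2) ^ n)"
    proof (rule ennreal_leI)
      have "2 ^ n * sqdist M (u n) (u (Suc n)) \<le> 2 ^ n * (1/4) ^ n"
        using cauchy[of n "Suc n"] by (intro mult_left_mono) auto
      also have "2 ^ n * (1/4) ^ n = (1/2::real) ^ n"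
        by (simp flip: power_mult_distrib)
      finally show "2 ^ n * sqdist M (u n) (u (Suc n)) + measure M (space M) * (1/2) ^ n
          \<le> (1 + measure M (space M)) * (1/2) ^ n"
        by (simp add: algebra_simps)
    qed
    finally show ?thesis .
  qed
  have "(\<integral>\<^sup>+x. (\<Sum>n. ennreal (norm (u (Suc n) x - u n x))) \<partial>M) = (\<Sum>n. \<integral>\<^sup>+x. ennreal (norm (u (Suc n) x - u n x)) \<partial>M)"
    by (rule nn_integral_suminf) measurable
  also have "\<dots> \<le> (\<Sum>n. ennreal ((1 + measure M (space M)) * (1/2) ^ n))"
    using step by (intro suminf_le) auto
  also have "\<dots> < \<infinity>"
    by (subst suminf_ennreal2) (auto intro!: summable_mult summable_geometric)
  finally have "AE x in M. (\<Sum>n. ennreal (norm (u (Suc n) x - u n x))) \<noteq> \<infinity>"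
    by (intro nn_integral_PInf_AE) auto
  then have conv: "AE x in M. convergent (\<lambda>n. u n x)"
  proof eventually_elim
    case (elim x)
    then have "summable (\<lambda>n. norm (u (Suc n) x - u n x))"
      by (intro summable_suminf_not_top) auto
    then have "summable (\<lambda>n. u (Suc n) x - u n x)"
      by (rule summable_norm_cancel)
    then have "convergent (\<lambda>n. \<Sum>i<n. u (Suc i) x - u i x)"
      by (simp add: summable_iff_convergent)
    also have "(\<lambda>n. \<Sum>i<n. u (Suc i) x - u i x) = (\<lambda>n. u n x - u 0 x)"
      by (rule ext) (rule sum_lessThan_telescope)
    finally have "convergent (\<lambda>n. (u n x - u 0 x) + u 0 x)"
      by (intro convergent_add convergent_const)
    then show ?case by simp
  qed
  define w where "w x = lim (\<lambda>n. u n x)" for x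
  have [measurable]: "w \<in> borel_measurable M" unfolding w_def by measurable
  have lim: "AE x in M. (\<lambda>n. u n x) \<longlonglongrightarrow> w x"
    using conv by eventually_elim (simp add: w_def convergent_LIMSEQ_iff)
  have fatou: "integrable M (\<lambda>x. (norm (u n x - w x))\<^sup>2) \<and> sqdist M (u n) w \<le> (1/4) ^ n" for n
  proof -
    have "(\<integral>\<^sup>+x. ennreal ((norm (u n x - w x))\<^sup>2) \<partial>M) = (\<integral>\<^sup>+x. liminf (\<lambda>m. ennreal ((norm (u n x - u m x))\<^sup>2)) \<partial>M)"
    proof (rule nn_integral_cong_AE, use lim in eventually_elim)
      case (elim x)
      then have "(\<lambda>m. ennreal ((norm (u n x - u m x))\<^sup>2)) \<longlonglongrightarrow> ennreal ((norm (u n x - w x))\<^sup>2)"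
        by (intro tendsto_ennrealI tendsto_intros)
      then show ?case by (rule lim_imp_Liminf[OF sequentially_bot, symmetric])
    qed
    also have "\<dots> \<le> liminf (\<lambda>m. \<integral>\<^sup>+x. ennreal ((norm (u n x - u m x))\<^sup>2) \<partial>M)"
      by (rule nn_integral_liminf) measurable
    also have "\<dots> \<le> ennreal ((1/4) ^ n)"
    proof (rule Liminf_le)
      show "\<forall>\<^sub>F m in sequentially. (\<integral>\<^sup>+x. ennreal ((norm (u n x - u m x))\<^sup>2) \<partial>M) \<le> ennreal ((1/4) ^ n)"
        using eventually_ge_at_top[of n]
      proof eventually_elim
        case (elim m)
        have "(\<integral>\<^sup>+x. ennreal ((norm (u n x - u m x))\<^sup>2) \<partial>M) = ennreal (sqdist M (u n) (u m))"
          unfolding sqdist_def using int2 by (intro nn_integral_eq_integral) auto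
        with cauchy[OF elim] show ?case by (simp add: ennreal_leI)
      qed
    qed simp
    finally have le: "(\<integral>\<^sup>+x. ennreal ((norm (u n x - w x))\<^sup>2) \<partial>M) \<le> ennreal ((1/4) ^ n)" .
    then have i: "integrable M (\<lambda>x. (norm (u n x - w x))\<^sup>2)"
      by (intro integrableI_bounded) (auto simp: le_less_trans[OF _ ennreal_less_top])
    then have "ennreal (sqdist M (u n) w) \<le> ennreal ((1/4) ^ n)"
      using le unfolding sqdist_def by (subst nn_integral_eq_integral[symmetric]) auto
    with i show ?thesis by simp
  qed
  show ?thesis
  proof (rule that)
    have "(\<lambda>x. u 0 x - w x) \<in> L2 M" using fatou by (auto simp: L2_def)
    from L2_diff[OF u[of 0] this] show "w \<in> L2 M" by simp
  qed (use fatou in auto)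
qed

text \<open>A minimising sequence for the distance from \<open>h\<close> to \<open>X\<close> is Cauchy by the parallelogram law. Each of its
  members is orthogonal to \<open>X\<close> up to an error that is controlled by how nearly it is minimal, and this error
  disappears in the limit.\<close>

lemma L2_projection:
  fixes X :: "('b \<Rightarrow> 'c::euclidean_space) set"
  assumes M: "finite_measure M" and X: "X \<subseteq> L2 M" "X \<noteq> {}"
    and lin: "\<And>u v a b. u \<in> X \<Longrightarrow> v \<in> X \<Longrightarrow> (\<lambda>x. a *\<^sub>R u x + b *\<^sub>R v x) \<in> X"
    and closed: "\<And>w. w \<in> L2 M \<Longrightarrow> (\<And>\<epsilon>. \<epsilon> > 0 \<Longrightarrow> \<exists>v\<in>X. sqdist M w v < \<epsilon>) \<Longrightarrow> w \<in> X"
    and h: "h \<in> L2 M"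
  obtains w where "w \<in> X" "\<And>z. z \<in> X \<Longrightarrow> (LINT x|M. w x \<bullet> z x) = (LINT x|M. h x \<bullet> z x)"
proof -
  define d where "d = (INF v\<in>X. sqdist M h v)"
  have bdd: "bdd_below (sqdist M h ` X)" by (rule bdd_belowI[of _ 0]) (auto simp: sqdist_nonneg)
  have d: "d \<le> sqdist M h v" if "v \<in> X" for v
    unfolding d_def using bdd that by (rule cINF_lower)
  have "\<exists>v\<in>X. sqdist M h v < d + (1/4) ^ n / 4" for n
    using cINF_less_iff[OF X(2) bdd, of "d + (1/4) ^ n / 4"] unfolding d_def by auto
  then obtain u where u: "\<And>n. u n \<in> X" "\<And>n. sqdist M h (u n) < d + (1/4) ^ n / 4" by metis
  have uL: "u n \<in> L2 M" for n using u X by auto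
  have "sqdist M (u n) (u m) \<le> (1/4) ^ n" if "n \<le> m" for n m
  proof -
    define v where "v = (\<lambda>x. (1/2) *\<^sub>R u n x + (1/2) *\<^sub>R u m x)"
    have v: "v \<in> X" unfolding v_def by (intro lin u)
    have "sqdist M (u n) (u m) = (LINT x|M. 2 * (norm (h x - u n x))\<^sup>2 + 2 * (norm (h x - u m x))\<^sup>2
        - 4 * (norm (h x - v x))\<^sup>2)"
      unfolding sqdist_def v_def
      by (intro Bochner_Integration.integral_cong refl)
         (simp add: power2_norm_eq_inner algebra_simps inner_commute)
    also have "\<dots> = 2 * sqdist M h (u n) + 2 * sqdist M h (u m) - 4 * sqdist M h v"
      unfolding sqdist_def using L2_integrable[OF L2_diff[OF h uL]] L2_integrable[OF L2_diff[OF h subsetD[OF X(1) v]]]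
      by simp
    also have "\<dots> \<le> (1/4) ^ n / 2 + (1/4) ^ m / 2"
      using d[OF v] u(2)[of n] u(2)[of m] by (simp add: algebra_simps)
    also have "\<dots> \<le> (1/4) ^ n"
      using power_decreasing[OF that, of "1/4::real"] by linarith
    finally show ?thesis .
  qed
  then obtain w where w: "w \<in> L2 M" "\<And>n. sqdist M (u n) w \<le> (1/4) ^ n"
    using L2_complete[of M u] M uL by blast
  have to0: "(\<lambda>n. (1/4) ^ n :: real) \<longlonglongrightarrow> 0" by (rule LIMSEQ_power_zero) simp
  have "w \<in> X"
  proof (rule closed[OF w(1)])
    fix \<epsilon> :: real assume "\<epsilon> > 0"
    then obtain n where "(1/4) ^ n < \<epsilon>"
      using real_arch_pow_inv[of \<epsilon> "1/4"] by auto
    with w(2)[of n] u(1)[of n] show "\<exists>v\<in>X. sqdist M w v < \<epsilon>"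
      by (auto simp: sqdist_commute[of M w] intro!: bexI[of _ "u n"])
  qed
  moreover have "(LINT x|M. w x \<bullet> z x) = (LINT x|M. h x \<bullet> z x)" if z: "z \<in> X" for z
  proof -
    have zL: "z \<in> L2 M" using z X by auto
    define Q where "Q = (LINT x|M. (norm (z x))\<^sup>2)"
    define E where "E = (LINT x|M. (h x - w x) \<bullet> z x)"
    \<comment> \<open>variation of the members of the minimising sequence in direction \<open>z\<close>\<close>
    have main: "2 * s * E \<le> 2 * s\<^sup>2 * Q" for s
    proof -
      have "2 * s * E \<le> 2 * (1/4) ^ n + 2 * s\<^sup>2 * Q" for n
      proof -
        note i1 = L2_inner_integrable[OF L2_diff[OF h uL[of n]] zL]
          and i2 = L2_inner_integrable[OF L2_diff[OF uL[of n] w(1)] zL]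
          and n1 = L2_integrable[OF L2_diff[OF h uL[of n]]]
          and n2 = L2_integrable[OF L2_diff[OF uL[of n] w(1)]]
          and nz = L2_integrable[OF zL]
        have "(\<lambda>x. 1 *\<^sub>R u n x + s *\<^sub>R z x) \<in> X" by (intro lin u z)
        from d[OF this] have "d \<le> sqdist M h (\<lambda>x. 1 *\<^sub>R u n x + s *\<^sub>R z x)" .
        also have "\<dots> = (LINT x|M. (norm (h x - u n x))\<^sup>2 - 2 * s * ((h x - u n x) \<bullet> z x) + s\<^sup>2 * (norm (z x))\<^sup>2)"
          unfolding sqdist_def power2_norm_eq_inner
          by (intro Bochner_Integration.integral_cong refl)
             (simp add: algebra_simps inner_commute power2_eq_square)
        also have "\<dots> = sqdist M h (u n) - 2 * s * (LINT x|M. (h x - u n x) \<bullet> z x) + s\<^sup>2 * Q"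
          unfolding sqdist_def Q_def using i1 n1 nz by simp
        finally have a: "2 * s * (LINT x|M. (h x - u n x) \<bullet> z x) \<le> (1/4) ^ n + s\<^sup>2 * Q"
          using u(2)[of n] zero_le_power[of "1/4::real" n] by linarith
        have "(LINT x|M. 2 * s * ((u n x - w x) \<bullet> z x)) \<le> (LINT x|M. (norm (u n x - w x))\<^sup>2 + s\<^sup>2 * (norm (z x))\<^sup>2)"
        proof (rule integral_mono)
          show "2 * s * ((u n x - w x) \<bullet> z x) \<le> (norm (u n x - w x))\<^sup>2 + s\<^sup>2 * (norm (z x))\<^sup>2" for x
            using inner_le_half_squares[of "u n x - w x" "s *\<^sub>R z x"]
            by (simp add: power_mult_distrib abs_le_iff)
        qed (use i2 n2 nz in auto)
        also have "\<dots> = sqdist M (u n) w + s\<^sup>2 * Q"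
          unfolding sqdist_def Q_def using n2 nz by simp
        finally have b: "2 * s * (LINT x|M. (u n x - w x) \<bullet> z x) \<le> (1/4) ^ n + s\<^sup>2 * Q"
          using w(2)[of n] i2 by simp
        have "E = (LINT x|M. ((h x - u n x) \<bullet> z x) + ((u n x - w x) \<bullet> z x))"
          unfolding E_def by (simp add: algebra_simps)
        also have "\<dots> = (LINT x|M. (h x - u n x) \<bullet> z x) + (LINT x|M. (u n x - w x) \<bullet> z x)"
          using i1 i2 by simp
        finally show ?thesis using a b by (simp add: algebra_simps)
      qed
      moreover have "(\<lambda>n. 2 * (1/4) ^ n + 2 * s\<^sup>2 * Q) \<longlonglongrightarrow> 2 * 0 + 2 * s\<^sup>2 * Q"
        by (intro tendsto_intros to0)
      ultimately show ?thesis
        by (intro LIMSEQ_le_const[where a="2 * s * E"]) auto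
    qed
    have "Q \<ge> 0" by (simp add: Q_def)
    \<comment> \<open>adding 1 covers the case \<open>Q = 0\<close>\<close>
    define s where "s = E / (Q + 1)"
    have E: "E = s * (Q + 1)" using \<open>Q \<ge> 0\<close> by (simp add: s_def)
    have "s\<^sup>2 \<le> 0" using main[of s] by (simp add: E power2_eq_square algebra_simps)
    then have "E = 0" by (simp add: E)
    then show ?thesis
      unfolding E_def using L2_inner_integrable[OF h zL] L2_inner_integrable[OF w(1) zL]
      by (simp add: inner_diff_left)
  qed
  ultimately show ?thesis by (rule that)
qed

section \<open>The space \<open>H\<^sub>0\<^sup>1\<close> as a closed space of graphs\<close>

text \<open>The space \<open>H\<^sub>0\<^sup>1\<close> with each function paired with its weak gradient. The pair is a single element of \<open>L\<^sup>2\<close>, so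
  limits of functions and of gradients need no separate treatment.\<close>

definition H10_graph :: "'a::euclidean_space set \<Rightarrow> ('a \<Rightarrow> real \<times> 'a) set" where
  "H10_graph \<Omega> = {W \<in> L2 (lebesgue_on \<Omega>).
     \<forall>\<epsilon>>0. \<exists>\<phi>\<in>test_functions \<Omega>. sqdist (lebesgue_on \<Omega>) W (\<lambda>x. (\<phi> x, grad \<phi> x)) < \<epsilon>}"

lemma norm_Pair_squared: "(norm (a, b))\<^sup>2 = (norm a)\<^sup>2 + (norm b)\<^sup>2"
  by (simp add: norm_prod_def)

lemma L2_Pair_iff: "(\<lambda>x. (u x, G x)) \<in> L2 M \<longleftrightarrow> u \<in> L2 M \<and> G \<in> L2 M"
proof
  assume W: "(\<lambda>x. (u x, G x)) \<in> L2 M"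
  have [measurable]: "(\<lambda>x. (u x, G x)) \<in> borel_measurable M" using W by (rule L2_measurable)
  have "(\<lambda>x. fst (u x, G x)) \<in> borel_measurable M" "(\<lambda>x. snd (u x, G x)) \<in> borel_measurable M"
    by (intro borel_measurable_continuous_on[of fst] borel_measurable_continuous_on[of snd] continuous_intros
        L2_measurable[OF W])+
  then have "u \<in> borel_measurable M" "G \<in> borel_measurable M" by simp_all
  then show "u \<in> L2 M \<and> G \<in> L2 M"
    using L2_integrable[OF W] by (auto intro!: L2_bound simp: norm_Pair_squared)
next
  assume "u \<in> L2 M \<and> G \<in> L2 M"
  then show "(\<lambda>x. (u x, G x)) \<in> L2 M"
    by (auto simp: L2_def norm_Pair_squared)
qed

lemma L2_fst: "W \<in> L2 M \<Longrightarrow> (\<lambda>x. fst (W x)) \<in> L2 M"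
  and L2_snd: "W \<in> L2 M \<Longrightarrow> (\<lambda>x. snd (W x)) \<in> L2 M"
  using L2_Pair_iff[of "\<lambda>x. fst (W x)" "\<lambda>x. snd (W x)" M] by simp_all

lemma L2_Cauchy_Schwarz_sqdist:
  assumes "u \<in> L2 M" "u' \<in> L2 M" "v \<in> L2 M"
  shows "((LINT x|M. u x \<bullet> v x) - (LINT x|M. u' x \<bullet> v x))\<^sup>2 \<le> sqdist M u u' * (LINT x|M. (norm (v x))\<^sup>2)"
  using L2_Cauchy_Schwarz[OF L2_diff[OF assms(1,2)] assms(3)]
  by (simp add: sqdist_def inner_diff_left L2_inner_integrable assms)

locale bounded_open =
  fixes \<Omega> :: "'a::euclidean_space set"
  assumes open_dom: "open \<Omega>" and bounded_dom: "bounded \<Omega>"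
begin

abbreviation "M \<equiv> lebesgue_on \<Omega>"

lemma dom_sets: "\<Omega> \<in> sets lebesgue"
  using open_dom by simp

lemma finite_measure_dom: "finite_measure M"
  by (intro finite_measure_lebesgue_on bounded_set_imp_lmeasurable bounded_dom dom_sets)

sublocale finite_measure M
  by (rule finite_measure_dom)

lemma L2_bounded:
  fixes u :: "'a \<Rightarrow> 'c::euclidean_space"
  assumes "u \<in> borel_measurable M" "AE x in M. norm (u x) \<le> C"
  shows "u \<in> L2 M"
proof (rule L2_bound[OF assms(1)])
  show "AE x in M. (norm (u x))\<^sup>2 \<le> C\<^sup>2"
    using assms(2) by eventually_elim (simp add: power_mono)
qed simp

lemma continuous_L2:
  fixes u :: "'a \<Rightarrow> 'c::euclidean_space"
  assumes "continuous_on UNIV u"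
  shows "u \<in> L2 M"
proof -
  have "bounded (u ` closure \<Omega>)"
    using bounded_dom by (intro compact_imp_bounded compact_continuous_image continuous_on_subset[OF assms]) auto
  then obtain C where C: "\<And>x. x \<in> closure \<Omega> \<Longrightarrow> norm (u x) \<le> C" by (auto simp: bounded_iff)
  show ?thesis
  proof (rule L2_bounded)
    show "u \<in> borel_measurable M"
      using assms by (intro measurable_restrict_space1 measurable_completion) (simp add: borel_measurable_continuous_onI)
    show "AE x in M. norm (u x) \<le> C"
      using C closure_subset[of \<Omega>] by (intro AE_I2) auto
  qed
qed

lemma L2_imp_integrable:
  fixes u :: "'a \<Rightarrow> 'c::euclidean_space"
  assumes "u \<in> L2 M"
  shows "integrable M u"
proof (rule Bochner_Integration.integrable_bound)
  show "integrable M (\<lambda>x. 1 + (norm (u x))\<^sup>2)"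
    using L2_integrable[OF assms] by simp
  have "t \<le> 1 + t\<^sup>2" for t :: real
    using zero_le_power2[of "t - 1/2"] by (simp add: power2_eq_square algebra_simps)
  then show "AE x in M. norm (u x) \<le> norm (1 + (norm (u x))\<^sup>2)" by simp
qed (rule L2_measurable[OF assms])

lemma L2_imp_L1_loc:
  fixes u :: "'a \<Rightarrow> 'c::euclidean_space"
  assumes "u \<in> L2 M"
  shows "u \<in> L1_loc \<Omega>"
proof -
  have "u absolutely_integrable_on \<Omega>"
    using L2_imp_integrable[OF assms] integrable_restrict_space[of \<Omega> lebesgue u] dom_sets
    by (simp add: set_integrable_def)
  then have "u absolutely_integrable_on K" if "compact K" "K \<subseteq> \<Omega>" for K
    by (rule set_integrable_subset) (use that in \<open>auto intro: fmeasurableD lmeasurable_compact\<close>)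
  then show ?thesis by (simp add: L1_loc_def)
qed

text \<open>Lebesgue measure is complete. This makes \<^const>\<open>weak_gradient\<close>, which is an arbitrary choice, measurable.\<close>

lemma AE_cong_measurable:
  fixes f g :: "'a \<Rightarrow> 'c::euclidean_space"
  assumes "f \<in> borel_measurable M" "AE x in M. f x = g x"
  shows "g \<in> borel_measurable M"
proof -
  have "(\<lambda>x. if x \<in> \<Omega> then g x else 0) \<in> borel_measurable lebesgue"
  proof (rule borel_measurable_AE)
    show "(\<lambda>x. if x \<in> \<Omega> then f x else 0) \<in> borel_measurable lebesgue"
      using assms(1) dom_sets by (rule borel_measurable_if_I)
    show "AE x in lebesgue. (if x \<in> \<Omega> then f x else 0) = (if x \<in> \<Omega> then g x else 0)"
      using assms(2) dom_sets by (auto simp: AE_restrict_space_iff elim: eventually_mono)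
  qed
  then show ?thesis by (rule borel_measurable_if_D)
qed

lemma test_graph_L2: "smooth \<phi> \<Longrightarrow> (\<lambda>x. (\<phi> x, grad \<phi> x)) \<in> L2 M"
  by (intro continuous_L2 continuous_intros smooth_continuous continuous_on_grad)

lemma H10_graph_L2: "W \<in> H10_graph \<Omega> \<Longrightarrow> W \<in> L2 M"
  by (simp add: H10_graph_def)

lemma H10_graph_test:
  assumes "\<phi> \<in> test_functions \<Omega>"
  shows "(\<lambda>x. (\<phi> x, grad \<phi> x)) \<in> H10_graph \<Omega>"
  unfolding H10_graph_def
  using assms test_graph_L2[OF test_functions_smooth[OF assms]] by (auto intro!: bexI[of _ \<phi>] simp: sqdist_def)

lemma H10_graph_nonempty: "H10_graph \<Omega> \<noteq> {}"
proof -
  have "(\<lambda>x. 0) \<in> test_functions \<Omega>"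
    by (rule test_functionsI[of _ "{}"]) (auto intro: smooth_const)
  from H10_graph_test[OF this] show ?thesis by auto
qed

lemma H10_graph_closed:
  assumes W: "W \<in> L2 M" and approx: "\<And>\<epsilon>. \<epsilon> > 0 \<Longrightarrow> \<exists>V\<in>H10_graph \<Omega>. sqdist M W V < \<epsilon>"
  shows "W \<in> H10_graph \<Omega>"
proof -
  have "\<exists>\<phi>\<in>test_functions \<Omega>. sqdist M W (\<lambda>x. (\<phi> x, grad \<phi> x)) < \<epsilon>" if \<epsilon>: "\<epsilon> > 0" for \<epsilon>
  proof -
    obtain V where V: "V \<in> H10_graph \<Omega>" "sqdist M W V < \<epsilon> / 4"
      using approx[of "\<epsilon> / 4"] \<epsilon> by auto
    obtain \<phi> where \<phi>: "\<phi> \<in> test_functions \<Omega>" "sqdist M V (\<lambda>x. (\<phi> x, grad \<phi> x)) < \<epsilon> / 4"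
      using V(1) \<epsilon> unfolding H10_graph_def by (auto dest!: spec[of _ "\<epsilon> / 4"])
    have "sqdist M W (\<lambda>x. (\<phi> x, grad \<phi> x)) < \<epsilon>"
      using sqdist_triangle[OF W H10_graph_L2[OF V(1)] test_graph_L2[OF test_functions_smooth[OF \<phi>(1)]]] V(2) \<phi>(2)
      by linarith
    with \<phi>(1) show ?thesis by blast
  qed
  with W show ?thesis by (simp add: H10_graph_def)
qed

lemma H10_graph_limit:
  assumes W: "W \<in> L2 M" and V: "\<And>n. V n \<in> H10_graph \<Omega>" and lim: "(\<lambda>n. sqdist M W (V n)) \<longlonglongrightarrow> 0"
  shows "W \<in> H10_graph \<Omega>"
proof (rule H10_graph_closed[OF W])
  fix \<epsilon> :: real assume "\<epsilon> > 0"
  with lim have "\<forall>\<^sub>F n in sequentially. sqdist M W (V n) < \<epsilon>" by (rule order_tendstoD)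
  then show "\<exists>V\<in>H10_graph \<Omega>. sqdist M W V < \<epsilon>"
    using V by (auto simp: eventually_sequentially)
qed

lemma H10_graph_approx:
  assumes "W \<in> H10_graph \<Omega>"
  obtains \<phi> where "\<And>n. \<phi> n \<in> test_functions \<Omega>" "(\<lambda>n. sqdist M W (\<lambda>x. (\<phi> n x, grad (\<phi> n) x))) \<longlonglongrightarrow> 0"
proof -
  have "\<exists>\<phi>\<in>test_functions \<Omega>. sqdist M W (\<lambda>x. (\<phi> x, grad \<phi> x)) < inverse (real (Suc n))" for n
    using assms unfolding H10_graph_def by (auto dest!: spec[of _ "inverse (real (Suc n))"])
  then obtain \<phi> where \<phi>: "\<And>n. \<phi> n \<in> test_functions \<Omega>"
    "\<And>n. sqdist M W (\<lambda>x. (\<phi> n x, grad (\<phi> n) x)) < inverse (real (Suc n))" by metis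
  have "(\<lambda>n. sqdist M W (\<lambda>x. (\<phi> n x, grad (\<phi> n) x))) \<longlonglongrightarrow> 0"
    by (rule tendsto_sandwich[OF _ _ tendsto_const LIMSEQ_inverse_real_of_nat])
       (use \<phi>(2) in \<open>auto intro: always_eventually less_imp_le sqdist_nonneg\<close>)
  with \<phi>(1) show ?thesis by (rule that)
qed

lemma test_functions_lincomb:
  assumes \<phi>: "\<phi> \<in> test_functions \<Omega>" and \<psi>: "\<psi> \<in> test_functions \<Omega>"
  shows "(\<lambda>x. a * \<phi> x + b * \<psi> x) \<in> test_functions \<Omega>"
    and "grad (\<lambda>x. a * \<phi> x + b * \<psi> x) x = a *\<^sub>R grad \<phi> x + b *\<^sub>R grad \<psi> x"
proof -
  note s = \<phi>[THEN test_functions_smooth] \<psi>[THEN test_functions_smooth]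
  obtain K where K: "compact K" "K \<subseteq> \<Omega>" "\<And>x. x \<notin> K \<Longrightarrow> \<phi> x = 0" using \<phi> by (rule test_functionsE) blast
  obtain L where L: "compact L" "L \<subseteq> \<Omega>" "\<And>x. x \<notin> L \<Longrightarrow> \<psi> x = 0" using \<psi> by (rule test_functionsE) blast
  show "(\<lambda>x. a * \<phi> x + b * \<psi> x) \<in> test_functions \<Omega>"
    by (rule test_functionsI[of _ "K \<union> L"])
       (use s K L in \<open>auto intro!: smooth_add smooth_mult smooth_const compact_Un\<close>)
  show "grad (\<lambda>x. a * \<phi> x + b * \<psi> x) x = a *\<^sub>R grad \<phi> x + b *\<^sub>R grad \<psi> x"
    by (rule grad_eqI)
       (auto intro!: derivative_eq_intros s[THEN smooth_has_derivative_grad] simp: algebra_simps inner_add_left)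
qed

lemma H10_graph_lincomb:
  assumes W: "W \<in> H10_graph \<Omega>" and V: "V \<in> H10_graph \<Omega>"
  shows "(\<lambda>x. a *\<^sub>R W x + b *\<^sub>R V x) \<in> H10_graph \<Omega>"
proof -
  obtain \<phi> where \<phi>: "\<And>n. \<phi> n \<in> test_functions \<Omega>" "(\<lambda>n. sqdist M W (\<lambda>x. (\<phi> n x, grad (\<phi> n) x))) \<longlonglongrightarrow> 0"
    using W by (rule H10_graph_approx) blast
  obtain \<psi> where \<psi>: "\<And>n. \<psi> n \<in> test_functions \<Omega>" "(\<lambda>n. sqdist M V (\<lambda>x. (\<psi> n x, grad (\<psi> n) x))) \<longlonglongrightarrow> 0"
    using V by (rule H10_graph_approx) blast
  note WL = H10_graph_L2[OF W] and VL = H10_graph_L2[OF V]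
  define \<theta> where "\<theta> n x = a * \<phi> n x + b * \<psi> n x" for n x
  have \<theta>: "\<theta> n \<in> test_functions \<Omega>" "grad (\<theta> n) x = a *\<^sub>R grad (\<phi> n) x + b *\<^sub>R grad (\<psi> n) x" for n x
    unfolding \<theta>_def using test_functions_lincomb[OF \<phi>(1)[of n] \<psi>(1)[of n]] by auto
  show ?thesis
  proof (rule H10_graph_limit[of _ "\<lambda>n x. (\<theta> n x, grad (\<theta> n) x)"])
    show "(\<lambda>x. a *\<^sub>R W x + b *\<^sub>R V x) \<in> L2 M" using WL VL by (rule L2_lincomb)
    show "(\<lambda>x. (\<theta> n x, grad (\<theta> n) x)) \<in> H10_graph \<Omega>" for n by (rule H10_graph_test[OF \<theta>(1)])
    let ?P = "\<lambda>n x. (\<phi> n x, grad (\<phi> n) x)" and ?Q = "\<lambda>n x. (\<psi> n x, grad (\<psi> n) x)"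
    have le: "sqdist M (\<lambda>x. a *\<^sub>R W x + b *\<^sub>R V x) (\<lambda>x. (\<theta> n x, grad (\<theta> n) x)) \<le>
        2 * a\<^sup>2 * sqdist M W (?P n) + 2 * b\<^sup>2 * sqdist M V (?Q n)" for n
    proof -
      note PL = test_graph_L2[OF test_functions_smooth[OF \<phi>(1)[of n]]]
        and QL = test_graph_L2[OF test_functions_smooth[OF \<psi>(1)[of n]]]
      note i = L2_integrable[OF L2_diff[OF WL PL]] L2_integrable[OF L2_diff[OF VL QL]]
      have "sqdist M (\<lambda>x. a *\<^sub>R W x + b *\<^sub>R V x) (\<lambda>x. (\<theta> n x, grad (\<theta> n) x)) \<le>
        (LINT x|M. 2 * a\<^sup>2 * (norm (W x - ?P n x))\<^sup>2 + 2 * b\<^sup>2 * (norm (V x - ?Q n x))\<^sup>2)"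
        unfolding sqdist_def
      proof (rule integral_mono)
        show "integrable M (\<lambda>x. (norm (a *\<^sub>R W x + b *\<^sub>R V x - (\<theta> n x, grad (\<theta> n) x)))\<^sup>2)"
          by (intro L2_integrable L2_diff L2_lincomb WL VL test_graph_L2 test_functions_smooth[OF \<theta>(1)])
        have "a *\<^sub>R W x + b *\<^sub>R V x - (\<theta> n x, grad (\<theta> n) x) = a *\<^sub>R (W x - ?P n x) + b *\<^sub>R (V x - ?Q n x)" for x
          by (rule prod_eqI) (simp_all add: \<theta>(2) \<theta>_def algebra_simps)
        then show "(norm (a *\<^sub>R W x + b *\<^sub>R V x - (\<theta> n x, grad (\<theta> n) x)))\<^sup>2 \<le>
            2 * a\<^sup>2 * (norm (W x - ?P n x))\<^sup>2 + 2 * b\<^sup>2 * (norm (V x - ?Q n x))\<^sup>2" for x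
          using power2_norm_add_le[of "a *\<^sub>R (W x - ?P n x)" "b *\<^sub>R (V x - ?Q n x)"]
          by (simp add: power_mult_distrib)
      qed (use i in auto)
      also have "\<dots> = 2 * a\<^sup>2 * sqdist M W (?P n) + 2 * b\<^sup>2 * sqdist M V (?Q n)"
        unfolding sqdist_def using i by simp
      finally show ?thesis .
    qed
    have "(\<lambda>n. 2 * a\<^sup>2 * sqdist M W (?P n) + 2 * b\<^sup>2 * sqdist M V (?Q n)) \<longlonglongrightarrow> 2 * a\<^sup>2 * 0 + 2 * b\<^sup>2 * 0"
      by (intro tendsto_intros \<phi>(2) \<psi>(2))
    then have lim: "(\<lambda>n. 2 * a\<^sup>2 * sqdist M W (?P n) + 2 * b\<^sup>2 * sqdist M V (?Q n)) \<longlonglongrightarrow> 0" by simp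
    show "(\<lambda>n. sqdist M (\<lambda>x. a *\<^sub>R W x + b *\<^sub>R V x) (\<lambda>x. (\<theta> n x, grad (\<theta> n) x))) \<longlonglongrightarrow> 0"
      by (rule tendsto_sandwich[OF _ _ tendsto_const lim]) (auto intro: always_eventually le sqdist_nonneg)
  qed
qed

lemma H10_graph_scale: "W \<in> H10_graph \<Omega> \<Longrightarrow> (\<lambda>x. a *\<^sub>R W x) \<in> H10_graph \<Omega>"
  using H10_graph_lincomb[of W W a 0] by simp

lemma H10_graph_diff: "W \<in> H10_graph \<Omega> \<Longrightarrow> V \<in> H10_graph \<Omega> \<Longrightarrow> (\<lambda>x. W x - V x) \<in> H10_graph \<Omega>"
  using H10_graph_lincomb[of W V 1 "-1"] by simp

text \<open>For a fixed test function the defining identity of weak gradients says that the pair is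
  orthogonal in \<open>L\<^sup>2\<close> to a fixed map \<open>\<xi>\<close>, a property that survives limits in \<open>L\<^sup>2\<close>.\<close>

lemma H10_graph_weak_gradient:
  assumes W: "W \<in> H10_graph \<Omega>"
  shows "has_weak_gradient \<Omega> (\<lambda>x. fst (W x)) (\<lambda>x. snd (W x))"
  unfolding has_weak_gradient_def
proof (intro conjI ballI)
  note WL = H10_graph_L2[OF W]
  show "(\<lambda>x. fst (W x)) \<in> L1_loc \<Omega>" "(\<lambda>x. snd (W x)) \<in> L1_loc \<Omega>"
    using WL by (auto intro: L2_imp_L1_loc L2_fst L2_snd)
  fix \<psi> and b :: 'a assume \<psi>: "\<psi> \<in> test_functions \<Omega>" and b: "b \<in> Basis"
  define \<xi> where "\<xi> x = (frechet_derivative \<psi> (at x) b, \<psi> x *\<^sub>R b)" for x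
  have \<xi>: "\<xi> \<in> L2 M"
    unfolding \<xi>_def using test_functions_smooth[OF \<psi>] b
    by (intro continuous_L2 continuous_intros smooth_continuous[OF smooth_partial] smooth_continuous)
  have expand: "(LINT x|M. V x \<bullet> \<xi> x) = (LINT x|M. fst (V x) * frechet_derivative \<psi> (at x) b) +
      (LINT x|M. (snd (V x) \<bullet> b) * \<psi> x)" if "V \<in> L2 M" for V
  proof -
    have "smooth \<psi>" "smooth (\<lambda>x. frechet_derivative \<psi> (at x) b)"
      using test_functions_smooth[OF \<psi>] b smooth_partial by auto
    then have "(\<lambda>x. frechet_derivative \<psi> (at x) b) \<in> L2 M" "(\<lambda>x. \<psi> x *\<^sub>R b) \<in> L2 M"
      by (auto intro!: continuous_L2 continuous_intros smooth_continuous)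
    from L2_inner_integrable[OF L2_fst[OF that] this(1)] L2_inner_integrable[OF L2_snd[OF that] this(2)]
    have "(LINT x|M. fst (V x) * frechet_derivative \<psi> (at x) b + (snd (V x) \<bullet> b) * \<psi> x) =
        (LINT x|M. fst (V x) * frechet_derivative \<psi> (at x) b) + (LINT x|M. (snd (V x) \<bullet> b) * \<psi> x)"
      by (intro Bochner_Integration.integral_add) (simp_all add: mult.commute)
    then show ?thesis by (simp add: \<xi>_def inner_prod_def mult.commute)
  qed
  obtain \<phi> where \<phi>: "\<And>n. \<phi> n \<in> test_functions \<Omega>" "(\<lambda>n. sqdist M W (\<lambda>x. (\<phi> n x, grad (\<phi> n) x))) \<longlonglongrightarrow> 0"
    using W by (rule H10_graph_approx) blast
  have "(LINT x|M. W x \<bullet> \<xi> x)\<^sup>2 \<le> sqdist M W (\<lambda>x. (\<phi> n x, grad (\<phi> n) x)) * (LINT x|M. (norm (\<xi> x))\<^sup>2)" for n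
  proof -
    note s = test_functions_smooth[OF \<phi>(1)[of n]]
    have "(LINT x|M. (\<phi> n x, grad (\<phi> n) x) \<bullet> \<xi> x) = 0"
      using has_weak_gradient_smooth[OF s dom_sets] \<psi> b
      unfolding has_weak_gradient_def expand[OF test_graph_L2[OF s]] by simp
    then show ?thesis
      using L2_Cauchy_Schwarz_sqdist[OF WL test_graph_L2[OF s] \<xi>] by simp
  qed
  moreover have "(\<lambda>n. sqdist M W (\<lambda>x. (\<phi> n x, grad (\<phi> n) x)) * (LINT x|M. (norm (\<xi> x))\<^sup>2)) \<longlonglongrightarrow> 0"
    by (rule tendsto_mult_left_zero[OF \<phi>(2)])
  ultimately have "(LINT x|M. W x \<bullet> \<xi> x)\<^sup>2 \<le> 0"
    by (intro LIMSEQ_le_const[where a="(LINT x|M. W x \<bullet> \<xi> x)\<^sup>2"]) auto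
  then have "(LINT x|M. W x \<bullet> \<xi> x) = 0" by simp
  then show "(LINT x|M. fst (W x) * frechet_derivative \<psi> (at x) b) = - (LINT x|M. (snd (W x) \<bullet> b) * \<psi> x)"
    using expand[OF WL] by simp
qed

lemma weak_gradient_AE:
  assumes "has_weak_gradient \<Omega> u G"
  shows "AE x in M. weak_gradient \<Omega> u x = G x"
  using weak_gradient_unique_AE[OF open_dom _ assms] someI[of "has_weak_gradient \<Omega> u", OF assms]
  unfolding weak_gradient_def by blast

lemma has_weak_gradient_diff:
  assumes u: "has_weak_gradient \<Omega> u G" and v: "has_weak_gradient \<Omega> v G'"
  shows "has_weak_gradient \<Omega> (\<lambda>x. u x - v x) (\<lambda>x. G x - G' x)"
  unfolding has_weak_gradient_def
proof (intro conjI ballI)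
  have L: "u \<in> L1_loc \<Omega>" "v \<in> L1_loc \<Omega>" "G \<in> L1_loc \<Omega>" "G' \<in> L1_loc \<Omega>"
    using u v by (simp_all add: has_weak_gradient_def)
  then show "(\<lambda>x. u x - v x) \<in> L1_loc \<Omega>" "(\<lambda>x. G x - G' x) \<in> L1_loc \<Omega>"
    by (simp_all add: L1_loc_def)
  fix \<psi> and b :: 'a assume \<psi>: "\<psi> \<in> test_functions \<Omega>" and b: "b \<in> Basis"
  obtain K where K: "compact K" "K \<subseteq> \<Omega>" "\<And>x. x \<notin> K \<Longrightarrow> \<psi> x = 0"
    "\<And>x b. x \<notin> K \<Longrightarrow> frechet_derivative \<psi> (at x) b = 0"
    using \<psi> by (rule test_functionsE) blast
  note s = test_functions_smooth[OF \<psi>]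
  note int = L1_loc_times_test_integrable[OF _ smooth_continuous[OF s] K(1-3) dom_sets]
    and int' = L1_loc_times_test_integrable[OF _ smooth_continuous[OF smooth_partial[OF s b]] K(1,2,4) dom_sets]
  show "(LINT x|M. (u x - v x) * frechet_derivative \<psi> (at x) b) = - (LINT x|M. ((G x - G' x) \<bullet> b) * \<psi> x)"
    using u v \<psi> b int'[OF L(1)] int'[OF L(2)] int[OF L1_loc_inner[OF L(3)]] int[OF L1_loc_inner[OF L(4)]]
    by (simp add: has_weak_gradient_def left_diff_distrib inner_diff_left)
qed

text \<open>The norm of \<open>H\<^sup>1\<close> in the definition of \<^const>\<open>H10\<close> involves the chosen weak gradient of a difference
  \<open>u - \<phi>\<close>; by uniqueness it is the difference of the gradients almost everywhere.\<close>

lemma H10_imp_graph: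
  assumes u: "u \<in> H10 \<Omega>"
  shows "(\<lambda>x. (u x, weak_gradient \<Omega> u x)) \<in> H10_graph \<Omega>"
proof -
  from u obtain G where uL: "u \<in> L2 M" and G: "G \<in> L2 M" "has_weak_gradient \<Omega> u G"
    by (auto simp: H10_def H1_def)
  have eq: "AE x in M. weak_gradient \<Omega> u x = G x" by (rule weak_gradient_AE[OF G(2)])
  then have eq': "AE x in M. G x = weak_gradient \<Omega> u x" by eventually_elim simp
  have wL: "weak_gradient \<Omega> u \<in> L2 M"
    using G(1) AE_cong_measurable[OF L2_measurable[OF G(1)] eq'] eq' by (rule L2_AE_cong)
  have "\<exists>\<phi>\<in>test_functions \<Omega>. sqdist M (\<lambda>x. (u x, weak_gradient \<Omega> u x)) (\<lambda>x. (\<phi> x, grad \<phi> x)) < \<epsilon>"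
    if \<epsilon>: "\<epsilon> > 0" for \<epsilon>
  proof -
    have "\<forall>\<epsilon>>0. \<exists>\<phi>\<in>test_functions \<Omega>. H1_norm \<Omega> (\<lambda>x. u x - \<phi> x) < \<epsilon>"
      using u by (simp add: H10_def)
    from this[rule_format, OF real_sqrt_gt_zero[OF \<epsilon>]]
    obtain \<phi> where \<phi>: "\<phi> \<in> test_functions \<Omega>" "H1_norm \<Omega> (\<lambda>x. u x - \<phi> x) < sqrt \<epsilon>" ..
    note s = test_functions_smooth[OF \<phi>(1)]
    note \<phi>L = test_graph_L2[OF s, THEN L2_fst] test_graph_L2[OF s, THEN L2_snd]
    have "has_weak_gradient \<Omega> (\<lambda>x. u x - \<phi> x) (\<lambda>x. G x - grad \<phi> x)"
      by (rule has_weak_gradient_diff[OF G(2) has_weak_gradient_smooth[OF s dom_sets]])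
    from weak_gradient_AE[OF this] eq
    have d: "AE x in M. weak_gradient \<Omega> (\<lambda>x. u x - \<phi> x) x = weak_gradient \<Omega> u x - grad \<phi> x"
      by eventually_elim simp
    have dL: "(\<lambda>x. weak_gradient \<Omega> u x - grad \<phi> x) \<in> L2 M" using wL \<phi>L by (auto intro: L2_diff)
    have "AE x in M. weak_gradient \<Omega> u x - grad \<phi> x = weak_gradient \<Omega> (\<lambda>x. u x - \<phi> x) x"
      using d by eventually_elim simp
    note dm = AE_cong_measurable[OF L2_measurable[OF dL] this]
    have "sqdist M (\<lambda>x. (u x, weak_gradient \<Omega> u x)) (\<lambda>x. (\<phi> x, grad \<phi> x)) =
        (LINT x|M. (u x - \<phi> x)\<^sup>2) + (LINT x|M. (norm (weak_gradient \<Omega> u x - grad \<phi> x))\<^sup>2)"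
      using L2_integrable[OF L2_diff[OF uL \<phi>L(1)]] L2_integrable[OF dL]
      by (simp add: sqdist_def norm_Pair_squared)
    also have "(LINT x|M. (norm (weak_gradient \<Omega> u x - grad \<phi> x))\<^sup>2) =
        (LINT x|M. (norm (weak_gradient \<Omega> (\<lambda>x. u x - \<phi> x) x))\<^sup>2)"
      by (rule integral_cong_AE) (use d dm L2_measurable[OF dL] in \<open>auto elim: eventually_mono\<close>)
    also have "(LINT x|M. (u x - \<phi> x)\<^sup>2) + \<dots> < \<epsilon>"
      using \<phi>(2) by (simp add: H1_norm_def)
    finally show ?thesis using \<phi>(1) by blast
  qed
  then show ?thesis
    using uL wL by (simp add: H10_graph_def L2_Pair_iff)
qed

lemma H10_graph_imp:
  assumes W: "W \<in> H10_graph \<Omega>"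
  shows "(\<lambda>x. fst (W x)) \<in> H10 \<Omega>" and "AE x in M. weak_gradient \<Omega> (\<lambda>x. fst (W x)) x = snd (W x)"
proof -
  note WL = H10_graph_L2[OF W] and wg = H10_graph_weak_gradient[OF W]
  show "AE x in M. weak_gradient \<Omega> (\<lambda>x. fst (W x)) x = snd (W x)" by (rule weak_gradient_AE[OF wg])
  have "\<exists>\<phi>\<in>test_functions \<Omega>. H1_norm \<Omega> (\<lambda>x. fst (W x) - \<phi> x) < \<epsilon>" if \<epsilon>: "\<epsilon> > 0" for \<epsilon>
  proof -
    have "\<forall>\<epsilon>>0. \<exists>\<phi>\<in>test_functions \<Omega>. sqdist M W (\<lambda>x. (\<phi> x, grad \<phi> x)) < \<epsilon>"
      using W by (simp add: H10_graph_def)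
    from this[rule_format, OF zero_less_power[OF \<epsilon>]]
    obtain \<phi> where \<phi>: "\<phi> \<in> test_functions \<Omega>" "sqdist M W (\<lambda>x. (\<phi> x, grad \<phi> x)) < \<epsilon>\<^sup>2" ..
    note s = test_functions_smooth[OF \<phi>(1)]
    note \<phi>L = test_graph_L2[OF s, THEN L2_fst, simplified] test_graph_L2[OF s, THEN L2_snd, simplified]
    have d: "AE x in M. weak_gradient \<Omega> (\<lambda>x. fst (W x) - \<phi> x) x = snd (W x) - grad \<phi> x"
      by (rule weak_gradient_AE[OF has_weak_gradient_diff[OF wg has_weak_gradient_smooth[OF s dom_sets]]])
    have dL: "(\<lambda>x. snd (W x) - grad \<phi> x) \<in> L2 M" using WL \<phi>L by (auto intro: L2_diff L2_snd)
    have "AE x in M. snd (W x) - grad \<phi> x = weak_gradient \<Omega> (\<lambda>x. fst (W x) - \<phi> x) x"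
      using d by eventually_elim simp
    note dm = AE_cong_measurable[OF L2_measurable[OF dL] this]
    have "sqdist M W (\<lambda>x. (\<phi> x, grad \<phi> x)) =
        (LINT x|M. (norm (fst (W x) - \<phi> x))\<^sup>2) + (LINT x|M. (norm (snd (W x) - grad \<phi> x))\<^sup>2)"
      using L2_integrable[OF L2_diff[OF L2_fst[OF WL] \<phi>L(1)]] L2_integrable[OF dL]
      by (simp add: sqdist_def norm_prod_def)
    also have "(LINT x|M. (norm (snd (W x) - grad \<phi> x))\<^sup>2) =
        (LINT x|M. (norm (weak_gradient \<Omega> (\<lambda>x. fst (W x) - \<phi> x) x))\<^sup>2)"
      by (rule integral_cong_AE) (use d dm L2_measurable[OF dL] in \<open>auto elim: eventually_mono\<close>)
    finally have "(H1_norm \<Omega> (\<lambda>x. fst (W x) - \<phi> x))\<^sup>2 < \<epsilon>\<^sup>2"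
      using \<phi>(2) by (simp add: H1_norm_def)
    then have "H1_norm \<Omega> (\<lambda>x. fst (W x) - \<phi> x) < \<epsilon>"
      by (rule power2_less_imp_less) (use \<epsilon> in simp)
    with \<phi>(1) show ?thesis by blast
  qed
  moreover have "(\<lambda>x. fst (W x)) \<in> H1 \<Omega>"
    unfolding H1_def using L2_fst[OF WL] L2_snd[OF WL] wg by blast
  ultimately show "(\<lambda>x. fst (W x)) \<in> H10 \<Omega>" by (simp add: H10_def)
qed

end

section \<open>Truncation in \<open>H\<^sub>0\<^sup>1\<close>\<close>

lemma L2_dominated_convergence:
  assumes W: "W \<in> L2 M" and T: "T \<in> borel_measurable M" "\<And>n. S n \<in> borel_measurable M"
    and dom: "\<And>n. AE x in M. norm (S n x) \<le> norm (W x)"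
    and lim: "AE x in M. (\<lambda>n. S n x) \<longlonglongrightarrow> T x"
  shows "T \<in> L2 M" and "(\<lambda>n. sqdist M T (S n)) \<longlonglongrightarrow> 0"
proof -
  have dom': "AE x in M. \<forall>n. norm (S n x) \<le> norm (W x)"
    using dom by (simp add: AE_all_countable)
  have domT: "AE x in M. norm (T x) \<le> norm (W x)"
    using lim dom'
  proof eventually_elim
    case (elim x)
    then show ?case by (intro LIMSEQ_le_const2[OF tendsto_norm[OF elim(1)]]) auto
  qed
  show TL: "T \<in> L2 M"
    by (rule L2_bound[OF T(1) L2_integrable[OF W]]) (use domT in eventually_elim, simp add: power_mono)
  have "(\<lambda>n. LINT x|M. (norm (T x - S n x))\<^sup>2) \<longlonglongrightarrow> (LINT x|M. 0)"
  proof (rule integral_dominated_convergence)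
    show "integrable M (\<lambda>x. 4 * (norm (W x))\<^sup>2)" using L2_integrable[OF W] by simp
    show "AE x in M. (\<lambda>n. (norm (T x - S n x))\<^sup>2) \<longlonglongrightarrow> 0"
      using lim
    proof eventually_elim
      case (elim x)
      have "(\<lambda>n. (norm (T x - S n x))\<^sup>2) \<longlonglongrightarrow> (norm (T x - T x))\<^sup>2"
        by (intro tendsto_intros elim)
      then show ?case by simp
    qed
    show "AE x in M. norm ((norm (T x - S n x))\<^sup>2) \<le> 4 * (norm (W x))\<^sup>2" for n
      using dom[of n] domT
    proof eventually_elim
      case (elim x)
      have "norm (T x - S n x) \<le> 2 * norm (W x)"
        using elim norm_triangle_ineq4[of "T x" "S n x"] by linarith
      then have "(norm (T x - S n x))\<^sup>2 \<le> (2 * norm (W x))\<^sup>2" by (rule power_mono) simp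
      then show ?case by (simp add: power_mult_distrib)
    qed
  qed (use T in auto)
  then show "(\<lambda>n. sqdist M T (S n)) \<longlonglongrightarrow> 0" by (simp add: sqdist_def)
qed

lemma norm_Pair_mono: "norm a \<le> norm c \<Longrightarrow> norm b \<le> norm d \<Longrightarrow> norm (a, b) \<le> norm (c, d)"
  by (simp add: norm_prod_def add_mono power_mono)

context bounded_open
begin

text \<open>Let test functions \<open>\<phi>\<^sub>n\<close> approximate \<open>u\<close>, with \<open>\<phi>\<^sub>n \<rightarrow> u\<close> almost everywhere after passing to a subsequence. Then
  \<open>h'(\<phi>\<^sub>n) \<nabla>\<phi>\<^sub>n\<close> differs from \<open>h'(u) \<nabla>u\<close> by \<open>h'(\<phi>\<^sub>n) (\<nabla>\<phi>\<^sub>n - \<nabla>u)\<close>, which is small in \<open>L\<^sup>2\<close>, and by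
  \<open>(h'(\<phi>\<^sub>n) - h'(u)) \<nabla>u\<close>, which tends to \<open>0\<close> by dominated convergence.\<close>

lemma H10_graph_chain_rule:
  assumes W: "W \<in> H10_graph \<Omega>"
    and h: "\<And>t. (h has_real_derivative h' t) (at t)" "\<And>t. \<bar>h' t\<bar> \<le> 1" "h 0 = 0"
    and h': "continuous_on UNIV h'"
    and test: "\<And>\<phi>. \<phi> \<in> test_functions \<Omega> \<Longrightarrow> (\<lambda>x. h (\<phi> x)) \<in> test_functions \<Omega>"
  shows "(\<lambda>x. (h (fst (W x)), h' (fst (W x)) *\<^sub>R snd (W x))) \<in> H10_graph \<Omega>"
proof -
  define T where "T x = (h (fst (W x)), h' (fst (W x)) *\<^sub>R snd (W x))" for x
  note WL = H10_graph_L2[OF W]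
  note uL = L2_fst[OF WL] and GL = L2_snd[OF WL]
  have hc: "continuous_on UNIV h" using h(1) by (meson DERIV_isCont continuous_at_imp_continuous_on)
  have lip: "\<bar>h s - h t\<bar> \<le> \<bar>s - t\<bar>" for s t
  proof -
    have "norm (h s - h t) \<le> 1 * norm (s - t)"
      by (rule field_differentiable_bound[of UNIV h h']) (use h in \<open>auto intro: has_field_derivative_at_within\<close>)
    then show ?thesis by simp
  qed
  have comp: "(\<lambda>x. h (v x)) \<in> borel_measurable N" "(\<lambda>x. h' (v x)) \<in> borel_measurable N"
    if "v \<in> borel_measurable N" for v :: "'a \<Rightarrow> real" and N
    using that hc h' by (auto intro: borel_measurable_continuous_on)
  have TL: "T \<in> L2 M"
  proof (rule L2_bound[OF _ L2_integrable[OF WL]])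
    show "T \<in> borel_measurable M"
      unfolding T_def using uL GL by (intro borel_measurable_Pair borel_measurable_scaleR comp) (auto simp: L2_def)
    have "norm (T x) \<le> norm (W x)" for x
      using lip[of "fst (W x)" 0] h(2)[of "fst (W x)"] h(3)
      norm_Pair_mono[of "h (fst (W x))" "fst (W x)" "h' (fst (W x)) *\<^sub>R snd (W x)" "snd (W x)"]
      by (simp add: T_def mult_left_le_one_le)
    then show "AE x in M. (norm (T x))\<^sup>2 \<le> (norm (W x))\<^sup>2" by (simp add: power_mono)
  qed
  obtain \<phi>0 where \<phi>0: "\<And>n. \<phi>0 n \<in> test_functions \<Omega>" "(\<lambda>n. sqdist M W (\<lambda>x. (\<phi>0 n x, grad (\<phi>0 n) x))) \<longlonglongrightarrow> 0"
    using W by (rule H10_graph_approx) blast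
  have "\<exists>r. strict_mono r \<and> (AE x in M. (\<lambda>n. (norm (W x - (\<phi>0 (r n) x, grad (\<phi>0 (r n)) x)))\<^sup>2) \<longlonglongrightarrow> 0)"
  proof (rule tendsto_L1_AE_subseq)
    show "integrable M (\<lambda>x. (norm (W x - (\<phi>0 n x, grad (\<phi>0 n) x)))\<^sup>2)" for n
      by (intro L2_integrable L2_diff WL test_graph_L2 test_functions_smooth[OF \<phi>0(1)])
    show "(\<lambda>n. LINT x|M. norm ((norm (W x - (\<phi>0 n x, grad (\<phi>0 n) x)))\<^sup>2)) \<longlonglongrightarrow> 0"
      using \<phi>0(2) by (simp add: sqdist_def)
  qed
  then obtain r where r: "strict_mono r"
    "AE x in M. (\<lambda>n. (norm (W x - (\<phi>0 (r n) x, grad (\<phi>0 (r n)) x)))\<^sup>2) \<longlonglongrightarrow> 0" by blast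
  define \<phi> where "\<phi> n = \<phi>0 (r n)" for n
  define P where "P n x = (\<phi> n x, grad (\<phi> n) x)" for n x
  have \<phi>: "\<phi> n \<in> test_functions \<Omega>" for n by (simp add: \<phi>_def \<phi>0(1))
  note s = test_functions_smooth[OF \<phi>]
  have PL: "P n \<in> L2 M" for n unfolding P_def using test_graph_L2[OF s] by simp
  have lim: "(\<lambda>n. sqdist M W (P n)) \<longlonglongrightarrow> 0"
    using LIMSEQ_subseq_LIMSEQ[OF \<phi>0(2) r(1)] by (simp add: comp_def P_def[abs_def] \<phi>_def)
  have AE_lim: "AE x in M. (\<lambda>n. \<phi> n x) \<longlonglongrightarrow> fst (W x)"
    using r(2)
  proof eventually_elim
    case (elim x)
    then have "(\<lambda>n. norm (P n x - W x)) \<longlonglongrightarrow> 0"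
      using tendsto_real_sqrt[OF elim] by (simp add: P_def \<phi>_def norm_minus_commute)
    then have "(\<lambda>n. P n x) \<longlonglongrightarrow> W x"
      by (metis LIM_zero_cancel tendsto_norm_zero_cancel)
    then show ?case using tendsto_fst[of "\<lambda>n. P n x"] by (simp add: P_def)
  qed
  have grad_h: "grad (\<lambda>x. h (\<phi> n x)) x = h' (\<phi> n x) *\<^sub>R grad (\<phi> n) x" for n x
  proof (rule grad_eqI)
    have "(h has_derivative (\<lambda>y. h' (\<phi> n x) * y)) (at (\<phi> n x))"
      using h(1) by (simp add: has_field_derivative_def)
    from has_derivative_compose[OF smooth_has_derivative_grad[OF s] this]
    show "((\<lambda>x. h (\<phi> n x)) has_derivative (\<bullet>) (h' (\<phi> n x) *\<^sub>R grad (\<phi> n) x)) (at x)"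
      by (rule has_derivative_eq_rhs) (simp add: fun_eq_iff)
  qed
  define V where "V n x = (h (\<phi> n x), h' (\<phi> n x) *\<^sub>R grad (\<phi> n) x)" for n x
  have V: "V n \<in> H10_graph \<Omega>" for n
    using H10_graph_test[OF test[OF \<phi>[of n]]] by (simp add: grad_h V_def[abs_def])
  define R where "R n x = (h' (fst (W x)) - h' (\<phi> n x)) *\<^sub>R snd (W x)" for n x
  have RL: "R n \<in> L2 M" for n
  proof (rule L2_bound)
    show "R n \<in> borel_measurable M"
      unfolding R_def using uL GL PL[of n, THEN L2_fst]
      by (intro borel_measurable_scaleR borel_measurable_diff comp) (auto simp: L2_def P_def)
    show "integrable M (\<lambda>x. 4 * (norm (snd (W x)))\<^sup>2)" using L2_integrable[OF GL] by simp
    have "norm (R n x) \<le> 2 * norm (snd (W x))" for x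
      using h(2)[of "fst (W x)"] h(2)[of "\<phi> n x"] unfolding R_def norm_scaleR
      by (intro mult_right_mono) (auto simp: abs_if split: if_splits)
    then have "(norm (R n x))\<^sup>2 \<le> (2 * norm (snd (W x)))\<^sup>2" for x by (intro power_mono) auto
    then show "AE x in M. (norm (R n x))\<^sup>2 \<le> 4 * (norm (snd (W x)))\<^sup>2"
      by (simp add: power_mult_distrib)
  qed
  have Rlim: "(\<lambda>n. sqdist M (\<lambda>x. 0) (R n)) \<longlonglongrightarrow> 0"
  proof (rule L2_dominated_convergence(2)[where W="\<lambda>x. 2 *\<^sub>R snd (W x)"])
    show "(\<lambda>x. 2 *\<^sub>R snd (W x)) \<in> L2 M" by (intro L2_scale GL)
    show "AE x in M. norm (R n x) \<le> norm (2 *\<^sub>R snd (W x))" for n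
    proof (rule AE_I2)
      fix x show "norm (R n x) \<le> norm (2 *\<^sub>R snd (W x))"
        using h(2)[of "fst (W x)"] h(2)[of "\<phi> n x"] unfolding R_def norm_scaleR
        by (intro mult_right_mono) (auto simp: abs_if split: if_splits)
    qed
    show "AE x in M. (\<lambda>n. R n x) \<longlonglongrightarrow> 0"
      using AE_lim
    proof eventually_elim
      case (elim x)
      have "(\<lambda>n. h' (\<phi> n x)) \<longlonglongrightarrow> h' (fst (W x))"
        using h' elim by (auto intro: continuous_on_tendsto_compose)
      then have "(\<lambda>n. (h' (fst (W x)) - h' (\<phi> n x)) *\<^sub>R snd (W x)) \<longlonglongrightarrow> (h' (fst (W x)) - h' (fst (W x))) *\<^sub>R snd (W x)"
        by (intro tendsto_intros)
      then show ?case by (simp add: R_def)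
    qed
  qed (use RL in \<open>auto dest: L2_measurable\<close>)
  have le: "sqdist M T (V n) \<le> 2 * sqdist M W (P n) + 2 * sqdist M (\<lambda>x. 0) (R n)" for n
  proof -
    have "sqdist M T (V n) \<le> (LINT x|M. 2 * (norm (W x - P n x))\<^sup>2 + 2 * (norm (R n x))\<^sup>2)"
      unfolding sqdist_def
    proof (rule integral_mono)
      show "integrable M (\<lambda>x. (norm (T x - V n x))\<^sup>2)"
        by (intro L2_integrable L2_diff TL H10_graph_L2 V)
      show "integrable M (\<lambda>x. 2 * (norm (W x - P n x))\<^sup>2 + 2 * (norm (R n x))\<^sup>2)"
        using L2_integrable[OF L2_diff[OF WL PL[of n]]] L2_integrable[OF RL[of n]] by simp
      show "(norm (T x - V n x))\<^sup>2 \<le> 2 * (norm (W x - P n x))\<^sup>2 + 2 * (norm (R n x))\<^sup>2" for x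
      proof -
        define A where "A = h' (\<phi> n x) *\<^sub>R (snd (W x) - grad (\<phi> n) x)"
        have "norm A \<le> norm (snd (W x) - grad (\<phi> n) x)"
          unfolding A_def using h(2)[of "\<phi> n x"] by (simp add: mult_left_le_one_le)
        then have A: "(norm A)\<^sup>2 \<le> (norm (snd (W x) - grad (\<phi> n) x))\<^sup>2" by (rule power_mono) simp
        have "\<bar>h (fst (W x)) - h (\<phi> n x)\<bar>\<^sup>2 \<le> \<bar>fst (W x) - \<phi> n x\<bar>\<^sup>2" by (rule power_mono[OF lip]) simp
        moreover have "(norm (A + R n x))\<^sup>2 \<le> 2 * (norm A)\<^sup>2 + 2 * (norm (R n x))\<^sup>2" by (rule power2_norm_add_le)
        moreover have "(norm (T x - V n x))\<^sup>2 = \<bar>h (fst (W x)) - h (\<phi> n x)\<bar>\<^sup>2 + (norm (A + R n x))\<^sup>2"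
        proof -
          have "T x - V n x = (h (fst (W x)) - h (\<phi> n x), A + R n x)"
            by (simp add: T_def V_def A_def R_def algebra_simps)
          then show ?thesis by (simp add: norm_Pair_squared)
        qed
        moreover have "(norm (W x - P n x))\<^sup>2 = \<bar>fst (W x) - \<phi> n x\<bar>\<^sup>2 + (norm (snd (W x) - grad (\<phi> n) x))\<^sup>2"
        proof -
          have "W x - P n x = (fst (W x) - \<phi> n x, snd (W x) - grad (\<phi> n) x)"
            by (simp add: P_def prod_eq_iff)
          then show ?thesis by (simp add: norm_Pair_squared)
        qed
        ultimately show ?thesis
          using A zero_le_power2[of "\<bar>fst (W x) - \<phi> n x\<bar>"] by linarith
      qed
    qed
    also have "\<dots> = 2 * sqdist M W (P n) + 2 * sqdist M (\<lambda>x. 0) (R n)"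
      unfolding sqdist_def using L2_integrable[OF L2_diff[OF WL PL[of n]]] L2_integrable[OF RL[of n]] by simp
    finally show ?thesis .
  qed
  have "(\<lambda>n. 2 * sqdist M W (P n) + 2 * sqdist M (\<lambda>x. 0) (R n)) \<longlonglongrightarrow> 2 * 0 + 2 * 0"
    by (intro tendsto_intros lim Rlim)
  then have lim0: "(\<lambda>n. 2 * sqdist M W (P n) + 2 * sqdist M (\<lambda>x. 0) (R n)) \<longlonglongrightarrow> 0" by simp
  have "(\<lambda>n. sqdist M T (V n)) \<longlonglongrightarrow> 0"
    by (rule tendsto_sandwich[OF _ _ tendsto_const lim0]) (auto intro: always_eventually le sqdist_nonneg)
  from H10_graph_limit[OF TL V this] show ?thesis by (simp add: T_def[abs_def])
qed

lemma flat_one_mult_nat_tendsto: "(\<lambda>n. flat 1 (real n * t)) \<longlonglongrightarrow> 0"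
proof (cases "0 < t")
  case True
  have lim: "(\<lambda>n. inverse (real n * t)) \<longlonglongrightarrow> 0"
    using tendsto_mult_left[OF lim_inverse_n, of "inverse t"] by (simp add: mult.commute)
  have "flat 1 (real n * t) \<le> inverse (real n * t)" for n
    using True by (auto simp: flat_def intro!: mult_left_le_one_le)
  then show ?thesis
    by (intro tendsto_sandwich[OF _ _ tendsto_const lim]) (auto intro: always_eventually flat_nonneg)
next
  case False
  then show ?thesis by (simp add: flat_eq_0 mult_nonneg_nonpos)
qed

text \<open>The functions \<open>h\<^sub>n(t) = (t - c) exp (- 1 / (n (t - c)))\<close>, continued by zero to \<open>t \<le> c\<close>, are smooth, have
  derivative in \<open>[0, 1]\<close> and tend to the positive part of \<open>t - c\<close>. As they vanish for \<open>t \<le> 0\<close>, they map test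
  functions to test functions.\<close>

lemma H10_graph_truncate:
  assumes W: "W \<in> H10_graph \<Omega>" and c: "0 \<le> c"
  shows "(\<lambda>x. (max (fst (W x) - c) 0, if c < fst (W x) then snd (W x) else 0)) \<in> H10_graph \<Omega>"
proof -
  define h h' where "h n t = (t - c) * flat 0 (real n * (t - c))"
    and "h' n t = flat 0 (real n * (t - c)) + flat 1 (real n * (t - c))" for n t
  have deriv: "(h n has_real_derivative h' n t) (at t)" for n t
  proof -
    let ?y = "real n * (t - c)"
    have y: "((\<lambda>t. real n * (t - c)) has_real_derivative real n) (at t)"
      by (auto intro!: derivative_eq_intros)
    have "((\<lambda>t. (t - c) * flat 0 (real n * (t - c))) has_real_derivative
        1 * flat 0 ?y + (flat (0 + 2) ?y - real 0 * flat (0 + 1) ?y) * real n * (t - c)) (at t)"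
      by (intro DERIV_mult DERIV_chain2[OF flat_has_derivative y]) (auto intro!: derivative_eq_intros)
    moreover have "y * flat 2 y = flat 1 y" for y by (simp add: flat_def power2_eq_square)
    then have "?y * flat 2 ?y = flat 1 ?y" .
    ultimately show ?thesis
      unfolding h_def h'_def by (simp add: mult_ac numeral_2_eq_2)
  qed
  have flat01: "flat 0 y + flat 1 y \<le> 1" for y
  proof (cases "0 < y")
    case True
    then have "flat 0 y + flat 1 y = exp (- inverse y) * (1 + inverse y)"
      by (simp add: flat_def algebra_simps)
    also have "\<dots> \<le> exp (- inverse y) * exp (inverse y)"
      by (intro mult_left_mono exp_ge_add_one_self) simp
    finally show ?thesis by (simp flip: exp_add)
  qed (simp add: flat_eq_0)
  have bound: "\<bar>h' n t\<bar> \<le> 1" "0 \<le> h' n t" for n t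
    using flat01[of "real n * (t - c)"] by (simp_all add: h'_def flat_nonneg add_nonneg_nonneg)
  have h0: "h n t = 0" if "t \<le> c" for n t
    using that by (simp add: h_def flat_eq_0 mult_nonneg_nonpos)
  have cont: "continuous_on UNIV (h' n)" for n
    unfolding h'_def by (intro continuous_intros continuous_on_compose2[OF flat_continuous[of UNIV]]) auto
  have test: "(\<lambda>x. h n (\<phi> x)) \<in> test_functions \<Omega>" if \<phi>: "\<phi> \<in> test_functions \<Omega>" for n \<phi>
  proof -
    obtain K where K: "compact K" "K \<subseteq> \<Omega>" "\<And>x. x \<notin> K \<Longrightarrow> \<phi> x = 0" using \<phi> by (rule test_functionsE) blast
    show ?thesis
    proof (rule test_functionsI[OF _ K(1,2)])
      show "smooth (\<lambda>x. h n (\<phi> x))"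
        unfolding h_def
        by (intro smooth_mult smooth_flat smooth_diff smooth_const test_functions_smooth[OF \<phi>])
    qed (use K c in \<open>auto intro: h0\<close>)
  qed
  define T where "T x = (max (fst (W x) - c) 0, if c < fst (W x) then snd (W x) else 0)" for x
  define S where "S n x = (h n (fst (W x)), h' n (fst (W x)) *\<^sub>R snd (W x))" for n x
  have S: "S n \<in> H10_graph \<Omega>" for n
    unfolding S_def using H10_graph_chain_rule[OF W deriv bound(1) h0[OF c] cont test] by simp
  note WL = H10_graph_L2[OF W]
  have lim: "(\<lambda>n. S n x) \<longlonglongrightarrow> T x" for x
  proof -
    let ?t = "fst (W x) - c"
    have "(\<lambda>n. S n x) \<longlonglongrightarrow> (?t * (if 0 < ?t then 1 else 0), ((if 0 < ?t then 1 else 0) + 0) *\<^sub>R snd (W x))"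
      unfolding S_def h_def h'_def
      by (intro tendsto_intros flat_mult_nat_tendsto flat_one_mult_nat_tendsto)
    moreover have "(?t * (if 0 < ?t then 1 else 0), ((if 0 < ?t then 1 else 0) + 0) *\<^sub>R snd (W x)) = T x"
      by (auto simp: T_def)
    ultimately show ?thesis by simp
  qed
  have dom: "norm (S n x) \<le> norm (W x)" for n x
  proof -
    have "\<bar>h n (fst (W x))\<bar> \<le> \<bar>fst (W x)\<bar>"
    proof (cases "fst (W x) \<le> c")
      case False
      then have "\<bar>h n (fst (W x))\<bar> \<le> \<bar>fst (W x) - c\<bar>"
        unfolding h_def abs_mult using flat_nonneg flat_zero_le_1 by (intro mult_left_le) auto
      with False c show ?thesis by simp
    qed (simp add: h0)
    then show ?thesis
      using bound[of n "fst (W x)"] norm_Pair_mono[of "h n (fst (W x))" "fst (W x)" "h' n (fst (W x)) *\<^sub>R snd (W x)" "snd (W x)"]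
      by (simp add: S_def mult_left_le_one_le)
  qed
  have Sm: "S n \<in> borel_measurable M" for n by (rule L2_measurable[OF H10_graph_L2[OF S]])
  have Tm: "T \<in> borel_measurable M"
    by (rule borel_measurable_LIMSEQ_metric[OF Sm lim])
  note dc = L2_dominated_convergence[OF WL Tm Sm AE_I2[OF dom] AE_I2[OF lim]]
  from H10_graph_limit[OF dc(1) S dc(2)] show ?thesis by (simp add: T_def[abs_def])
qed

end

section \<open>The Dirichlet form, the resolvent and the maximum principle\<close>

context bounded_open
begin

definition dirichlet :: "('a \<Rightarrow> real \<times> 'a) \<Rightarrow> ('a \<Rightarrow> real \<times> 'a) \<Rightarrow> real" where
  "dirichlet W Z = (LINT x|M. snd (W x) \<bullet> snd (Z x))"

text \<open>The equation \<open>- \<Delta>w = h\<close> with zero boundary values, where \<open>w\<close> is the first component of \<open>W\<close>.\<close>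

definition weakly_eq :: "('a \<Rightarrow> real \<times> 'a) \<Rightarrow> ('a \<Rightarrow> real) \<Rightarrow> bool" where
  "weakly_eq W h \<longleftrightarrow> W \<in> H10_graph \<Omega> \<and> (\<forall>Z\<in>H10_graph \<Omega>. dirichlet W Z = (LINT x|M. h x * fst (Z x)))"

text \<open>The inequality \<open>- \<Delta>w \<le> h\<close> in the weak sense.\<close>

definition weakly_le :: "('a \<Rightarrow> real \<times> 'a) \<Rightarrow> ('a \<Rightarrow> real) \<Rightarrow> bool" where
  "weakly_le W h \<longleftrightarrow> W \<in> H10_graph \<Omega> \<and>
     (\<forall>Z\<in>H10_graph \<Omega>. (AE x in M. 0 \<le> fst (Z x)) \<longrightarrow> dirichlet W Z \<le> (LINT x|M. h x * fst (Z x)))"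

lemma weakly_eq_imp_le: "weakly_eq W h \<Longrightarrow> weakly_le W h"
  by (simp add: weakly_eq_def weakly_le_def)

lemma dirichlet_diff:
  assumes "W \<in> L2 M" "V \<in> L2 M" "Z \<in> L2 M"
  shows "dirichlet (\<lambda>x. W x - V x) Z = dirichlet W Z - dirichlet V Z"
  unfolding dirichlet_def
  using L2_inner_integrable[OF L2_snd[OF assms(1)] L2_snd[OF assms(3)]]
    L2_inner_integrable[OF L2_snd[OF assms(2)] L2_snd[OF assms(3)]]
  by (simp add: inner_diff_left)

lemma dirichlet_self_nonneg: "0 \<le> dirichlet W W"
  by (simp add: dirichlet_def)

lemma L2_mult_integrable: "h \<in> L2 M \<Longrightarrow> u \<in> L2 M \<Longrightarrow> integrable M (\<lambda>x. h x * u x :: real)"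
  using L2_inner_integrable[of h M u] by simp

lemma integral_mult_cong_AE:
  assumes "h \<in> L2 M" "h' \<in> L2 M" "AE x in M. h x = h' x" "u \<in> L2 M"
  shows "(LINT x|M. h x * u x) = (LINT x|M. h' x * u x :: real)"
proof (rule integral_cong_AE)
  show "(\<lambda>x. h x * u x) \<in> borel_measurable M" "(\<lambda>x. h' x * u x) \<in> borel_measurable M"
    using assms by (auto intro!: borel_measurable_times simp: L2_def)
qed (use assms(3) in \<open>auto elim: eventually_mono\<close>)

lemma weakly_eq_cong:
  assumes "weakly_eq W h" "h \<in> L2 M" "h' \<in> L2 M" "AE x in M. h x = h' x"
  shows "weakly_eq W h'"
  using assms(1) integral_mult_cong_AE[OF assms(2-4)] unfolding weakly_eq_def
  by (auto intro: L2_fst H10_graph_L2)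

lemma weakly_le_mono:
  assumes "weakly_le W h" "h \<in> L2 M" "h' \<in> L2 M" "AE x in M. h x \<le> h' x"
  shows "weakly_le W h'"
  unfolding weakly_le_def
proof (intro conjI ballI impI)
  show "W \<in> H10_graph \<Omega>" using assms(1) by (simp add: weakly_le_def)
  fix Z assume Z: "Z \<in> H10_graph \<Omega>" "AE x in M. 0 \<le> fst (Z x)"
  note zL = L2_fst[OF H10_graph_L2[OF Z(1)]]
  have "dirichlet W Z \<le> (LINT x|M. h x * fst (Z x))" using assms(1) Z by (simp add: weakly_le_def)
  also have "\<dots> \<le> (LINT x|M. h' x * fst (Z x))"
  proof (rule integral_mono_AE)
    show "AE x in M. h x * fst (Z x) \<le> h' x * fst (Z x)"
      using assms(4) Z(2) by eventually_elim (rule mult_right_mono)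
  qed (use assms zL in \<open>auto intro: L2_mult_integrable\<close>)
  finally show "dirichlet W Z \<le> (LINT x|M. h' x * fst (Z x))" .
qed

lemma weakly_le_diff:
  assumes "weakly_le V h'" "weakly_eq U h" "h' \<in> L2 M" "h \<in> L2 M"
  shows "weakly_le (\<lambda>x. V x - U x) (\<lambda>x. h' x - h x)"
  unfolding weakly_le_def
proof (intro conjI ballI impI)
  have VU: "V \<in> H10_graph \<Omega>" "U \<in> H10_graph \<Omega>" using assms by (auto simp: weakly_le_def weakly_eq_def)
  then show "(\<lambda>x. V x - U x) \<in> H10_graph \<Omega>" by (rule H10_graph_diff)
  fix Z assume Z: "Z \<in> H10_graph \<Omega>" "AE x in M. 0 \<le> fst (Z x)"
  note zL = L2_fst[OF H10_graph_L2[OF Z(1)]]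
  have "dirichlet (\<lambda>x. V x - U x) Z = dirichlet V Z - dirichlet U Z"
    using VU Z(1) by (intro dirichlet_diff H10_graph_L2)
  also have "\<dots> \<le> (LINT x|M. h' x * fst (Z x)) - (LINT x|M. h x * fst (Z x))"
    using assms(1,2) Z by (simp add: weakly_le_def weakly_eq_def)
  also have "\<dots> = (LINT x|M. (h' x - h x) * fst (Z x))"
    using L2_mult_integrable[OF assms(3) zL] L2_mult_integrable[OF assms(4) zL] by (simp add: left_diff_distrib)
  finally show "dirichlet (\<lambda>x. V x - U x) Z \<le> (LINT x|M. (h' x - h x) * fst (Z x))" .
qed

text \<open>Test with \<open>(v - c)\<^sup>+\<close>: the Dirichlet form is then the integral of \<open>\<bar>\<nabla>v\<bar>\<^sup>2\<close> over \<open>{v > c}\<close>, so the right hand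
  side is nonnegative, while it is at most \<open>- k\<close> times the integral of \<open>((v - c)\<^sup>+)\<^sup>2\<close>.\<close>

lemma weak_maximum_principle:
  assumes V: "weakly_le V h" and h: "h \<in> L2 M" and c: "0 \<le> c" and k: "0 < k"
    and neg: "AE x in M. c < fst (V x) \<longrightarrow> h x \<le> - k * (fst (V x) - c)"
  shows "AE x in M. fst (V x) \<le> c"
proof -
  define Z where "Z x = (max (fst (V x) - c) 0, if c < fst (V x) then snd (V x) else 0)" for x
  have VG: "V \<in> H10_graph \<Omega>" using V by (simp add: weakly_le_def)
  have Z: "Z \<in> H10_graph \<Omega>" unfolding Z_def by (rule H10_graph_truncate[OF VG c])
  note zL = L2_fst[OF H10_graph_L2[OF Z]]
  have "0 \<le> dirichlet V Z"
    unfolding dirichlet_def by (rule Bochner_Integration.integral_nonneg) (simp add: Z_def)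
  also have "\<dots> \<le> (LINT x|M. h x * fst (Z x))"
  proof -
    have "AE x in M. 0 \<le> fst (Z x)" by (simp add: Z_def)
    with V Z show ?thesis by (simp add: weakly_le_def)
  qed
  also have "\<dots> \<le> (LINT x|M. - k * (fst (Z x))\<^sup>2)"
  proof (rule integral_mono_AE)
    show "integrable M (\<lambda>x. - k * (fst (Z x))\<^sup>2)" using L2_integrable[OF zL] by simp
    show "AE x in M. h x * fst (Z x) \<le> - k * (fst (Z x))\<^sup>2"
      using neg
    proof eventually_elim
      case (elim x)
      show ?case
      proof (cases "c < fst (V x)")
        case True
        then have "h x * (fst (V x) - c) \<le> - k * (fst (V x) - c) * (fst (V x) - c)"
          using elim by (intro mult_right_mono) auto
        with True show ?thesis by (simp add: Z_def power2_eq_square)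
      qed (simp add: Z_def)
    qed
  qed (use h zL in \<open>auto intro: L2_mult_integrable\<close>)
  finally have "k * (LINT x|M. (fst (Z x))\<^sup>2) \<le> 0" by simp
  then have "(LINT x|M. (fst (Z x))\<^sup>2) \<le> 0" using k by (simp add: mult_le_0_iff)
  moreover have "0 \<le> (LINT x|M. (fst (Z x))\<^sup>2)" by simp
  ultimately have "(LINT x|M. (fst (Z x))\<^sup>2) = 0" by linarith
  then have "AE x in M. (fst (Z x))\<^sup>2 = 0"
    using L2_integrable[OF zL] by (subst (asm) integral_nonneg_eq_0_iff_AE) auto
  then show ?thesis by eventually_elim (simp add: Z_def max_def split: if_splits)
qed

text \<open>After the first component is multiplied by \<open>sqrt k\<close>, the form \<open>\<integral> \<nabla>w \<bullet> \<nabla>z + k w z\<close> is the inner product of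
  \<open>L\<^sup>2\<close>, and the solution is the orthogonal projection of \<open>(h / sqrt k, 0)\<close>.\<close>

lemma resolvent_exists:
  assumes k: "0 < k" and h: "h \<in> L2 M"
  obtains W where "weakly_eq W (\<lambda>x. h x - k * fst (W x))"
proof -
  define S where "S W x = (sqrt k * fst (W x), snd (W x))" for W :: "'a \<Rightarrow> real \<times> 'a" and x
  define H where "H x = (h x / sqrt k, 0::'a)" for x
  have SL: "S W \<in> L2 M" if "W \<in> L2 M" for W
    unfolding S_def using L2_scale[OF L2_fst[OF that], of "sqrt k"] L2_snd[OF that] by (simp add: L2_Pair_iff)
  obtain V where V: "V \<in> S ` H10_graph \<Omega>"
    "\<And>Z. Z \<in> S ` H10_graph \<Omega> \<Longrightarrow> (LINT x|M. V x \<bullet> Z x) = (LINT x|M. H x \<bullet> Z x)"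
  proof (rule L2_projection)
    show "finite_measure M" by (rule finite_measure_dom)
    show "S ` H10_graph \<Omega> \<subseteq> L2 M" using SL H10_graph_L2 by auto
    show "S ` H10_graph \<Omega> \<noteq> {}" using H10_graph_nonempty by simp
    show "H \<in> L2 M"
      unfolding H_def using L2_scale[OF h, of "1 / sqrt k"]
      unfolding L2_Pair_iff by (simp add: L2_def)
    fix U V a b assume "U \<in> S ` H10_graph \<Omega>" "V \<in> S ` H10_graph \<Omega>"
    then obtain U' V' where U': "U' \<in> H10_graph \<Omega>" "U = S U'" and V': "V' \<in> H10_graph \<Omega>" "V = S V'" by auto
    have "(\<lambda>x. a *\<^sub>R U x + b *\<^sub>R V x) = S (\<lambda>x. a *\<^sub>R U' x + b *\<^sub>R V' x)"
      by (auto simp: S_def U' V' fun_eq_iff algebra_simps)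
    then show "(\<lambda>x. a *\<^sub>R U x + b *\<^sub>R V x) \<in> S ` H10_graph \<Omega>"
      using H10_graph_lincomb[OF U'(1) V'(1)] by auto
  next
    fix W :: "'a \<Rightarrow> real \<times> 'a"
    assume W: "W \<in> L2 M" and approx: "\<And>\<epsilon>. \<epsilon> > 0 \<Longrightarrow> \<exists>V\<in>S ` H10_graph \<Omega>. sqdist M W V < \<epsilon>"
    define W' where "W' x = (fst (W x) / sqrt k, snd (W x))" for x
    have W'L: "W' \<in> L2 M"
      unfolding W'_def using L2_scale[OF L2_fst[OF W], of "1 / sqrt k"] L2_snd[OF W] by (simp add: L2_Pair_iff)
    have "W' \<in> H10_graph \<Omega>"
    proof (rule H10_graph_closed[OF W'L])
      fix \<epsilon> :: real assume \<epsilon>: "\<epsilon> > 0"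
      define C where "C = 1 + 1 / k"
      have C: "C > 0" using k by (simp add: C_def add_pos_pos)
      obtain V where V: "V \<in> H10_graph \<Omega>" "sqdist M W (S V) < \<epsilon> / C"
        using approx[of "\<epsilon> / C"] \<epsilon> C by auto
      note d = L2_integrable[OF L2_diff[OF W SL[OF H10_graph_L2[OF V(1)]]]]
      have "sqdist M W' V \<le> (LINT x|M. C * (norm (W x - S V x))\<^sup>2)"
        unfolding sqdist_def
      proof (rule integral_mono)
        show "integrable M (\<lambda>x. (norm (W' x - V x))\<^sup>2)"
          by (intro L2_integrable L2_diff W'L H10_graph_L2 V)
        show "(norm (W' x - V x))\<^sup>2 \<le> C * (norm (W x - S V x))\<^sup>2" for x
        proof -
          let ?d = "fst (W x) - sqrt k * fst (V x)" and ?g = "(norm (snd (W x) - snd (V x)))\<^sup>2"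
          have "fst (W' x - V x) = ?d / sqrt k" using k by (simp add: W'_def field_simps)
          then have "(norm (W' x - V x))\<^sup>2 = ?d\<^sup>2 / k + ?g"
            using k by (simp add: norm_prod_def W'_def power_divide)
          also have "\<dots> \<le> (1 + 1 / k) * (?d\<^sup>2 + ?g)"
            using k by (simp add: algebra_simps)
          also have "?d\<^sup>2 + ?g = (norm (W x - S V x))\<^sup>2"
            by (simp add: norm_prod_def S_def)
          finally show ?thesis by (simp add: C_def)
        qed
      qed (use d in simp)
      also have "\<dots> = C * sqdist M W (S V)" by (simp add: sqdist_def)
      also have "\<dots> < \<epsilon>" using V(2) C by (simp add: field_simps)
      finally show "\<exists>V\<in>H10_graph \<Omega>. sqdist M W' V < \<epsilon>" using V(1) by blast
    qed
    moreover have "W = S W'" using k by (auto simp: S_def W'_def fun_eq_iff)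
    ultimately show "W \<in> S ` H10_graph \<Omega>" by blast
  qed blast
  then obtain W where W: "W \<in> H10_graph \<Omega>" "V = S W" by auto
  have "dirichlet W Z = (LINT x|M. (h x - k * fst (W x)) * fst (Z x))" if Z: "Z \<in> H10_graph \<Omega>" for Z
  proof -
    note WL = H10_graph_L2[OF W(1)] and ZL = H10_graph_L2[OF Z]
    note i1 = L2_inner_integrable[OF L2_snd[OF WL] L2_snd[OF ZL]]
      and i2 = L2_mult_integrable[OF L2_fst[OF WL] L2_fst[OF ZL]]
      and i3 = L2_mult_integrable[OF h L2_fst[OF ZL]]
    have "(LINT x|M. S W x \<bullet> S Z x) = (LINT x|M. k * (fst (W x) * fst (Z x)) + snd (W x) \<bullet> snd (Z x))"
      using k by (intro Bochner_Integration.integral_cong) (auto simp: S_def mult_ac)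
    also have "\<dots> = k * (LINT x|M. fst (W x) * fst (Z x)) + dirichlet W Z"
      using i1 i2 by (simp add: dirichlet_def)
    finally have l: "(LINT x|M. S W x \<bullet> S Z x) = k * (LINT x|M. fst (W x) * fst (Z x)) + dirichlet W Z" .
    have r: "(LINT x|M. H x \<bullet> S Z x) = (LINT x|M. h x * fst (Z x))"
      using k by (intro Bochner_Integration.integral_cong) (auto simp: S_def H_def)
    have "(LINT x|M. (h x - k * fst (W x)) * fst (Z x)) = (LINT x|M. h x * fst (Z x) - k * (fst (W x) * fst (Z x)))"
      by (simp add: algebra_simps)
    also have "\<dots> = (LINT x|M. h x * fst (Z x)) - k * (LINT x|M. fst (W x) * fst (Z x))"
      using i2 i3 by simp
    finally show ?thesis using V(2)[of "S Z"] l r Z W by simp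
  qed
  then have "weakly_eq W (\<lambda>x. h x - k * fst (W x))" using W(1) by (simp add: weakly_eq_def)
  then show ?thesis by (rule that)
qed

text \<open>The maximum principle for the difference, at level \<open>0\<close>.\<close>

lemma comparison_principle:
  assumes V: "weakly_le V (\<lambda>x. h' x - k * fst (V x))" and U: "weakly_eq U (\<lambda>x. h x - k * fst (U x))"
    and k: "0 < k" and L: "h' \<in> L2 M" "h \<in> L2 M" and le: "AE x in M. h' x \<le> h x"
  shows "AE x in M. fst (V x) \<le> fst (U x)"
proof -
  have G: "V \<in> H10_graph \<Omega>" "U \<in> H10_graph \<Omega>" using V U by (auto simp: weakly_le_def weakly_eq_def)
  have vL: "(\<lambda>x. k * fst (V x)) \<in> L2 M" "(\<lambda>x. k * fst (U x)) \<in> L2 M"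
    using L2_scale[OF L2_fst[OF H10_graph_L2[OF G(1)]], of k] L2_scale[OF L2_fst[OF H10_graph_L2[OF G(2)]], of k]
    by simp_all
  have "AE x in M. fst (V x - U x) \<le> 0"
  proof (rule weak_maximum_principle[OF weakly_le_diff[OF V U]])
    show "AE x in M. 0 < fst (V x - U x) \<longrightarrow>
        h' x - k * fst (V x) - (h x - k * fst (U x)) \<le> - k * (fst (V x - U x) - 0)"
      using le by eventually_elim (simp add: algebra_simps)
  qed (use k L vL in \<open>auto intro: L2_diff\<close>)
  then show ?thesis by simp
qed

end

section \<open>Bumps on balls\<close>

definition laplacian :: "('a::euclidean_space \<Rightarrow> real) \<Rightarrow> 'a \<Rightarrow> real" where
  "laplacian \<phi> x = (\<Sum>b\<in>Basis. frechet_derivative (\<lambda>y. frechet_derivative \<phi> (at y) b) (at x) b)"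

lemma smooth_laplacian: "smooth \<phi> \<Longrightarrow> smooth (laplacian \<phi>)"
  unfolding laplacian_def by (intro smooth_sum smooth_partial)

lemma test_functions_partial:
  assumes \<phi>: "\<phi> \<in> test_functions \<Omega>" and b: "b \<in> Basis"
  shows "(\<lambda>x. frechet_derivative \<phi> (at x) b) \<in> test_functions \<Omega>"
proof -
  obtain K where K: "compact K" "K \<subseteq> \<Omega>" "\<And>x b. x \<notin> K \<Longrightarrow> frechet_derivative \<phi> (at x) b = 0"
    using \<phi> by (rule test_functionsE) blast
  show ?thesis
    by (rule test_functionsI[OF smooth_partial[OF test_functions_smooth[OF \<phi>] b] K(1,2)]) (simp add: K(3))
qed

lemma laplacian_flat_ball:
  fixes c :: "'a::euclidean_space" and R :: real
  defines "s \<equiv> \<lambda>x. R\<^sup>2 - (norm (x - c))\<^sup>2"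
  shows "laplacian (\<lambda>x. flat 0 (s x)) x =
    4 * (norm (x - c))\<^sup>2 * (flat 4 (s x) - 2 * flat 3 (s x)) - 2 * DIM('a) * flat 2 (s x)"
proof -
  have s: "(s has_derivative (\<lambda>h. - 2 * ((x - c) \<bullet> h))) (at x)" for x
    unfolding s_def power2_norm_eq_inner
    by (auto intro!: derivative_eq_intros simp: algebra_simps inner_commute)
  have d1: "frechet_derivative (\<lambda>x. flat 0 (s x)) (at x) = (\<lambda>h. flat 2 (s x) * (- 2 * ((x - c) \<bullet> h)))" for x
    using flat_comp_has_derivative[OF s, of 0] by (intro frechet_derivative_eqI) (simp add: numeral_2_eq_2)
  have d2: "frechet_derivative (\<lambda>x. flat 2 (s x) * (- 2 * ((x - c) \<bullet> b))) (at x) b =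
      flat 2 (s x) * (- 2 * (b \<bullet> b)) + (flat 4 (s x) - 2 * flat 3 (s x)) * (- 2 * ((x - c) \<bullet> b)) * (- 2 * ((x - c) \<bullet> b))" for b x
  proof -
    have "((\<lambda>x. flat 2 (s x)) has_derivative (\<lambda>h. (flat 4 (s x) - 2 * flat 3 (s x)) * (- 2 * ((x - c) \<bullet> h)))) (at x)"
      using flat_comp_has_derivative[OF s, of 2 x] by (simp add: eval_nat_numeral)
    moreover have "((\<lambda>x. - 2 * ((x - c) \<bullet> b)) has_derivative (\<lambda>h. - 2 * (h \<bullet> b))) (at x)"
      by (auto intro!: derivative_eq_intros)
    ultimately have "((\<lambda>x. flat 2 (s x) * (- 2 * ((x - c) \<bullet> b))) has_derivative
       (\<lambda>h. flat 2 (s x) * (- 2 * (h \<bullet> b)) + (flat 4 (s x) - 2 * flat 3 (s x)) * (- 2 * ((x - c) \<bullet> h)) * (- 2 * ((x - c) \<bullet> b)))) (at x)"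
      by (rule has_derivative_mult)
    then show ?thesis by (simp add: frechet_derivative_eqI)
  qed
  have "laplacian (\<lambda>x. flat 0 (s x)) x = (\<Sum>b\<in>Basis. - 2 * flat 2 (s x) +
      4 * (flat 4 (s x) - 2 * flat 3 (s x)) * (((x - c) \<bullet> b) * ((x - c) \<bullet> b)))"
    unfolding laplacian_def d1 by (intro sum.cong refl) (subst d2, simp add: algebra_simps)
  also have "\<dots> = - 2 * flat 2 (s x) * DIM('a) +
      4 * (flat 4 (s x) - 2 * flat 3 (s x)) * (\<Sum>b\<in>Basis. ((x - c) \<bullet> b) * ((x - c) \<bullet> b))"
    by (simp add: sum.distrib sum_distrib_left sum_subtractf)
  also have "(\<Sum>b\<in>Basis. ((x - c) \<bullet> b) * ((x - c) \<bullet> b)) = (norm (x - c))\<^sup>2"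
    unfolding power2_norm_eq_inner by (subst euclidean_inner) simp
  finally show ?thesis by (simp add: algebra_simps)
qed

lemma cubic_quadratic_bounded_by_quartic:
  fixes A B D y :: real
  assumes "0 < A" "0 \<le> B" "0 \<le> D" "0 \<le> y"
  defines "Y \<equiv> (B + D) / A + 1"
  shows "B * y ^ 3 + D * y\<^sup>2 - A * y ^ 4 \<le> B * Y ^ 3 + D * Y\<^sup>2"
proof (cases "y \<le> Y")
  case True
  have "B * y ^ 3 + D * y\<^sup>2 \<le> B * Y ^ 3 + D * Y\<^sup>2"
    using assms True by (intro add_mono mult_left_mono power_mono) auto
  moreover have "0 \<le> A * y ^ 4" using assms by simp
  ultimately show ?thesis by linarith
next
  case False
  have "0 \<le> (B + D) / A" using assms by simp
  then have y: "1 \<le> y" "(B + D) / A \<le> y" "0 \<le> Y" using False by (auto simp: Y_def)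
  have "D * y\<^sup>2 \<le> D * y ^ 3" using y assms by (intro mult_left_mono power_increasing) auto
  then have "B * y ^ 3 + D * y\<^sup>2 \<le> (B + D) * y ^ 3" by (simp add: algebra_simps)
  also have "\<dots> \<le> (A * y) * y ^ 3"
    using y assms by (intro mult_right_mono) (auto simp: field_simps)
  also have "\<dots> = A * y ^ 4" by (simp add: power_numeral_reduce)
  finally have "B * y ^ 3 + D * y\<^sup>2 - A * y ^ 4 \<le> 0" by simp
  also have "0 \<le> B * Y ^ 3 + D * Y\<^sup>2" using assms(2,3) y by simp
  finally show ?thesis .
qed

text \<open>In terms of \<open>y = 1 / (R\<^sup>2 - \<bar>x - c\<bar>\<^sup>2)\<close> the quotient of \<open>- \<Delta>\<phi>\<close> and \<open>\<phi>\<close> is a polynomial with leading term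
  \<open>- 4 R\<^sup>2 y\<^sup>4\<close>. So it tends to \<open>- \<infinity>\<close> at the boundary of the ball and is bounded above.\<close>

lemma flat_ball_laplacian_bound:
  fixes c :: "'a::euclidean_space"
  assumes R: "R > 0"
  obtains C where "C > 0"
    "\<And>x. - laplacian (\<lambda>x. flat 0 (R\<^sup>2 - (norm (x - c))\<^sup>2)) x \<le> C * flat 0 (R\<^sup>2 - (norm (x - c))\<^sup>2)"
proof -
  define A B D where "A = 4 * R\<^sup>2" and "B = 8 * R\<^sup>2 + 4" and "D = 2 * real DIM('a)"
  define Y where "Y = (B + D) / A + 1"
  have pos: "A > 0" "B > 0" "D > 0" using R by (auto simp: A_def B_def D_def add_nonneg_pos)
  then have Y: "Y > 0" by (simp add: Y_def add_pos_pos)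
  show ?thesis
  proof (rule that)
    show "B * Y ^ 3 + D * Y\<^sup>2 > 0" using pos Y by (simp add: add_pos_pos)
    fix x
    let ?s = "R\<^sup>2 - (norm (x - c))\<^sup>2"
    show "- laplacian (\<lambda>x. flat 0 (R\<^sup>2 - (norm (x - c))\<^sup>2)) x \<le> (B * Y ^ 3 + D * Y\<^sup>2) * flat 0 ?s"
    proof (cases "0 < ?s")
      case True
      define y where "y = inverse ?s"
      have y: "y > 0" using True by (simp add: y_def)
      have n: "(norm (x - c))\<^sup>2 = R\<^sup>2 - inverse y" by (simp add: y_def)
      have fl: "flat j ?s = exp (- y) * y ^ j" for j using True by (simp add: flat_def y_def)
      have "- laplacian (\<lambda>x. flat 0 (R\<^sup>2 - (norm (x - c))\<^sup>2)) x =
          exp (- y) * (D * y\<^sup>2 - 4 * (R\<^sup>2 - inverse y) * (y ^ 4 - 2 * y ^ 3))"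
        unfolding laplacian_flat_ball fl n[symmetric] by (simp add: D_def algebra_simps)
      also have "4 * (R\<^sup>2 - inverse y) * (y ^ 4 - 2 * y ^ 3) = A * y ^ 4 - B * y ^ 3 + 8 * y\<^sup>2"
        using y by (simp add: A_def B_def field_simps power_numeral_reduce)
      also have "exp (- y) * (D * y\<^sup>2 - (A * y ^ 4 - B * y ^ 3 + 8 * y\<^sup>2)) \<le> exp (- y) * (B * Y ^ 3 + D * Y\<^sup>2)"
      proof (rule mult_left_mono)
        have "B * y ^ 3 + D * y\<^sup>2 - A * y ^ 4 \<le> B * Y ^ 3 + D * Y\<^sup>2"
          unfolding Y_def by (rule cubic_quadratic_bounded_by_quartic) (use pos y in auto)
        then show "D * y\<^sup>2 - (A * y ^ 4 - B * y ^ 3 + 8 * y\<^sup>2) \<le> B * Y ^ 3 + D * Y\<^sup>2"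
          using zero_le_power2[of y] by linarith
      qed simp
      finally show ?thesis by (simp add: fl mult.commute)
    next
      case False
      then show ?thesis by (simp add: laplacian_flat_ball flat_eq_0)
    qed
  qed
qed

context bounded_open
begin

text \<open>The partial derivatives of \<open>\<phi>\<close> are test functions themselves, so this is the definition of the weak
  gradient of \<open>Z\<close>, summed over the coordinates.\<close>

lemma dirichlet_test:
  assumes \<phi>: "\<phi> \<in> test_functions \<Omega>" and Z: "Z \<in> H10_graph \<Omega>"
  shows "dirichlet (\<lambda>x. (\<phi> x, grad \<phi> x)) Z = (LINT x|M. - laplacian \<phi> x * fst (Z x))"
proof -
  let ?D = "\<lambda>b x. frechet_derivative \<phi> (at x) b"
  let ?DD = "\<lambda>b x. frechet_derivative (?D b) (at x) b"
  note s = test_functions_smooth[OF \<phi>] and ZL = H10_graph_L2[OF Z]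
  have DL: "?D b \<in> L2 M" "?DD b \<in> L2 M" if "b \<in> Basis" for b
    using that s by (auto intro!: continuous_L2 smooth_continuous smooth_partial)
  have SL: "(\<lambda>x. snd (Z x) \<bullet> b) \<in> L2 M" if "b \<in> Basis" for b
  proof (rule L2_bound[OF _ L2_integrable[OF L2_snd[OF ZL]]])
    show "(\<lambda>x. snd (Z x) \<bullet> b) \<in> borel_measurable M"
      using L2_measurable[OF L2_snd[OF ZL]] by (intro borel_measurable_inner) auto
    show "AE x in M. (norm (snd (Z x) \<bullet> b))\<^sup>2 \<le> (norm (snd (Z x)))\<^sup>2"
      using Basis_le_norm[OF that] by (intro AE_I2 power_mono) auto
  qed
  have "dirichlet (\<lambda>x. (\<phi> x, grad \<phi> x)) Z = (LINT x|M. (\<Sum>b\<in>Basis. (snd (Z x) \<bullet> b) * ?D b x))"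
    unfolding dirichlet_def
    by (intro Bochner_Integration.integral_cong refl)
       (simp add: grad_def inner_sum_right inner_commute[of _ "snd (Z x)" for x] mult.commute)
  also have "\<dots> = (\<Sum>b\<in>Basis. (LINT x|M. (snd (Z x) \<bullet> b) * ?D b x))"
    by (rule Bochner_Integration.integral_sum) (intro L2_mult_integrable SL DL)
  also have "\<dots> = (\<Sum>b\<in>Basis. - (LINT x|M. fst (Z x) * ?DD b x))"
    using H10_graph_weak_gradient[OF Z] test_functions_partial[OF \<phi>]
    by (intro sum.cong refl) (simp add: has_weak_gradient_def)
  also have "\<dots> = - (LINT x|M. (\<Sum>b\<in>Basis. fst (Z x) * ?DD b x))"
    by (subst Bochner_Integration.integral_sum)
       (auto intro!: L2_mult_integrable DL L2_fst ZL simp: sum_negf)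
  also have "\<dots> = (LINT x|M. - laplacian \<phi> x * fst (Z x))"
    by (simp add: laplacian_def sum_distrib_left mult.commute flip: Bochner_Integration.integral_minus)
  finally show ?thesis .
qed

lemma weakly_le_scale:
  assumes "weakly_le W h" "0 \<le> t"
  shows "weakly_le (\<lambda>x. t *\<^sub>R W x) (\<lambda>x. t * h x)"
  unfolding weakly_le_def
proof (intro conjI ballI impI)
  show "(\<lambda>x. t *\<^sub>R W x) \<in> H10_graph \<Omega>" using assms by (auto simp: weakly_le_def intro: H10_graph_scale)
  fix Z assume "Z \<in> H10_graph \<Omega>" "AE x in M. 0 \<le> fst (Z x)"
  with assms have "t * dirichlet W Z \<le> t * (LINT x|M. h x * fst (Z x))"
    by (intro mult_left_mono) (auto simp: weakly_le_def)
  then show "dirichlet (\<lambda>x. t *\<^sub>R W x) Z \<le> (LINT x|M. t * h x * fst (Z x))"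
    by (simp add: dirichlet_def mult.assoc)
qed

lemma ball_bump:
  assumes R: "R > 0" "cball c R \<subseteq> \<Omega>"
  obtains W C where "C > 0" "weakly_le W (\<lambda>x. C * fst (W x))" "\<And>x. 0 \<le> fst (W x)" "\<And>x. fst (W x) \<le> 1"
    "\<And>x. x \<in> ball c R \<Longrightarrow> 0 < fst (W x)"
proof -
  define \<phi> where "\<phi> x = flat 0 (R\<^sup>2 - (norm (x - c))\<^sup>2)" for x
  have "smooth \<phi>"
    unfolding \<phi>_def by (intro smooth_flat smooth_diff smooth_const smooth_norm_squared)
  moreover have "\<phi> x = 0" if "x \<notin> cball c R" for x
  proof -
    have "R \<le> norm (x - c)" using that by (simp add: dist_norm norm_minus_commute)
    then have "R\<^sup>2 \<le> (norm (x - c))\<^sup>2" using R by (intro power_mono) auto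
    then show ?thesis by (simp add: \<phi>_def flat_eq_0)
  qed
  ultimately have \<phi>: "\<phi> \<in> test_functions \<Omega>"
    using R by (intro test_functionsI[of \<phi> "cball c R"]) auto
  obtain C where C: "C > 0" "\<And>x. - laplacian \<phi> x \<le> C * \<phi> x"
    using flat_ball_laplacian_bound[OF R(1), of c] unfolding \<phi>_def by blast
  show ?thesis
  proof (rule that[OF C(1), of "\<lambda>x. (\<phi> x, grad \<phi> x)"])
    show "weakly_le (\<lambda>x. (\<phi> x, grad \<phi> x)) (\<lambda>x. C * fst (\<phi> x, grad \<phi> x))"
      unfolding weakly_le_def
    proof (intro conjI ballI impI)
      show "(\<lambda>x. (\<phi> x, grad \<phi> x)) \<in> H10_graph \<Omega>" by (rule H10_graph_test[OF \<phi>])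
      fix Z assume Z: "Z \<in> H10_graph \<Omega>" "AE x in M. 0 \<le> fst (Z x)"
      note s = test_functions_smooth[OF \<phi>] and zL = L2_fst[OF H10_graph_L2[OF Z(1)]]
      have "dirichlet (\<lambda>x. (\<phi> x, grad \<phi> x)) Z = (LINT x|M. - laplacian \<phi> x * fst (Z x))"
        by (rule dirichlet_test[OF \<phi> Z(1)])
      also have "\<dots> \<le> (LINT x|M. C * fst (\<phi> x, grad \<phi> x) * fst (Z x))"
      proof (rule integral_mono_AE)
        have c: "continuous_on UNIV (laplacian \<phi>)" "continuous_on UNIV \<phi>"
          using s by (auto intro: smooth_continuous smooth_laplacian)
        show "integrable M (\<lambda>x. - laplacian \<phi> x * fst (Z x))"
          by (intro L2_mult_integrable continuous_L2 continuous_intros c zL)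
        show "integrable M (\<lambda>x. C * fst (\<phi> x, grad \<phi> x) * fst (Z x))"
          unfolding fst_conv by (intro L2_mult_integrable continuous_L2 continuous_intros c zL)
        show "AE x in M. - laplacian \<phi> x * fst (Z x) \<le> C * fst (\<phi> x, grad \<phi> x) * fst (Z x)"
          using Z(2) unfolding fst_conv by eventually_elim (rule mult_right_mono[OF C(2)])
      qed
      finally show "dirichlet (\<lambda>x. (\<phi> x, grad \<phi> x)) Z \<le> (LINT x|M. C * fst (\<phi> x, grad \<phi> x) * fst (Z x))" .
    qed
    show "0 < fst (\<phi> x, grad \<phi> x)" if "x \<in> ball c R" for x
    proof -
      have "norm (x - c) < R" using that by (simp add: dist_norm norm_minus_commute)
      then have "(norm (x - c))\<^sup>2 < R\<^sup>2" by (intro power_strict_mono) auto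
      then show ?thesis by (simp add: \<phi>_def flat_pos_iff)
    qed
  qed (simp_all add: \<phi>_def flat_nonneg flat_zero_le_1)
qed

end

section \<open>The local sublinear problem\<close>

definition reaction :: "real \<Rightarrow> real \<Rightarrow> real \<Rightarrow> real \<Rightarrow> real \<Rightarrow> real" where
  "reaction l \<mu> \<alpha> \<beta> s = l * s powr \<alpha> - \<mu> * s powr \<beta>"

text \<open>The mean value theorem, except at \<open>s = 0\<close>, where the power function may fail to be differentiable.\<close>

lemma powr_diff_le:
  fixes s t m \<beta> :: real
  assumes "0 \<le> s" "s \<le> t" "t \<le> m" "1 \<le> \<beta>"
  shows "t powr \<beta> - s powr \<beta> \<le> \<beta> * m powr (\<beta> - 1) * (t - s)"
proof -
  consider "s = t" | "s = 0" "0 < t" | "0 < s" "s < t" using assms by linarith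
  then show ?thesis
  proof cases
    case 2
    have "t powr \<beta> = t powr (\<beta> - 1) * t" using 2 powr_mult_base[of t "\<beta> - 1"] by (simp add: mult.commute)
    also have "\<dots> \<le> (\<beta> * m powr (\<beta> - 1)) * t"
    proof (rule mult_right_mono)
      have "t powr (\<beta> - 1) \<le> 1 * m powr (\<beta> - 1)" using 2 assms by (simp add: powr_mono2)
      also have "\<dots> \<le> \<beta> * m powr (\<beta> - 1)" using assms by (intro mult_right_mono) auto
      finally show "t powr (\<beta> - 1) \<le> \<beta> * m powr (\<beta> - 1)" .
    qed (use 2 in simp)
    finally show ?thesis using 2 by simp
  next
    case 3
    obtain z where z: "s < z" "z < t" "t powr \<beta> - s powr \<beta> = (t - s) * (\<beta> * z powr (\<beta> - 1))"
      using MVT2[OF 3(2), of "\<lambda>x. x powr \<beta>" "\<lambda>x. \<beta> * x powr (\<beta> - 1)"] has_real_derivative_powr 3 by force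
    have "z powr (\<beta> - 1) \<le> m powr (\<beta> - 1)" using z 3 assms by (intro powr_mono2) auto
    then have "(t - s) * (\<beta> * z powr (\<beta> - 1)) \<le> (t - s) * (\<beta> * m powr (\<beta> - 1))"
      using 3 assms by (intro mult_left_mono) auto
    then show ?thesis using z by (simp add: mult_ac)
  qed simp
qed

text \<open>The last assumption makes the constant \<open>m\<close> a supersolution.\<close>

locale sublinear_problem = bounded_open \<Omega> for \<Omega> :: "'a::euclidean_space set" +
  fixes l \<mu> \<alpha> \<beta> m :: real
  assumes l: "0 < l" and \<mu>: "0 < \<mu>" and \<alpha>: "0 \<le> \<alpha>" "\<alpha> < 1" and \<beta>: "1 \<le> \<beta>"
    and m: "0 < m" "l * m powr \<alpha> \<le> \<mu> * m powr \<beta>"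
begin

text \<open>The largest slope on \<open>[0, m]\<close> of the absorption term: adding \<open>k s\<close> makes the reaction increasing there.\<close>

definition k :: real where "k = \<mu> * (\<beta> * m powr (\<beta> - 1))"

definition F :: "real \<Rightarrow> real" where "F = reaction l \<mu> \<alpha> \<beta>"

definition clamp_m :: "real \<Rightarrow> real" where "clamp_m s = max 0 (min m s)"

text \<open>Clamping to \<open>[0, m]\<close> makes this function bounded and increasing on the whole line, so that the right
  hand sides of the iteration are square integrable without information on the range of the iterates.\<close>

definition shifted :: "real \<Rightarrow> real" where "shifted s = F (clamp_m s) + k * clamp_m s"

lemma k_pos: "0 < k"
  using \<mu> \<beta> m by (simp add: k_def)

lemma F_0: "F 0 = 0"
  by (simp add: F_def reaction_def)

lemma F_plus_linear_mono:
  assumes "0 \<le> s" "s \<le> t" "t \<le> m"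
  shows "F s + k * s \<le> F t + k * t"
proof -
  have "l * s powr \<alpha> \<le> l * t powr \<alpha>"
    using assms l \<alpha> by (intro mult_left_mono powr_mono2) auto
  moreover have "\<mu> * (t powr \<beta> - s powr \<beta>) \<le> \<mu> * (\<beta> * m powr (\<beta> - 1) * (t - s))"
    using powr_diff_le[OF assms \<beta>] \<mu> by (intro mult_left_mono) auto
  ultimately show ?thesis
    by (simp add: F_def reaction_def k_def algebra_simps)
qed

lemma clamp_m_range: "0 \<le> clamp_m s" "clamp_m s \<le> m"
  using m by (auto simp: clamp_m_def)

lemma clamp_m_id: "0 \<le> s \<Longrightarrow> s \<le> m \<Longrightarrow> clamp_m s = s"
  by (simp add: clamp_m_def)

lemma shifted_mono: "s \<le> t \<Longrightarrow> shifted s \<le> shifted t"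
  unfolding shifted_def by (intro F_plus_linear_mono clamp_m_range) (auto simp: clamp_m_def)

lemma shifted_range: "0 \<le> shifted s" "shifted s \<le> k * m"
proof -
  show "0 \<le> shifted s"
    unfolding shifted_def using F_plus_linear_mono[of 0 "clamp_m s"] clamp_m_range[of s] by (simp add: F_0)
  have "shifted s \<le> F m + k * m"
    unfolding shifted_def using F_plus_linear_mono[of "clamp_m s" m] clamp_m_range[of s] by simp
  also have "\<dots> \<le> k * m" using m by (simp add: F_def reaction_def)
  finally show "shifted s \<le> k * m" .
qed

lemma shifted_eq: "0 \<le> s \<Longrightarrow> s \<le> m \<Longrightarrow> shifted s = F s + k * s"
  by (simp add: shifted_def clamp_m_id)

text \<open>For \<open>\<alpha> = 0\<close> the term \<open>s powr \<alpha>\<close> jumps at \<open>0\<close>, so the limit has to be positive. This is why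
  the positivity of the limit precedes the passage to the limit in \<open>maximal_solution\<close>.\<close>

lemma shifted_tendsto:
  assumes "(u \<longlongrightarrow> s) net" "0 < s"
  shows "((\<lambda>n. shifted (u n)) \<longlongrightarrow> shifted s) net"
proof -
  have "((\<lambda>n. clamp_m (u n)) \<longlongrightarrow> clamp_m s) net"
    unfolding clamp_m_def by (intro tendsto_intros assms)
  moreover have "clamp_m s \<noteq> 0" using assms m by (auto simp: clamp_m_def)
  ultimately show ?thesis
    unfolding shifted_def F_def reaction_def by (auto intro!: tendsto_intros)
qed

lemma borel_measurable_F [measurable]: "F \<in> borel_measurable borel"
  unfolding F_def reaction_def by measurable

lemma borel_measurable_shifted [measurable]: "shifted \<in> borel_measurable borel"
  unfolding shifted_def clamp_m_def by measurable

lemma shifted_L2: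
  assumes "u \<in> borel_measurable M"
  shows "(\<lambda>x. shifted (u x)) \<in> L2 M"
  by (rule L2_bounded[OF measurable_compose[OF assms borel_measurable_shifted], of "k * m"])
     (simp add: shifted_range)

lemma F_L2:
  assumes "u \<in> borel_measurable M" "AE x in M. 0 \<le> u x \<and> u x \<le> m"
  shows "(\<lambda>x. F (u x)) \<in> L2 M"
proof (rule L2_bounded[OF measurable_compose[OF assms(1) borel_measurable_F], of "k * m + k * m"])
  show "AE x in M. norm (F (u x)) \<le> k * m + k * m"
    using assms(2)
  proof eventually_elim
    case (elim x)
    then have "k * u x \<le> k * m" "0 \<le> k * u x" using k_pos by auto
    with elim shifted_eq[of "u x"] shifted_range[of "u x"] show ?case
      unfolding real_norm_def abs_le_iff by linarith
  qed
qed

lemma graph_measurable: "W \<in> H10_graph \<Omega> \<Longrightarrow> (\<lambda>x. fst (W x)) \<in> borel_measurable M"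
  by (intro L2_measurable L2_fst H10_graph_L2)

text \<open>The inverse of \<open>- \<Delta> + k\<close>.\<close>

definition solve :: "('a \<Rightarrow> real) \<Rightarrow> 'a \<Rightarrow> real \<times> 'a" where
  "solve h = (SOME W. weakly_eq W (\<lambda>x. h x - k * fst (W x)))"

lemma solve:
  assumes "h \<in> L2 M"
  shows "weakly_eq (solve h) (\<lambda>x. h x - k * fst (solve h x))"
proof -
  obtain W where "weakly_eq W (\<lambda>x. h x - k * fst (W x))"
    using resolvent_exists[OF k_pos assms] by blast
  then show ?thesis unfolding solve_def
    by (rule someI[of "\<lambda>W. weakly_eq W (\<lambda>x. h x - k * fst (W x))"])
qed

lemma solve_graph: "h \<in> L2 M \<Longrightarrow> solve h \<in> H10_graph \<Omega>"
  using solve by (simp add: weakly_eq_def)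

lemma solve_mono:
  assumes "h \<in> L2 M" "h' \<in> L2 M" "AE x in M. h x \<le> h' x"
  shows "AE x in M. fst (solve h x) \<le> fst (solve h' x)"
  by (rule comparison_principle[OF weakly_eq_imp_le[OF solve] solve k_pos]) (use assms in auto)

lemma solve_le_m:
  assumes h: "h \<in> L2 M" "AE x in M. h x \<le> k * m"
  shows "AE x in M. fst (solve h x) \<le> m"
proof (rule weak_maximum_principle[OF weakly_eq_imp_le[OF solve[OF h(1)]]])
  show "(\<lambda>x. h x - k * fst (solve h x)) \<in> L2 M"
    using L2_diff[OF h(1) L2_scale[OF L2_fst[OF H10_graph_L2[OF solve_graph[OF h(1)]]], of k]] by simp
  show "AE x in M. m < fst (solve h x) \<longrightarrow> h x - k * fst (solve h x) \<le> - k * (fst (solve h x) - m)"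
    using h(2) by eventually_elim (simp add: algebra_simps)
qed (use m k_pos in auto)

lemma solve_shifted_le_m:
  "u \<in> borel_measurable M \<Longrightarrow> AE x in M. fst (solve (\<lambda>x. shifted (u x)) x) \<le> m"
  by (intro solve_le_m shifted_L2) (auto simp: shifted_range)

lemma subsolution_le_solve:
  assumes V: "weakly_le V (\<lambda>x. F (fst (V x)))" "AE x in M. 0 \<le> fst (V x) \<and> fst (V x) \<le> m"
    and h: "h \<in> L2 M" "AE x in M. shifted (fst (V x)) \<le> h x"
  shows "AE x in M. fst (V x) \<le> fst (solve h x)"
proof (rule comparison_principle[OF _ solve[OF h(1)] k_pos])
  have VG: "V \<in> H10_graph \<Omega>" using V by (simp add: weakly_le_def)
  note vm = graph_measurable[OF VG]
  show L: "(\<lambda>x. shifted (fst (V x))) \<in> L2 M" by (rule shifted_L2[OF vm])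
  have L': "(\<lambda>x. shifted (fst (V x)) - k * fst (V x)) \<in> L2 M"
    using L2_diff[OF L L2_scale[OF L2_fst[OF H10_graph_L2[OF VG]], of k]] by simp
  show "weakly_le V (\<lambda>x. shifted (fst (V x)) - k * fst (V x))"
    by (rule weakly_le_mono[OF V(1) F_L2[OF vm V(2)] L'])
       (use V(2) in eventually_elim, simp add: shifted_eq)
qed (use h in auto)

lemma zero_subsolution: "weakly_le (\<lambda>x. 0) (\<lambda>x. F (fst (0::real \<times> 'a)))"
proof -
  obtain W where "W \<in> H10_graph \<Omega>" using H10_graph_nonempty by blast
  from H10_graph_diff[OF this this] have "(\<lambda>x. 0) \<in> H10_graph \<Omega>" by simp
  then show ?thesis by (simp add: weakly_le_def dirichlet_def F_0)
qed

text \<open>For the bump \<open>w\<close> of \<open>ball_bump\<close> and \<open>v = \<epsilon> w\<close> one has \<open>- \<Delta>v \<le> C v\<close>. Since \<open>v = v\<^sup>\<alpha> v\<^sup>1\<^sup>-\<^sup>\<alpha>\<close> and \<open>\<alpha> < 1\<close>, for small \<open>\<epsilon>\<close> both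
  \<open>C v\<close> and \<open>\<mu> v\<^sup>\<beta>\<close> are small fractions of \<open>l v\<^sup>\<alpha>\<close>.\<close>

lemma ball_subsolution:
  assumes "R > 0" "cball c R \<subseteq> \<Omega>"
  obtains V where "weakly_le V (\<lambda>x. F (fst (V x)))" "\<And>x. 0 \<le> fst (V x) \<and> fst (V x) \<le> m"
    "\<And>x. x \<in> ball c R \<Longrightarrow> 0 < fst (V x)"
proof -
  obtain W C where W: "C > 0" "weakly_le W (\<lambda>x. C * fst (W x))" "\<And>x. 0 \<le> fst (W x)" "\<And>x. fst (W x) \<le> 1"
    "\<And>x. x \<in> ball c R \<Longrightarrow> 0 < fst (W x)"
    using assms by (rule ball_bump) blast
  \<comment> \<open>the largest \<open>\<epsilon>\<close> for which \<open>(C + \<mu>) \<epsilon>\<^sup>1\<^sup>-\<^sup>\<alpha> \<le> l\<close>, capped by the range of subsolutions and by \<open>1\<close>, where \<open>v\<^sup>\<beta>\<^sup>-\<^sup>\<alpha> \<le> v\<^sup>1\<^sup>-\<^sup>\<alpha>\<close>\<close>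
  define \<epsilon> where "\<epsilon> = min (min 1 m) ((l / (C + \<mu>)) powr (1 / (1 - \<alpha>)))"
  have \<epsilon>: "0 < \<epsilon>" "\<epsilon> \<le> 1" "\<epsilon> \<le> m" using m l W(1) \<mu> by (auto simp: \<epsilon>_def)
  have \<epsilon>': "(C + \<mu>) * \<epsilon> powr (1 - \<alpha>) \<le> l"
  proof -
    have "\<epsilon> powr (1 - \<alpha>) \<le> ((l / (C + \<mu>)) powr (1 / (1 - \<alpha>))) powr (1 - \<alpha>)"
      using \<epsilon> \<alpha> by (intro powr_mono2) (auto simp: \<epsilon>_def)
    also have "\<dots> = l / (C + \<mu>)" using \<alpha> l W(1) \<mu> by (simp add: powr_powr)
    finally show ?thesis using W(1) \<mu> by (simp add: field_simps)
  qed
  have small: "C * v \<le> F v" if v: "0 \<le> v" "v \<le> \<epsilon>" for v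
  proof (cases "v = 0")
    case False
    then have v0: "0 < v" "v \<le> 1" using v \<epsilon> by auto
    have "v powr \<beta> = v powr \<alpha> * v powr (\<beta> - \<alpha>)" by (simp flip: powr_add)
    also have "\<dots> \<le> v powr \<alpha> * v powr (1 - \<alpha>)"
      using v0 \<beta> \<alpha> by (intro mult_left_mono powr_mono') auto
    finally have b: "\<mu> * v powr \<beta> \<le> \<mu> * (v powr \<alpha> * v powr (1 - \<alpha>))"
      using \<mu> by (intro mult_left_mono) auto
    have a: "v = v powr \<alpha> * v powr (1 - \<alpha>)" using v0 by (simp flip: powr_add)
    have "(C + \<mu>) * v powr (1 - \<alpha>) \<le> (C + \<mu>) * \<epsilon> powr (1 - \<alpha>)"
      using v v0 \<alpha> W(1) \<mu> by (intro mult_left_mono powr_mono2) auto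
    with \<epsilon>' have "(C + \<mu>) * v powr (1 - \<alpha>) \<le> l" by linarith
    then have "v powr \<alpha> * ((C + \<mu>) * v powr (1 - \<alpha>)) \<le> v powr \<alpha> * l" by (intro mult_left_mono) auto
    then have "C * (v powr \<alpha> * v powr (1 - \<alpha>)) + \<mu> * (v powr \<alpha> * v powr (1 - \<alpha>)) \<le> l * v powr \<alpha>"
      by (simp add: algebra_simps)
    with a b show ?thesis by (simp add: F_def reaction_def)
  qed (simp add: F_0)
  define V where "V x = \<epsilon> *\<^sub>R W x" for x
  have V0: "0 \<le> fst (V x)" "fst (V x) \<le> \<epsilon>" for x
    using W(3,4)[of x] \<epsilon> by (auto simp: V_def intro: mult_left_le)
  have "weakly_le V (\<lambda>x. \<epsilon> * (C * fst (W x)))"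
    unfolding V_def using W(2) \<epsilon> by (intro weakly_le_scale) auto
  then have V: "weakly_le V (\<lambda>x. C * fst (V x))" by (simp add: V_def mult_ac)
  then have VG: "V \<in> H10_graph \<Omega>" by (simp add: weakly_le_def)
  have r: "0 \<le> fst (V x) \<and> fst (V x) \<le> m" for x using V0[of x] \<epsilon> by linarith
  show ?thesis
  proof (rule that)
    show "weakly_le V (\<lambda>x. F (fst (V x)))"
    proof (rule weakly_le_mono[OF V])
      show "(\<lambda>x. C * fst (V x)) \<in> L2 M"
        using L2_scale[OF L2_fst[OF H10_graph_L2[OF VG]], of C] by simp
      show "(\<lambda>x. F (fst (V x))) \<in> L2 M" using r by (intro F_L2 graph_measurable VG) auto
    qed (use small V0 in auto)
    show "0 < fst (V x)" if "x \<in> ball c R" for x using W(5)[OF that] \<epsilon> by (simp add: V_def)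
  qed (rule r)
qed

lemma AE_pos_if_above_ball_subsolutions:
  assumes "\<And>c R. R > 0 \<Longrightarrow> cball c R \<subseteq> \<Omega> \<Longrightarrow> AE x in M. x \<in> ball c R \<longrightarrow> 0 < u x"
  shows "AE x in M. 0 < u x"
proof -
  define \<B> where "\<B> = {ball c R | c R. R > 0 \<and> cball c R \<subseteq> \<Omega>}"
  have "open B" if "B \<in> \<B>" for B using that by (auto simp: \<B>_def)
  then obtain \<B>' where \<B>': "\<B>' \<subseteq> \<B>" "countable \<B>'" "\<Union>\<B>' = \<Union>\<B>"
    by (rule Lindelof)
  have cover: "\<Omega> \<subseteq> \<Union>\<B>"
  proof
    fix x assume "x \<in> \<Omega>"
    then obtain R where "R > 0" "cball x R \<subseteq> \<Omega>" using open_dom by (auto simp: open_contains_cball)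
    then show "x \<in> \<Union>\<B>" unfolding \<B>_def by (intro UnionI[of "ball x R"]) auto
  qed
  have "AE x in M. \<forall>B\<in>\<B>'. x \<in> B \<longrightarrow> 0 < u x"
    unfolding AE_ball_countable[OF \<B>'(2)] using \<B>'(1) assms by (auto simp: \<B>_def)
  moreover have "AE x in M. x \<in> \<Omega>" by (rule AE_I2) simp
  ultimately show ?thesis
    by eventually_elim (use cover \<B>'(3) in auto)
qed

text \<open>The iterates decrease to some \<open>w\<close>, which lies above every subsolution and is therefore positive. The
  solution \<open>W\<close> of \<open>- \<Delta>W + k W = shifted(w)\<close> is shown to coincide with \<open>w\<close>: its distance to the next
  iterate is controlled by the distance of \<open>shifted(U\<^sub>n)\<close> to \<open>shifted(w)\<close>, which tends to \<open>0\<close> by dominated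
  convergence.\<close>

theorem maximal_solution:
  obtains U where "weakly_eq U (\<lambda>x. F (fst (U x)))" "AE x in M. 0 < fst (U x) \<and> fst (U x) \<le> m"
    "\<And>V. weakly_le V (\<lambda>x. F (fst (V x))) \<Longrightarrow> AE x in M. 0 \<le> fst (V x) \<and> fst (V x) \<le> m \<Longrightarrow>
      AE x in M. fst (V x) \<le> fst (U x)"
proof -
  define U where "U = rec_nat (solve (\<lambda>x. k * m)) (\<lambda>n W. solve (\<lambda>x. shifted (fst (W x))))"
  have U0: "U 0 = solve (\<lambda>x. k * m)" and USuc: "U (Suc n) = solve (\<lambda>x. shifted (fst (U n x)))" for n
    by (simp_all add: U_def)
  have constL: "(\<lambda>x. k * m) \<in> L2 M" by (rule L2_bounded[where C="\<bar>k * m\<bar>"]) auto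
  have UG: "U n \<in> H10_graph \<Omega>" for n
  proof (induction n)
    case 0
    show ?case unfolding U0 by (rule solve_graph[OF constL])
  next
    case (Suc n)
    then show ?case unfolding USuc by (intro solve_graph shifted_L2 graph_measurable)
  qed
  note um = graph_measurable[OF UG]
  have Um: "AE x in M. fst (U n x) \<le> m" for n
  proof (cases n)
    case 0
    show ?thesis unfolding 0 U0 by (rule solve_le_m[OF constL]) simp
  next
    case (Suc j)
    show ?thesis unfolding Suc USuc by (rule solve_shifted_le_m[OF um])
  qed
  have decr: "AE x in M. fst (U (Suc n) x) \<le> fst (U n x)" for n
  proof (induction n)
    case 0
    have "AE x in M. fst (U (Suc 0) x) \<le> fst (solve (\<lambda>x. k * m) x)"
      unfolding USuc by (rule solve_mono[OF shifted_L2[OF um] constL]) (simp add: shifted_range)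
    then show ?case by (simp add: U0)
  next
    case (Suc n)
    have "AE x in M. shifted (fst (U (Suc n) x)) \<le> shifted (fst (U n x))"
      using Suc by eventually_elim (rule shifted_mono)
    then have "AE x in M. fst (solve (\<lambda>x. shifted (fst (U (Suc n) x))) x) \<le> fst (solve (\<lambda>x. shifted (fst (U n x))) x)"
      by (rule solve_mono[OF shifted_L2[OF um] shifted_L2[OF um]])
    then show ?case by (simp add: USuc)
  qed
  have sub: "AE x in M. fst (V x) \<le> fst (U n x)"
    if V: "weakly_le V (\<lambda>x. F (fst (V x)))" "AE x in M. 0 \<le> fst (V x) \<and> fst (V x) \<le> m" for V n
  proof (induction n)
    case 0
    show ?case unfolding U0 by (rule subsolution_le_solve[OF V constL]) (simp add: shifted_range)
  next
    case (Suc n)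
    show ?case unfolding USuc
      by (rule subsolution_le_solve[OF V shifted_L2[OF um]]) (use Suc in eventually_elim, rule shifted_mono)
  qed
  have nonneg: "AE x in M. 0 \<le> fst (U n x)" for n
    using sub[of "\<lambda>x. 0", OF zero_subsolution] m by simp
  define w where "w x = lim (\<lambda>n. fst (U n x))" for x
  have lim: "AE x in M. (\<lambda>n. fst (U n x)) \<longlonglongrightarrow> w x"
  proof -
    have "AE x in M. \<forall>n. fst (U (Suc n) x) \<le> fst (U n x)" using decr by (simp add: AE_all_countable)
    moreover have "AE x in M. \<forall>n. 0 \<le> fst (U n x)" using nonneg by (simp add: AE_all_countable)
    ultimately show ?thesis
    proof eventually_elim
      case (elim x)
      then have "decseq (\<lambda>n. fst (U n x))" by (intro decseq_SucI) auto
      then have "convergent (\<lambda>n. fst (U n x))"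
        using decseq_convergent[of "\<lambda>n. fst (U n x)" 0] elim(2) by (metis convergentI)
      then show ?case by (simp add: w_def convergent_LIMSEQ_iff)
    qed
  qed
  have wm: "w \<in> borel_measurable M" unfolding w_def using um by (intro borel_measurable_lim_metric)
  have sub_w: "AE x in M. fst (V x) \<le> w x"
    if V: "weakly_le V (\<lambda>x. F (fst (V x)))" "AE x in M. 0 \<le> fst (V x) \<and> fst (V x) \<le> m" for V
  proof -
    have "AE x in M. \<forall>n. fst (V x) \<le> fst (U n x)" using sub[OF V] by (simp add: AE_all_countable)
    with lim show ?thesis
    proof eventually_elim
      case (elim x)
      then show ?case by (intro LIMSEQ_le_const[OF elim(1)]) auto
    qed
  qed
  have wpos: "AE x in M. 0 < w x"
  proof (rule AE_pos_if_above_ball_subsolutions)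
    fix c R assume "R > 0" "cball c R \<subseteq> \<Omega>"
    then obtain V where V: "weakly_le V (\<lambda>x. F (fst (V x)))" "\<And>x. 0 \<le> fst (V x) \<and> fst (V x) \<le> m"
      "\<And>x. x \<in> ball c R \<Longrightarrow> 0 < fst (V x)" by (rule ball_subsolution) blast
    have "AE x in M. fst (V x) \<le> w x" using V(2) by (intro sub_w V(1)) simp
    then show "AE x in M. x \<in> ball c R \<longrightarrow> 0 < w x" by eventually_elim (use V(3) in force)
  qed
  define W where "W = solve (\<lambda>x. shifted (w x))"
  have WG: "W \<in> H10_graph \<Omega>" unfolding W_def by (intro solve_graph shifted_L2 wm)
  note Wm = graph_measurable[OF WG]
  have hw: "(\<lambda>x. shifted (w x)) \<in> L2 M" by (rule shifted_L2[OF wm])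
  have W: "weakly_eq W (\<lambda>x. shifted (w x) - k * fst (W x))" unfolding W_def by (rule solve[OF hw])
  have W_eq_w: "AE x in M. fst (W x) = w x"
  proof -
    let ?d = "\<lambda>n x. fst (U (Suc n) x) - fst (W x)" and ?\<rho> = "\<lambda>n x. shifted (fst (U n x)) - shifted (w x)"
    have dL: "?d n \<in> L2 M" for n by (intro L2_diff L2_fst H10_graph_L2 UG WG)
    have \<rho>L: "?\<rho> n \<in> L2 M" for n by (intro L2_diff shifted_L2 um wm)
    \<comment> \<open>test the equation for \<open>U (n + 1) - W\<close> with the difference itself\<close>
    have est: "k\<^sup>2 * (LINT x|M. (?d n x)\<^sup>2) \<le> (LINT x|M. (?\<rho> n x)\<^sup>2)" for n
    proof -
      let ?D = "\<lambda>x. U (Suc n) x - W x"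
      have DG: "?D \<in> H10_graph \<Omega>" by (intro H10_graph_diff UG WG)
      have hU: "(\<lambda>x. shifted (fst (U n x))) \<in> L2 M" by (intro shifted_L2 um)
      have kL: "(\<lambda>x. shifted (fst (U n x)) - k * fst (U (Suc n) x)) \<in> L2 M" "(\<lambda>x. shifted (w x) - k * fst (W x)) \<in> L2 M"
        using L2_diff[OF hU L2_scale[OF L2_fst[OF H10_graph_L2[OF UG[of "Suc n"]]], of k]]
          L2_diff[OF hw L2_scale[OF L2_fst[OF H10_graph_L2[OF WG]], of k]] by simp_all
      have USn: "weakly_eq (U (Suc n)) (\<lambda>x. shifted (fst (U n x)) - k * fst (U (Suc n) x))"
        unfolding USuc by (rule solve[OF hU])
      have "0 \<le> dirichlet ?D ?D" by (rule dirichlet_self_nonneg)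
      also have "\<dots> = dirichlet (U (Suc n)) ?D - dirichlet W ?D"
        by (intro dirichlet_diff H10_graph_L2 UG WG DG)
      also have "\<dots> = (LINT x|M. (shifted (fst (U n x)) - k * fst (U (Suc n) x)) * fst (?D x))
          - (LINT x|M. (shifted (w x) - k * fst (W x)) * fst (?D x))"
        using USn W DG by (simp add: weakly_eq_def)
      also have "\<dots> = (LINT x|M. ?\<rho> n x * ?d n x - k * (?d n x)\<^sup>2)"
        using L2_mult_integrable[OF kL(1) dL[of n]] L2_mult_integrable[OF kL(2) dL[of n]]
        by (subst Bochner_Integration.integral_diff[symmetric])
           (auto intro!: Bochner_Integration.integral_cong simp: algebra_simps power2_eq_square)
      also have "\<dots> \<le> (LINT x|M. (?\<rho> n x)\<^sup>2 / (2 * k) - (k / 2) * (?d n x)\<^sup>2)"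
      proof (rule integral_mono)
        show "integrable M (\<lambda>x. ?\<rho> n x * ?d n x - k * (?d n x)\<^sup>2)"
          using L2_mult_integrable[OF \<rho>L dL, of n n] L2_integrable[OF dL[of n]] by simp
        show "integrable M (\<lambda>x. (?\<rho> n x)\<^sup>2 / (2 * k) - (k / 2) * (?d n x)\<^sup>2)"
          using L2_integrable[OF \<rho>L[of n]] L2_integrable[OF dL[of n]] by simp
        show "?\<rho> n x * ?d n x - k * (?d n x)\<^sup>2 \<le> (?\<rho> n x)\<^sup>2 / (2 * k) - (k / 2) * (?d n x)\<^sup>2" for x
          using zero_le_power2[of "?\<rho> n x - k * ?d n x"] k_pos
          by (simp add: field_simps power2_eq_square)
      qed
      also have "\<dots> = (LINT x|M. (?\<rho> n x)\<^sup>2) / (2 * k) - (k / 2) * (LINT x|M. (?d n x)\<^sup>2)"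
        using L2_integrable[OF \<rho>L[of n]] L2_integrable[OF dL[of n]] by simp
      finally show ?thesis using k_pos by (simp add: field_simps power2_eq_square)
    qed
    have sm: "(\<lambda>x. shifted (fst (U n x))) \<in> borel_measurable M" for n by (intro L2_measurable shifted_L2 um)
    have "(\<lambda>n. sqdist M (\<lambda>x. shifted (w x)) (\<lambda>x. shifted (fst (U n x)))) \<longlonglongrightarrow> 0"
    proof (rule L2_dominated_convergence(2)[OF constL L2_measurable[OF hw] sm])
      show "AE x in M. norm (shifted (fst (U n x))) \<le> norm (k * m)" for n
        using shifted_range[of "fst (U n x)" for x] k_pos m by (intro AE_I2) simp
      show "AE x in M. (\<lambda>n. shifted (fst (U n x))) \<longlonglongrightarrow> shifted (w x)"
        using lim wpos by eventually_elim (rule shifted_tendsto)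
    qed
    then have \<rho>0: "(\<lambda>n. LINT x|M. (?\<rho> n x)\<^sup>2) \<longlonglongrightarrow> 0"
      by (simp add: sqdist_def power2_commute)
    have "(\<lambda>n. k\<^sup>2 * (LINT x|M. (?d n x)\<^sup>2)) \<longlonglongrightarrow> 0"
      by (rule tendsto_sandwich[OF _ _ tendsto_const \<rho>0]) (auto intro!: always_eventually est)
    from tendsto_mult_left[OF this, of "1 / k\<^sup>2"] have d0: "(\<lambda>n. LINT x|M. (?d n x)\<^sup>2) \<longlonglongrightarrow> 0"
      using k_pos by simp
    have mL: "(\<lambda>x. m) \<in> L2 M" by (rule L2_bounded[where C="\<bar>m\<bar>"]) auto
    have dc: "w \<in> L2 M" "(\<lambda>n. sqdist M w (\<lambda>x. fst (U (Suc n) x))) \<longlonglongrightarrow> 0"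
    proof -
      have dom: "AE x in M. norm (fst (U (Suc n) x)) \<le> norm m" for n
        using nonneg[of "Suc n"] Um[of "Suc n"] by eventually_elim simp
      have "AE x in M. (\<lambda>n. fst (U (Suc n) x)) \<longlonglongrightarrow> w x"
        using lim by eventually_elim (rule LIMSEQ_Suc)
      note L2_dominated_convergence[OF mL wm um dom this]
      then show "w \<in> L2 M" "(\<lambda>n. sqdist M w (\<lambda>x. fst (U (Suc n) x))) \<longlonglongrightarrow> 0" by auto
    qed
    have WL: "(\<lambda>x. fst (W x)) \<in> L2 M" by (intro L2_fst H10_graph_L2 WG)
    have le: "sqdist M w (\<lambda>x. fst (W x)) \<le> 2 * sqdist M w (\<lambda>x. fst (U (Suc n) x)) + 2 * (LINT x|M. (?d n x)\<^sup>2)" for n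
      using sqdist_triangle[OF dc(1) L2_fst[OF H10_graph_L2[OF UG[of "Suc n"]]] WL] by (simp add: sqdist_def)
    have "(\<lambda>n. 2 * sqdist M w (\<lambda>x. fst (U (Suc n) x)) + 2 * (LINT x|M. (?d n x)\<^sup>2)) \<longlonglongrightarrow> 2 * 0 + 2 * 0"
      by (intro tendsto_intros dc(2) d0)
    then have lim0: "(\<lambda>n. 2 * sqdist M w (\<lambda>x. fst (U (Suc n) x)) + 2 * (LINT x|M. (?d n x)\<^sup>2)) \<longlonglongrightarrow> 0"
      by simp
    have "sqdist M w (\<lambda>x. fst (W x)) \<le> 0"
      by (rule LIMSEQ_le_const[OF lim0]) (use le in blast)
    then have "(LINT x|M. (norm (w x - fst (W x)))\<^sup>2) = 0"
      using sqdist_nonneg[of M w "\<lambda>x. fst (W x)"] unfolding sqdist_def by linarith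
    then have "AE x in M. (norm (w x - fst (W x)))\<^sup>2 = 0"
      using L2_integrable[OF L2_diff[OF dc(1) WL]] by (subst (asm) integral_nonneg_eq_0_iff_AE) auto
    then show ?thesis by eventually_elim simp
  qed
  have Wle: "AE x in M. fst (W x) \<le> m" unfolding W_def by (rule solve_shifted_le_m[OF wm])
  have Wrange: "AE x in M. 0 < fst (W x) \<and> fst (W x) \<le> m"
    using W_eq_w wpos Wle by eventually_elim auto
  then have Wrange': "AE x in M. 0 \<le> fst (W x) \<and> fst (W x) \<le> m" by eventually_elim auto
  have kL: "(\<lambda>x. shifted (w x) - k * fst (W x)) \<in> L2 M"
    using L2_diff[OF hw L2_scale[OF L2_fst[OF H10_graph_L2[OF WG]], of k]] by simp
  show ?thesis
  proof (rule that)
    show "weakly_eq W (\<lambda>x. F (fst (W x)))"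
      by (rule weakly_eq_cong[OF W kL F_L2[OF Wm Wrange']])
         (use W_eq_w Wrange in eventually_elim, simp add: shifted_eq)
    show "AE x in M. fst (V x) \<le> fst (W x)"
      if "weakly_le V (\<lambda>x. F (fst (V x)))" "AE x in M. 0 \<le> fst (V x) \<and> fst (V x) \<le> m" for V
      using sub_w[OF that] W_eq_w by eventually_elim simp
  qed (rule Wrange)
qed

end

section \<open>Dependence on the parameters and the nonlocal problem\<close>

text \<open>The set where a continuous function obeys a bound is closed, and a closed set that has full measure
  in an open set contains that open set.\<close>

lemma continuous_Linfty_bound:
  fixes f :: "real \<Rightarrow> real"
  assumes f: "continuous_on {0..} f" "f \<in> Linfty (lebesgue_on {0..})"
  obtains C where "\<And>t. 0 \<le> t \<Longrightarrow> f t \<le> C"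
proof -
  obtain C where "AE x in lebesgue_on {0..}. \<bar>f x\<bar> \<le> C" using f(2) by (auto simp: Linfty_def)
  then have ae: "AE x in lebesgue. x \<in> {0..} \<longrightarrow> \<bar>f x\<bar> \<le> C" by (subst (asm) AE_restrict_space_iff) auto
  define S where "S = {x. \<bar>f (max x 0)\<bar> \<le> C}"
  have "continuous_on UNIV (\<lambda>x. f (max x 0))"
    by (rule continuous_on_compose2[OF f(1)]) (auto intro!: continuous_intros)
  then have S: "closed S"
    unfolding S_def by (intro closed_Collect_le continuous_intros)
  have "x \<in> S" if "x \<in> {0<..}" for x
  proof (rule mem_closed_if_AE_lebesgue_open[OF _ S _ that])
    show "AE x\<in>{0<..} in lebesgue. x \<in> S"
      using ae by eventually_elim (auto simp: S_def max_def)
  qed simp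
  then have "closure {0<..} \<subseteq> S" by (intro closure_minimal S) auto
  then have "{0..} \<subseteq> S" by simp
  then show ?thesis by (intro that[of C]) (auto simp: S_def subset_iff abs_le_iff max_def)
qed

context bounded_open
begin

definition maximal_in :: "real \<Rightarrow> real \<Rightarrow> real \<Rightarrow> real \<Rightarrow> real \<Rightarrow> ('a \<Rightarrow> real \<times> 'a) \<Rightarrow> bool" where
  "maximal_in \<alpha> \<beta> m l \<mu> U \<longleftrightarrow>
     weakly_eq U (\<lambda>x. reaction l \<mu> \<alpha> \<beta> (fst (U x))) \<and> (AE x in M. 0 < fst (U x) \<and> fst (U x) \<le> m) \<and>
     (\<forall>V. weakly_le V (\<lambda>x. reaction l \<mu> \<alpha> \<beta> (fst (V x))) \<longrightarrow> (AE x in M. 0 \<le> fst (V x) \<and> fst (V x) \<le> m) \<longrightarrow>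
       (AE x in M. fst (V x) \<le> fst (U x)))"

text \<open>Scaling by \<open>t\<close> replaces \<open>(l, \<mu>)\<close> by \<open>(t\<^sup>1\<^sup>-\<^sup>\<alpha> l, t\<^sup>1\<^sup>-\<^sup>\<beta> \<mu>)\<close>. The gain \<open>l' - t\<^sup>1\<^sup>-\<^sup>\<alpha> l\<close> in the sublinear term has to pay for an
  increase from \<open>\<mu>\<close> to \<open>\<mu>'\<close>; the two terms are compared by \<open>s\<^sup>\<beta> \<le> m\<^sup>\<beta>\<^sup>-\<^sup>\<alpha> s\<^sup>\<alpha>\<close>.\<close>

lemma scaled_reaction_le:
  assumes \<alpha>: "\<alpha> < 1" and \<beta>: "1 \<le> \<beta>" and t: "0 < t" "t \<le> 1" and s: "0 < s" "s \<le> m"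
    and close: "t powr (1 - \<alpha>) * l + \<bar>\<mu>' - \<mu>\<bar> * m powr (\<beta> - \<alpha>) \<le> l'" and \<mu>: "0 < \<mu>"
  shows "t * reaction l \<mu> \<alpha> \<beta> s \<le> reaction l' \<mu>' \<alpha> \<beta> (t * s)"
proof -
  define A where "A = t powr \<alpha> * s powr \<alpha>"
  have A: "0 \<le> A" by (simp add: A_def)
  have "t powr \<beta> \<le> t powr 1" using t \<beta> by (intro powr_mono') auto
  then have t\<beta>: "t powr \<beta> \<le> t" using t by simp
  have "\<mu>' * (t powr \<beta> * s powr \<beta>) - \<mu> * (t * s powr \<beta>) \<le> (\<mu>' - \<mu>) * (t powr \<beta> * s powr \<beta>)"
  proof -
    have "\<mu> * (t powr \<beta> * s powr \<beta>) \<le> \<mu> * (t * s powr \<beta>)"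
      using t\<beta> \<mu> by (intro mult_left_mono mult_right_mono) auto
    then show ?thesis by (simp add: algebra_simps)
  qed
  also have "\<dots> \<le> \<bar>\<mu>' - \<mu>\<bar> * (t powr \<beta> * s powr \<beta>)" by (intro mult_right_mono) auto
  also have "\<dots> \<le> \<bar>\<mu>' - \<mu>\<bar> * (A * m powr (\<beta> - \<alpha>))"
  proof (rule mult_left_mono)
    have "t powr \<beta> * s powr \<beta> \<le> t powr \<alpha> * (s powr \<alpha> * s powr (\<beta> - \<alpha>))"
      using t s \<alpha> \<beta> by (intro mult_mono powr_mono') (auto simp flip: powr_add)
    also have "\<dots> \<le> t powr \<alpha> * (s powr \<alpha> * m powr (\<beta> - \<alpha>))"
      using s \<alpha> \<beta> by (intro mult_left_mono powr_mono2) auto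
    finally show "t powr \<beta> * s powr \<beta> \<le> A * m powr (\<beta> - \<alpha>)" by (simp add: A_def mult_ac)
  qed simp
  also have "\<dots> \<le> A * (l' - t powr (1 - \<alpha>) * l)"
  proof -
    have "A * (\<bar>\<mu>' - \<mu>\<bar> * m powr (\<beta> - \<alpha>)) \<le> A * (l' - t powr (1 - \<alpha>) * l)"
      using close A by (intro mult_left_mono) auto
    then show ?thesis by (simp add: mult_ac)
  qed
  also have "\<dots> = l' * (t powr \<alpha> * s powr \<alpha>) - (t powr \<alpha> * t powr (1 - \<alpha>)) * l * s powr \<alpha>"
    by (simp add: A_def algebra_simps)
  also have "t powr \<alpha> * t powr (1 - \<alpha>) = t" using t by (simp flip: powr_add)
  finally show ?thesis
    using t s by (simp add: reaction_def powr_mult algebra_simps)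
qed

lemma scaled_maximal_le:
  assumes \<alpha>: "0 \<le> \<alpha>" "\<alpha> < 1" and \<beta>: "1 \<le> \<beta>" and m: "0 < m" and t: "0 < t" "t \<le> 1"
    and P: "0 < l" "0 < \<mu>" "l * m powr \<alpha> \<le> \<mu> * m powr \<beta>"
    and P': "0 < l'" "0 < \<mu>'" "l' * m powr \<alpha> \<le> \<mu>' * m powr \<beta>"
    and U: "maximal_in \<alpha> \<beta> m l \<mu> U" and U': "maximal_in \<alpha> \<beta> m l' \<mu>' U'"
    and close: "t powr (1 - \<alpha>) * l + \<bar>\<mu>' - \<mu>\<bar> * m powr (\<beta> - \<alpha>) \<le> l'"
  shows "AE x in M. t * fst (U x) \<le> fst (U' x)"
proof -
  interpret P: sublinear_problem \<Omega> l \<mu> \<alpha> \<beta> m by unfold_locales (use \<alpha> \<beta> m P in auto)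
  interpret P': sublinear_problem \<Omega> l' \<mu>' \<alpha> \<beta> m by unfold_locales (use \<alpha> \<beta> m P' in auto)
  let ?V = "\<lambda>x. t *\<^sub>R U x"
  have range: "AE x in M. 0 < fst (U x) \<and> fst (U x) \<le> m" and eq: "weakly_eq U (\<lambda>x. reaction l \<mu> \<alpha> \<beta> (fst (U x)))"
    using U by (auto simp: maximal_in_def)
  have UG: "U \<in> H10_graph \<Omega>" using eq by (simp add: weakly_eq_def)
  have rU: "AE x in M. 0 \<le> fst (U x) \<and> fst (U x) \<le> m" using range by eventually_elim auto
  have rV: "AE x in M. 0 \<le> fst (?V x) \<and> fst (?V x) \<le> m"
    using range
  proof eventually_elim
    case (elim x)
    then have "t * fst (U x) \<le> 1 * m" using t by (intro mult_mono) auto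
    with elim t show ?case by simp
  qed
  have "weakly_le ?V (\<lambda>x. t * reaction l \<mu> \<alpha> \<beta> (fst (U x)))"
    using weakly_eq_imp_le[OF eq] t by (intro weakly_le_scale) auto
  then have "weakly_le ?V (\<lambda>x. reaction l' \<mu>' \<alpha> \<beta> (fst (?V x)))"
  proof (rule weakly_le_mono)
    show "(\<lambda>x. t * reaction l \<mu> \<alpha> \<beta> (fst (U x))) \<in> L2 M"
      using L2_scale[OF P.F_L2[OF P.graph_measurable[OF UG] rU], of t] by (simp add: P.F_def)
    show "(\<lambda>x. reaction l' \<mu>' \<alpha> \<beta> (fst (?V x))) \<in> L2 M"
      using P'.F_L2[OF P.graph_measurable[OF H10_graph_scale[OF UG]] rV] by (simp add: P'.F_def)
    show "AE x in M. t * reaction l \<mu> \<alpha> \<beta> (fst (U x)) \<le> reaction l' \<mu>' \<alpha> \<beta> (fst (?V x))"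
      using range by eventually_elim (use scaled_reaction_le[OF \<alpha>(2) \<beta> t _ _ close P(2)] in auto)
  qed
  then have "AE x in M. fst (?V x) \<le> fst (U' x)"
    using U' rV unfolding maximal_in_def by blast
  then show ?thesis by simp
qed

text \<open>For each \<open>t < 1\<close> the scaling comparison holds in both directions for all large indices. Together
  with the bound \<open>m\<close> this confines the difference to an interval of length proportional to \<open>1 - t\<close>. Letting
  \<open>t\<close> run through a sequence tending to \<open>1\<close> keeps the exceptional sets countable in number.\<close>

lemma maximal_tendsto_AE:
  assumes \<alpha>: "0 \<le> \<alpha>" "\<alpha> < 1" and \<beta>: "1 \<le> \<beta>" and m: "0 < m"
    and P: "0 < l" "0 < \<mu>" "l * m powr \<alpha> \<le> \<mu> * m powr \<beta>"
    and Pn: "\<And>n. 0 < ls n" "\<And>n. 0 < \<mu>s n" "\<And>n. ls n * m powr \<alpha> \<le> \<mu>s n * m powr \<beta>"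
    and U: "maximal_in \<alpha> \<beta> m l \<mu> U" and Us: "\<And>n. maximal_in \<alpha> \<beta> m (ls n) (\<mu>s n) (Us n)"
    and lim: "ls \<longlonglongrightarrow> l" "\<mu>s \<longlonglongrightarrow> \<mu>"
  shows "AE x in M. (\<lambda>n. fst (Us n x)) \<longlonglongrightarrow> fst (U x)"
proof -
  \<comment> \<open>a sequence in \<open>(0, 1)\<close> tending to \<open>1\<close>; the summand 2 keeps \<open>t\<^sub>0\<close> positive\<close>
  define t where "t j = 1 - inverse (real j + 2)" for j :: nat
  have t: "0 < t j" "t j < 1" for j
    by (auto simp: t_def inverse_eq_divide field_simps)
  have "\<exists>N. \<forall>n\<ge>N. t j powr (1 - \<alpha>) * l + \<bar>\<mu>s n - \<mu>\<bar> * m powr (\<beta> - \<alpha>) \<le> ls n \<and>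
      t j powr (1 - \<alpha>) * ls n + \<bar>\<mu> - \<mu>s n\<bar> * m powr (\<beta> - \<alpha>) \<le> l" for j
  proof -
    have "t j powr (1 - \<alpha>) < 1"
      using powr_less_mono2[of "1 - \<alpha>" "t j" 1] t[of j] \<alpha> by simp
    then have less: "t j powr (1 - \<alpha>) * l < l" using P(1) by simp
    have "(\<lambda>n. ls n - (t j powr (1 - \<alpha>) * l + \<bar>\<mu>s n - \<mu>\<bar> * m powr (\<beta> - \<alpha>))) \<longlonglongrightarrow>
        l - (t j powr (1 - \<alpha>) * l + \<bar>\<mu> - \<mu>\<bar> * m powr (\<beta> - \<alpha>))"
      by (intro tendsto_intros lim)
    then have 1: "\<forall>\<^sub>F n in sequentially. 0 < ls n - (t j powr (1 - \<alpha>) * l + \<bar>\<mu>s n - \<mu>\<bar> * m powr (\<beta> - \<alpha>))"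
      by (rule order_tendstoD) (use less in simp)
    have "(\<lambda>n. l - (t j powr (1 - \<alpha>) * ls n + \<bar>\<mu> - \<mu>s n\<bar> * m powr (\<beta> - \<alpha>))) \<longlonglongrightarrow>
        l - (t j powr (1 - \<alpha>) * l + \<bar>\<mu> - \<mu>\<bar> * m powr (\<beta> - \<alpha>))"
      by (intro tendsto_intros lim)
    then have 2: "\<forall>\<^sub>F n in sequentially. 0 < l - (t j powr (1 - \<alpha>) * ls n + \<bar>\<mu> - \<mu>s n\<bar> * m powr (\<beta> - \<alpha>))"
      by (rule order_tendstoD) (use less in simp)
    have "\<forall>\<^sub>F n in sequentially. t j powr (1 - \<alpha>) * l + \<bar>\<mu>s n - \<mu>\<bar> * m powr (\<beta> - \<alpha>) \<le> ls n \<and>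
      t j powr (1 - \<alpha>) * ls n + \<bar>\<mu> - \<mu>s n\<bar> * m powr (\<beta> - \<alpha>) \<le> l"
      using 1 2 by eventually_elim auto
    then show ?thesis by (simp add: eventually_sequentially)
  qed
  then have "\<forall>j. \<exists>N. \<forall>n\<ge>N. t j powr (1 - \<alpha>) * l + \<bar>\<mu>s n - \<mu>\<bar> * m powr (\<beta> - \<alpha>) \<le> ls n \<and>
      t j powr (1 - \<alpha>) * ls n + \<bar>\<mu> - \<mu>s n\<bar> * m powr (\<beta> - \<alpha>) \<le> l" by (rule allI)
  from choice[OF this] obtain N
    where N': "\<forall>j. \<forall>n\<ge>N j. t j powr (1 - \<alpha>) * l + \<bar>\<mu>s n - \<mu>\<bar> * m powr (\<beta> - \<alpha>) \<le> ls n \<and>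
      t j powr (1 - \<alpha>) * ls n + \<bar>\<mu> - \<mu>s n\<bar> * m powr (\<beta> - \<alpha>) \<le> l" ..
  have N: "t j powr (1 - \<alpha>) * l + \<bar>\<mu>s n - \<mu>\<bar> * m powr (\<beta> - \<alpha>) \<le> ls n"
    "t j powr (1 - \<alpha>) * ls n + \<bar>\<mu> - \<mu>s n\<bar> * m powr (\<beta> - \<alpha>) \<le> l" if "N j \<le> n" for j n
    using N' that by blast+
  have "AE x in M. N j \<le> n \<longrightarrow> t j * fst (U x) \<le> fst (Us n x) \<and> t j * fst (Us n x) \<le> fst (U x)" for j n
  proof (cases "N j \<le> n")
    case True
    note up = scaled_maximal_le[OF \<alpha> \<beta> m t(1) less_imp_le[OF t(2)] P Pn U Us N(1)[OF True]]
      and down = scaled_maximal_le[OF \<alpha> \<beta> m t(1) less_imp_le[OF t(2)] Pn P Us U N(2)[OF True]]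
    from up down show ?thesis by eventually_elim simp
  qed simp
  then have "AE x in M. \<forall>j n. N j \<le> n \<longrightarrow> t j * fst (U x) \<le> fst (Us n x) \<and> t j * fst (Us n x) \<le> fst (U x)"
    by (intro AE_all_countable[THEN iffD2] allI)
  moreover have "AE x in M. \<forall>n. fst (Us n x) \<le> m"
    unfolding AE_all_countable using Us by (auto simp: maximal_in_def elim: eventually_mono)
  moreover have "AE x in M. fst (U x) \<le> m" using U by (auto simp: maximal_in_def elim: eventually_mono)
  ultimately show ?thesis
  proof eventually_elim
    case (elim x)
    show ?case
    proof (rule LIMSEQ_I)
      fix e :: real assume "e > 0"
      then obtain j where j: "inverse (real (Suc j)) < e / m" using m reals_Archimedean[of "e / m"] by auto
      define \<delta> where "\<delta> = inverse (real j + 2)"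
      have \<delta>: "0 < \<delta>" "\<delta> * m < e"
      proof -
        have "\<delta> < inverse (real (Suc j))" by (simp add: \<delta>_def field_simps)
        with j have "\<delta> < e / m" by linarith
        with m show "\<delta> * m < e" by (simp add: pos_less_divide_eq)
      qed (simp add: \<delta>_def)
      have "norm (fst (Us n x) - fst (U x)) < e" if "N j \<le> n" for n
      proof -
        have "(1 - \<delta>) * fst (U x) \<le> fst (Us n x)" "(1 - \<delta>) * fst (Us n x) \<le> fst (U x)"
          using elim(1) that by (auto simp: t_def \<delta>_def)
        moreover have "\<delta> * fst (U x) \<le> \<delta> * m" "\<delta> * fst (Us n x) \<le> \<delta> * m"
          using elim(2,3) \<delta>(1) by (auto intro: mult_left_mono)
        ultimately show ?thesis using \<delta>(2) unfolding real_norm_def abs_less_iff by (simp add: algebra_simps)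
      qed
      then show "\<exists>N. \<forall>n\<ge>N. norm (fst (Us n x) - fst (U x)) < e" by blast
    qed
  qed
qed

lemma power_integral_bounds:
  fixes u :: "'a \<Rightarrow> real"
  assumes u: "u \<in> borel_measurable M" "AE x in M. 0 < u x \<and> u x \<le> m" and s: "0 \<le> s"
  shows "0 \<le> (LINT x|M. \<bar>u x\<bar> powr s)" "(LINT x|M. \<bar>u x\<bar> powr s) \<le> m powr s * measure M (space M)"
proof -
  show "0 \<le> (LINT x|M. \<bar>u x\<bar> powr s)" by (rule Bochner_Integration.integral_nonneg) simp
  have b: "AE x in M. \<bar>u x\<bar> powr s \<le> m powr s"
    using u(2) by eventually_elim (auto intro: powr_mono2 s)
  have "integrable M (\<lambda>x. \<bar>u x\<bar> powr s)"
    by (rule integrable_const_bound[of _ "m powr s"]) (use b u in auto)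
  then have "(LINT x|M. \<bar>u x\<bar> powr s) \<le> (LINT x|M. m powr s)"
    using b by (intro integral_mono_AE) auto
  then show "(LINT x|M. \<bar>u x\<bar> powr s) \<le> m powr s * measure M (space M)" by (simp add: mult.commute)
qed

lemma power_integral_tendsto:
  fixes u :: "'a \<Rightarrow> real" and un :: "nat \<Rightarrow> 'a \<Rightarrow> real"
  assumes u: "u \<in> borel_measurable M" "AE x in M. 0 < u x"
    and un: "\<And>n. un n \<in> borel_measurable M" "\<And>n. AE x in M. 0 < un n x \<and> un n x \<le> m"
    and s: "0 \<le> s" and lim: "AE x in M. (\<lambda>n. un n x) \<longlonglongrightarrow> u x"
  shows "(\<lambda>n. LINT x|M. \<bar>un n x\<bar> powr s) \<longlonglongrightarrow> (LINT x|M. \<bar>u x\<bar> powr s)"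
proof (rule integral_dominated_convergence[where w="\<lambda>x. m powr s"])
  show "integrable M (\<lambda>x. m powr s)" by simp
  show "AE x in M. (\<lambda>n. \<bar>un n x\<bar> powr s) \<longlonglongrightarrow> \<bar>u x\<bar> powr s"
    using lim u(2)
  proof eventually_elim
    case (elim x)
    then show ?case by (intro tendsto_powr tendsto_rabs tendsto_const) auto
  qed
  show "AE x in M. norm (\<bar>un n x\<bar> powr s) \<le> m powr s" for n
    using un(2)[of n] by eventually_elim (auto intro: powr_mono2 s)
qed (use u un in measurable)

lemma maximal_in_weak_solution:
  assumes U: "maximal_in \<alpha> \<beta> m (F0 / A0) (G0 / A0) U" and A0: "0 < A0" and \<alpha>: "0 \<le> \<alpha>" and \<beta>: "0 \<le> \<beta>"
    and A: "a (LINT x|M. \<bar>fst (U x)\<bar> powr q) = A0" and F: "f (LINT x|M. \<bar>fst (U x)\<bar> powr p) = F0"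
    and G: "g (LINT x|M. \<bar>fst (U x)\<bar> powr r) = G0"
  shows "weak_solution \<Omega> a f g p q r \<alpha> \<beta> (\<lambda>x. fst (U x))"
proof -
  have UG: "U \<in> H10_graph \<Omega>" and range: "AE x in M. 0 < fst (U x) \<and> fst (U x) \<le> m"
    using U by (auto simp: maximal_in_def weakly_eq_def)
  note um = L2_measurable[OF L2_fst[OF H10_graph_L2[OF UG]]]
  have uH: "(\<lambda>x. fst (U x)) \<in> H10 \<Omega>" by (rule H10_graph_imp(1)[OF UG])
  have powL: "(\<lambda>x. fst (U x) powr \<gamma>) \<in> L2 M" if "0 \<le> \<gamma>" for \<gamma>
  proof (rule L2_bounded[where C="m powr \<gamma>"])
    show "(\<lambda>x. fst (U x) powr \<gamma>) \<in> borel_measurable M" using um by measurable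
    show "AE x in M. norm (fst (U x) powr \<gamma>) \<le> m powr \<gamma>"
      using range by eventually_elim (auto intro: powr_mono2 that)
  qed
  have "A0 * (LINT x|M. weak_gradient \<Omega> (\<lambda>x. fst (U x)) x \<bullet> weak_gradient \<Omega> \<phi> x) =
      F0 * (LINT x|M. fst (U x) powr \<alpha> * \<phi> x) - G0 * (LINT x|M. fst (U x) powr \<beta> * \<phi> x)"
    if \<phi>: "\<phi> \<in> H10 \<Omega>" for \<phi>
  proof -
    let ?Z = "\<lambda>x. (\<phi> x, weak_gradient \<Omega> \<phi> x)"
    have Z: "?Z \<in> H10_graph \<Omega>" by (rule H10_imp_graph[OF \<phi>])
    have ZL: "\<phi> \<in> L2 M" "weak_gradient \<Omega> \<phi> \<in> L2 M" using H10_graph_L2[OF Z] by (simp_all add: L2_Pair_iff)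
    have wL: "weak_gradient \<Omega> (\<lambda>x. fst (U x)) \<in> L2 M"
      using H10_graph_L2[OF H10_imp_graph[OF uH]] by (simp add: L2_Pair_iff)
    note int = L2_mult_integrable[OF powL[OF \<alpha>] ZL(1)] L2_mult_integrable[OF powL[OF \<beta>] ZL(1)]
    have "(LINT x|M. weak_gradient \<Omega> (\<lambda>x. fst (U x)) x \<bullet> weak_gradient \<Omega> \<phi> x) = dirichlet U ?Z"
      unfolding dirichlet_def snd_conv
    proof (rule integral_cong_AE)
      show "(\<lambda>x. weak_gradient \<Omega> (\<lambda>x. fst (U x)) x \<bullet> weak_gradient \<Omega> \<phi> x) \<in> borel_measurable M"
        "(\<lambda>x. snd (U x) \<bullet> weak_gradient \<Omega> \<phi> x) \<in> borel_measurable M"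
        using L2_measurable[OF wL] L2_measurable[OF ZL(2)] L2_measurable[OF L2_snd[OF H10_graph_L2[OF UG]]]
        by (auto intro: borel_measurable_inner)
      show "AE x in M. weak_gradient \<Omega> (\<lambda>x. fst (U x)) x \<bullet> weak_gradient \<Omega> \<phi> x = snd (U x) \<bullet> weak_gradient \<Omega> \<phi> x"
        using H10_graph_imp(2)[OF UG] by eventually_elim simp
    qed
    also have "\<dots> = (LINT x|M. reaction (F0 / A0) (G0 / A0) \<alpha> \<beta> (fst (U x)) * fst (?Z x))"
      using U Z unfolding maximal_in_def weakly_eq_def by blast
    also have "\<dots> = (LINT x|M. (F0 / A0) * (fst (U x) powr \<alpha> * \<phi> x) - (G0 / A0) * (fst (U x) powr \<beta> * \<phi> x))"
      by (simp add: reaction_def algebra_simps)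
    also have "\<dots> = (F0 / A0) * (LINT x|M. fst (U x) powr \<alpha> * \<phi> x) - (G0 / A0) * (LINT x|M. fst (U x) powr \<beta> * \<phi> x)"
      using int by simp
    finally show ?thesis using A0 by (simp add: right_diff_distrib)
  qed
  moreover have "(\<lambda>x. fst (U x)) \<in> Linfty M"
  proof -
    have "AE x in M. \<bar>fst (U x)\<bar> \<le> m" using range by eventually_elim simp
    with um show ?thesis by (auto simp: Linfty_def)
  qed
  moreover have "AE x in M. 0 < fst (U x)" using range by eventually_elim simp
  ultimately show ?thesis
    unfolding weak_solution_def A F G using uH by blast
qed

end

theorem theorem4p2:
  fixes \<Omega> :: "'a::euclidean_space set"
    and a f g :: "real \<Rightarrow> real"
    and a0 p q r \<alpha> \<beta> :: real
  assumes "open \<Omega>" and "connected \<Omega>" and "\<Omega> \<noteq> {}" and "bounded \<Omega>" and "smooth_boundary \<Omega>"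
    and "continuous_on {0..} a" and "continuous_on {0..} f" and "continuous_on {0..} g"
    and "f \<in> Linfty (lebesgue_on {0..})" and "g \<in> Linfty (lebesgue_on {0..})"
    and "a0 > 0"
    and "(INF t\<in>{0..}. ereal (a t)) \<ge> ereal a0"
    and "(INF t\<in>{0..}. ereal (f t)) \<ge> ereal a0"
    and "(INF t\<in>{0..}. ereal (g t)) \<ge> ereal a0"
    and "p \<ge> 1" and "q \<ge> 1" and "r \<ge> 1" and "\<beta> \<ge> 1" and "0 \<le> \<alpha>" and "\<alpha> < 1"
  shows "\<exists>u. weak_solution \<Omega> a f g p q r \<alpha> \<beta> u"
proof -
  interpret bounded_open \<Omega> by unfold_locales fact+
  have lower: "a0 \<le> a t" "a0 \<le> f t" "a0 \<le> g t" if "0 \<le> t" for t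
    using assms(12-14) that by (auto simp: le_INF_iff)
  obtain C where C: "\<And>t. 0 \<le> t \<Longrightarrow> f t \<le> C" using continuous_Linfty_bound assms(7,9) by blast
  have C0: "0 < C" using lower(2)[of 0] C[of 0] \<open>a0 > 0\<close> by simp
  \<comment> \<open>the solution of \<open>C m\<^sup>\<alpha> = a0 m\<^sup>\<beta>\<close>, so that \<open>m\<close> is a supersolution for all admissible parameters\<close>
  define m where "m = (C / a0) powr (1 / (\<beta> - \<alpha>))"
  have m: "0 < m" using C0 \<open>a0 > 0\<close> by (simp add: m_def)
  have m_powr: "m powr (\<beta> - \<alpha>) = C / a0" using assms(18-20) C0 \<open>a0 > 0\<close> by (simp add: m_def powr_powr)
  define l \<mu> where "l t = f (fst (snd t)) / a (fst t)" and "\<mu> t = g (snd (snd t)) / a (fst t)" for t :: "real \<times> real \<times> real"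
  define B where "B s = m powr s * measure M (space M)" for s
  define K where "K = cbox (0, 0, 0) (B q, B p, B r)"
  have K: "0 \<le> fst t" "0 \<le> fst (snd t)" "0 \<le> snd (snd t)" if "t \<in> K" for t
    using that by (auto simp: K_def cbox_Pair_eq)
  have pos: "0 < l t" "0 < \<mu> t" "l t * m powr \<alpha> \<le> \<mu> t * m powr \<beta>" if "t \<in> K" for t
  proof -
    note low = lower(1)[OF K(1)[OF that]] lower(2)[OF K(2)[OF that]] lower(3)[OF K(3)[OF that]]
    show "0 < l t" "0 < \<mu> t" using low \<open>a0 > 0\<close> by (auto simp: l_def \<mu>_def)
    have "f (fst (snd t)) \<le> a0 * (C / a0)" using C[OF K(2)[OF that]] \<open>a0 > 0\<close> by simp
    also have "\<dots> \<le> g (snd (snd t)) * m powr (\<beta> - \<alpha>)"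
      unfolding m_powr using low C0 \<open>a0 > 0\<close> by (intro mult_right_mono) auto
    finally have "f (fst (snd t)) * m powr \<alpha> \<le> g (snd (snd t)) * m powr (\<beta> - \<alpha>) * m powr \<alpha>"
      by (rule mult_right_mono) simp
    also have "\<dots> = g (snd (snd t)) * m powr \<beta>" by (simp add: mult.assoc flip: powr_add)
    finally show "l t * m powr \<alpha> \<le> \<mu> t * m powr \<beta>"
      using low \<open>a0 > 0\<close> by (simp add: l_def \<mu>_def divide_right_mono)
  qed
  have "\<exists>U. maximal_in \<alpha> \<beta> m (l t) (\<mu> t) U" if "t \<in> K" for t
  proof -
    interpret P: sublinear_problem \<Omega> "l t" "\<mu> t" \<alpha> \<beta> m
      by unfold_locales (use assms(18-20) m pos[OF that] in auto)
    obtain U where "weakly_eq U (\<lambda>x. P.F (fst (U x)))" "AE x in M. 0 < fst (U x) \<and> fst (U x) \<le> m"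
      "\<And>V. weakly_le V (\<lambda>x. P.F (fst (V x))) \<Longrightarrow> AE x in M. 0 \<le> fst (V x) \<and> fst (V x) \<le> m \<Longrightarrow>
        AE x in M. fst (V x) \<le> fst (U x)" by (rule P.maximal_solution) blast
    then have "maximal_in \<alpha> \<beta> m (l t) (\<mu> t) U" by (simp add: maximal_in_def P.F_def)
    then show ?thesis by (rule exI[of _ U])
  qed
  then obtain U where U: "\<And>t. t \<in> K \<Longrightarrow> maximal_in \<alpha> \<beta> m (l t) (\<mu> t) (U t)" by metis
  have um: "(\<lambda>x. fst (U t x)) \<in> borel_measurable M" and ur: "AE x in M. 0 < fst (U t x) \<and> fst (U t x) \<le> m" if "t \<in> K" for t
    using U[OF that] by (auto simp: maximal_in_def weakly_eq_def intro: L2_measurable L2_fst H10_graph_L2)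
  define J where "J s t = (LINT x|M. \<bar>fst (U t x)\<bar> powr s)" for s t
  define T where "T t = (J q t, J p t, J r t)" for t
  have cont: "continuous_on K (J s)" if s: "1 \<le> s" for s
    unfolding continuous_on_sequentially
  proof (intro allI ballI impI, elim conjE)
    fix tn t assume t: "t \<in> K" and tn: "\<forall>n. tn n \<in> K" and lim: "tn \<longlonglongrightarrow> t"
    have comp: "(\<lambda>n. h (c (tn n))) \<longlonglongrightarrow> h (c t)"
      if "continuous_on {0..} h" "\<And>t. t \<in> K \<Longrightarrow> 0 \<le> c t" "(\<lambda>n. c (tn n)) \<longlonglongrightarrow> c t" for h c :: "_ \<Rightarrow> real"
      using continuous_on_tendsto_compose[OF that(1,3)] that(2) t tn by simp
    have "a (fst t) \<noteq> 0" using lower(1)[OF K(1)[OF t]] \<open>a0 > 0\<close> by simp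
    then have limits: "(\<lambda>n. l (tn n)) \<longlonglongrightarrow> l t" "(\<lambda>n. \<mu> (tn n)) \<longlonglongrightarrow> \<mu> t"
      unfolding l_def \<mu>_def using assms(6-8) lim
      by (auto intro!: tendsto_divide comp[of _ fst] comp[of _ "\<lambda>t. fst (snd t)"] comp[of _ "\<lambda>t. snd (snd t)"] K tendsto_intros)
    have "AE x in M. (\<lambda>n. fst (U (tn n) x)) \<longlonglongrightarrow> fst (U t x)"
      by (rule maximal_tendsto_AE[where l="l t" and \<mu>="\<mu> t" and ls="\<lambda>n. l (tn n)" and \<mu>s="\<lambda>n. \<mu> (tn n)" and m=m and \<alpha>=\<alpha> and \<beta>=\<beta>])
         (use assms(18-20) m pos U t tn limits in auto)
    moreover have "AE x in M. 0 < fst (U t x)" using ur[OF t] by eventually_elim simp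
    ultimately have "(\<lambda>n. J s (tn n)) \<longlonglongrightarrow> J s t"
      unfolding J_def using tn s by (intro power_integral_tendsto[where m=m] um[OF t] um ur) auto
    then show "(J s \<circ> tn) \<longlonglongrightarrow> J s t" by (simp add: comp_def)
  qed
  obtain t where t: "t \<in> K" "T t = t"
  proof (rule brouwer[of K T])
    have "0 \<le> B s" for s by (simp add: B_def)
    then have "(0, 0, 0) \<in> K" by (simp add: K_def cbox_Pair_eq)
    then show "K \<noteq> {}" by blast
    show "continuous_on K T"
      unfolding T_def using assms(15-17) by (intro continuous_on_Pair cont)
    have "J s t \<in> cbox 0 (B s)" if "t \<in> K" "1 \<le> s" for s t
      unfolding J_def B_def using power_integral_bounds[OF um[OF that(1)] ur[OF that(1)], of s] that(2) by simp
    then show "T \<in> K \<rightarrow> K"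
      using assms(15-17) by (auto simp: T_def K_def cbox_Pair_eq)
  qed (auto simp: K_def)
  have fp: "J q t = fst t" "J p t = fst (snd t)" "J r t = snd (snd t)"
    using t(2) by (auto simp: T_def prod_eq_iff)
  have "weak_solution \<Omega> a f g p q r \<alpha> \<beta> (\<lambda>x. fst (U t x))"
  proof (rule maximal_in_weak_solution)
    show "maximal_in \<alpha> \<beta> m (f (fst (snd t)) / a (fst t)) (g (snd (snd t)) / a (fst t)) (U t)"
      using U[OF t(1)] by (simp add: l_def \<mu>_def)
    show "0 < a (fst t)" using lower(1)[OF K(1)[OF t(1)]] \<open>a0 > 0\<close> by simp
  qed (use assms(18-20) fp in \<open>auto simp: J_def\<close>)
  then show ?thesis by blast
qed

end
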